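(* Fix an action $a\in\mathcal A$, a score function $g:\mathcal X\times\mathbb R\times\mathbb R^d\to\mathbb R^d$, and let $\theta_a^*\in\mathbb R^d$ satisfy $\mathbb E[g(X,Y(a);\theta_a^* )]=0$. Assume: (1) $A_t\perp\{Y_t(a')\}_{a'\in\mathcal A}\mid(\mathcal H_{t-1},X_t)$ for all $t$. (2) For all $\epsilon>0$, $\inf_{\|\theta-\theta_a^*\|_2>\epsilon}\|\mathbb E[g(X_t,Y_t(a);\theta)]\|_2>0$. (3) There are constants $R_\theta,M_2$ such that (i) $\|\mathbb E[g(X_t,Y_t(a);\theta_a^* )g(X_t,Y_t(a);\theta_a^* )^\top\mid X_t]\|_2\le M_2$ for a.e. $X_t$; (ii) $\|\theta_a^*\|_2<R_\theta$ and $\sup_{\|\theta\|_2\le R_\theta}\mathbb E[\|g(X_t,Y_t(a);\theta)\|_2^2]<\infty$; (iii) $\mathbb E[\|g(X_t,Y_t(a);\theta_a^* )\|_2^4]<\infty$. (4) (i) $g(x,y;\theta)$ is twice differentiable in $\theta$, and $\mathbb E[\nabla g(X_t,Y_t(a);\theta_a^* )]$ is nonsingular; (ii) there is $\phi$ with $\sup_{\|\theta\|_2\le R_\theta}\|\nabla g(x,y;\theta)\|_2\le\phi(x,y)$ for all $x,y$ and $\mathbb E[\phi(X_t,Y_t(a))^2]<\infty$; (iii) there are $\epsilon_0>0$ and $\Phi$ with $\sup_{\|\theta-\theta_a^*\|_2\le\epsilon_0,\,i\in[d]}\|\nabla^2g^{(i)}(x,y;\theta)\|_2\le\Phi(x,y)$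 and $\mathbb E[\Phi(X_t,Y_t(a))]<\infty$, where $g^{(i)}$ is the $i$-th entry of $g$. (5) $\pi_t(a)\ge\pi_{\min}$ almost surely for some constant $\pi_{\min}\in(0,1)$. (6) There is a stationary policy $\bar\pi:\mathcal X\to\Delta(\mathcal A)$ with $\pi_t(a\mid X_t,\mathcal H_{t-1})-\bar\pi(a\mid X_t)\xrightarrow{p}0$ as $t\to\infty$. Let $\{\hat\theta_a^{(T)}\}_{T\ge1}$ be any estimator sequence with $\|\hat\theta_a^{(T)}\|_2\le R_\theta$ for all $T$ and $\frac1T\sum_{t=1}^T\frac{1_{\{A_t=a\}}}{\pi_t(A_t)}g(X_t,Y_t;\hat\theta_a^{(T)})=o_p(1/\sqrt T)$. Set $$\hat{\dot G}_{a,T}=\frac1T\sum_{t=1}^T\frac{1_{\{A_t=a\}}}{\pi_t(A_t)}\nabla g(X_t,Y_t;\hat\theta_a^{(T)}),\qquad \hat I_{a,T}=\frac1T\sum_{t=1}^T\frac{1_{\{A_t=a\}}}{\pi_t(A_t)^2}g(X_t,Y_t;\hat\theta_a^{(T)})g(X_t,Y_t;\hat\theta_a^{(T)})^\top.$$ Then $\hat\Sigma_a=[\hat{\dot G}_{a,T}]^{-1}\hat I_{a,T}\big([\hat{\dot G}_{a,T}]^{-1}\big)^\top$ is a consistent estimator (as $T\to\infty$, in probability) of $\Sigma_a^*=J_a^{-1}\bar I_a(J_a^{-1})^\top$, where $\bar I_a=\mathbb E\big[\frac1{\bar\pi(a\mid X_t)}g(X_t,Y_t(a);\theta_a^* )g(X_t,Y_t(a);\theta_a^*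 )^\top\big]$ and $J_a=\mathbb E[\nabla g(X_t,Y_t(a);\theta_a^* )]$.
   Context: Contextual bandit setting. Contexts $X_t\in\mathcal X\subseteq\mathbb R^{d_X}$, finite action set $\mathcal A=\{1,\dots,K\}$, potential outcomes $Y_t(a)\in\mathbb R$; the tuples $(X_t,\{Y_t(a)\}_{a\in\mathcal A})$, $t\ge1$, are i.i.d., with generic copy $(X,\{Y(a)\})$. At time $t$, given the history $\mathcal H_{t-1}=\{X_\tau,\pi_\tau,A_\tau,Y_\tau\}_{\tau<t}$ and $X_t$, the action $A_t$ is drawn from the behavior policy $\pi_t(\cdot\mid X_t,\mathcal H_{t-1})\in\Delta(\mathcal A)$ (probability distributions on $\mathcal A$), and the outcome $Y_t=Y_t(A_t)$ is observed. The tuple $(X_t,\{Y_t(a)\}_a)$ is independent of $\mathcal H_{t-1}$. We abbreviate $\pi_t(a)=\pi_t(a\mid X_t,\mathcal H_{t-1})$. $\nabla g$ denotes the Jacobian of $g$ in $\theta$, $\nabla^2 g^{(i)}$ the Hessian in $\theta$; $\|\cdot\|_2$ is the Euclidean norm of vectors and the spectral norm of matrices. *)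

theory Defs
  imports "HOL-Probability.Probability"
begin

section \<open>Probabilistic notions\<close>

definition gen_algebra :: "'w measure \<Rightarrow> 'b measure \<Rightarrow> ('w \<Rightarrow> 'b) \<Rightarrow> 'w measure" where
  "gen_algebra M N U = vimage_algebra (space M) U N"

definition cond_indep ::
  "'w measure \<Rightarrow> 'w measure \<Rightarrow> 'b measure \<Rightarrow> ('w \<Rightarrow> 'b) \<Rightarrow> 'c measure \<Rightarrow> ('w \<Rightarrow> 'c) \<Rightarrow> bool" where
  "cond_indep M F N1 U N2 V \<longleftrightarrow>
     (\<forall>B\<in>sets N1. \<forall>C\<in>sets N2. AE \<omega> in M.
        real_cond_exp M F (indicator {\<omega>\<in>space M. U \<omega> \<in> B \<and> V \<omega> \<in> C}) \<omega>
        = real_cond_exp M F (indicator {\<omega>\<in>space M. U \<omega> \<in> B}) \<omega>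
          * real_cond_exp M F (indicator {\<omega>\<in>space M. V \<omega> \<in> C}) \<omega>)"

text \<open>Measurability is part of the definition because \<^const>\<open>measure\<close> is \<open>0\<close> on nonmeasurable
  sets. Sequences are indexed by \<open>n \<ge> 1\<close>; the entry at \<open>0\<close> is irrelevant.\<close>

definition conv_in_prob ::
  "'w measure \<Rightarrow> (nat \<Rightarrow> 'w \<Rightarrow> 'b::metric_space) \<Rightarrow> 'b \<Rightarrow> bool" where
  "conv_in_prob M Z c \<longleftrightarrow>
     (\<forall>n\<ge>1. Z n \<in> borel_measurable M) \<and>
     (\<forall>\<epsilon>>0. (\<lambda>n. measure M {\<omega>\<in>space M. dist (Z n \<omega>) c > \<epsilon>}) \<longlonglongrightarrow> 0)"

definition small_o_prob ::
  "'w measure \<Rightarrow> (nat \<Rightarrow> 'w \<Rightarrow> 'b::real_normed_vector) \<Rightarrow> (nat \<Rightarrow> real) \<Rightarrow> bool" where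
  "small_o_prob M Z r \<longleftrightarrow> conv_in_prob M (\<lambda>n \<omega>. inverse (r n) *\<^sub>R Z n \<omega>) 0"

section \<open>Matrices and derivatives\<close>

text \<open>The library norm on \<open>real^'n^'m\<close> is the Frobenius norm.\<close>

definition spectral_norm :: "real^'n^'m \<Rightarrow> real" where
  "spectral_norm B = onorm (\<lambda>v. B *v v)"

definition outer :: "real^'m \<Rightarrow> real^'n \<Rightarrow> real^'n^'m" where
  "outer v w = (\<chi> i j. v $ i * w $ j)"

definition grad :: "(real^'n \<Rightarrow> real) \<Rightarrow> real^'n \<Rightarrow> real^'n" where
  "grad f \<theta> = (\<chi> j. frechet_derivative f (at \<theta>) (axis j 1))"

definition hessian :: "(real^'n \<Rightarrow> real) \<Rightarrow> real^'n \<Rightarrow> real^'n^'n" where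
  "hessian f \<theta> = jacobian (grad f) (at \<theta>)"

definition twice_differentiable :: "(real^'n \<Rightarrow> real^'m) \<Rightarrow> bool" where
  "twice_differentiable f \<longleftrightarrow>
     (\<forall>\<theta>. f differentiable at \<theta>) \<and>
     (\<forall>\<theta>. (\<lambda>\<eta>. jacobian f (at \<eta>)) differentiable at \<theta>)"

section \<open>The contextual bandit\<close>

text \<open>The actions are the elements of a finite type \<open>'k\<close>; a vector \<open>real^'k\<close> is used both for a
  tuple of potential outcomes and for an element of the simplex of distributions on the actions.
  The context set \<open>S\<close> carries the trace of the Borel \<open>\<sigma>\<close>-algebra and is itself arbitrary.\<close>

definition prob_simplex :: "(real^'k) set" where
  "prob_simplex = {p. (\<forall>a. 0 \<le> p $ a) \<and> (\<Sum>a\<in>UNIV. p $ a) = 1}"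

definition ctx_space :: "(real^'x) set \<Rightarrow> (real^'x) measure" where
  "ctx_space S = restrict_space borel S"

text \<open>The history after \<open>t\<close> rounds assigns to each \<open>\<tau> \<in> {1..t}\<close> the context, the vector of
  behavior-policy probabilities used, the action and the observed outcome.\<close>

type_synonym ('x, 'k) history = "nat \<Rightarrow> (real^'x) \<times> (real^'k) \<times> 'k \<times> real"

type_synonym ('x, 'k) policy = "real^'x \<Rightarrow> ('x, 'k) history \<Rightarrow> real^'k"

definition hist_space :: "(real^'x) set \<Rightarrow> nat \<Rightarrow> ('x::finite, 'k::finite) history measure" where
  "hist_space S t =
     PiM {1..t} (\<lambda>_. ctx_space S \<Otimes>\<^sub>M (borel \<Otimes>\<^sub>M (count_space UNIV \<Otimes>\<^sub>M borel)))"

definition observed ::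
  "(nat \<Rightarrow> 'w \<Rightarrow> real^'k) \<Rightarrow> (nat \<Rightarrow> 'w \<Rightarrow> 'k) \<Rightarrow> nat \<Rightarrow> 'w \<Rightarrow> real" where
  "observed Y A t \<omega> = Y t \<omega> $ A t \<omega>"

primrec hist ::
  "(nat \<Rightarrow> 'w \<Rightarrow> real^'x) \<Rightarrow> (nat \<Rightarrow> 'w \<Rightarrow> real^'k) \<Rightarrow> (nat \<Rightarrow> 'w \<Rightarrow> 'k) \<Rightarrow>
   (nat \<Rightarrow> ('x::finite, 'k::finite) policy) \<Rightarrow> nat \<Rightarrow> 'w \<Rightarrow> ('x, 'k) history" where
  "hist X Y A pol 0 = (\<lambda>\<omega> \<tau>. undefined)"
| "hist X Y A pol (Suc t) = (\<lambda>\<omega>. (hist X Y A pol t \<omega>)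
     (Suc t := (X (Suc t) \<omega>, pol (Suc t) (X (Suc t) \<omega>) (hist X Y A pol t \<omega>),
                A (Suc t) \<omega>, observed Y A (Suc t) \<omega>)))"

text \<open>\<open>behav X Y A pol t \<omega> $ a\<close> is \<open>\<pi>\<^sub>t(a | X\<^sub>t, H\<^sub>t\<^sub>-\<^sub>1)\<close>.\<close>

definition behav ::
  "(nat \<Rightarrow> 'w \<Rightarrow> real^'x) \<Rightarrow> (nat \<Rightarrow> 'w \<Rightarrow> real^'k) \<Rightarrow> (nat \<Rightarrow> 'w \<Rightarrow> 'k) \<Rightarrow>
   (nat \<Rightarrow> ('x::finite, 'k::finite) policy) \<Rightarrow> nat \<Rightarrow> 'w \<Rightarrow> real^'k" where
  "behav X Y A pol t \<omega> = pol t (X t \<omega>) (hist X Y A pol (t - 1) \<omega>)"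

text \<open>The \<open>\<sigma>\<close>-algebra generated by \<open>(X\<^sub>t, H\<^sub>t\<^sub>-\<^sub>1)\<close>.\<close>

definition pre_action_algebra ::
  "'w measure \<Rightarrow> (real^'x) set \<Rightarrow>
   (nat \<Rightarrow> 'w \<Rightarrow> real^'x) \<Rightarrow> (nat \<Rightarrow> 'w \<Rightarrow> real^'k) \<Rightarrow> (nat \<Rightarrow> 'w \<Rightarrow> 'k) \<Rightarrow>
   (nat \<Rightarrow> ('x::finite, 'k::finite) policy) \<Rightarrow> nat \<Rightarrow> 'w measure" where
  "pre_action_algebra M S X Y A pol t =
     gen_algebra M (ctx_space S \<Otimes>\<^sub>M hist_space S (t - 1))
       (\<lambda>\<omega>. (X t \<omega>, hist X Y A pol (t - 1) \<omega>))"

text \<open>\<open>P\<close> is the law of the generic copy \<open>(X, {Y(a)})\<close> on \<open>S \<times> \<real>\<^sup>K\<close>. Rounds are \<open>t \<ge> 1\<close>;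
  \<open>X 0\<close>, \<open>Y 0\<close>, \<open>A 0\<close>, \<open>pol 0\<close> are never used.\<close>

locale contextual_bandit = prob_space M
  for M :: "'w measure" +
  fixes S :: "(real^'x) set"
    and P :: "((real^'x) \<times> (real^'k)) measure"
    and X :: "nat \<Rightarrow> 'w \<Rightarrow> real^'x"
    and Y :: "nat \<Rightarrow> 'w \<Rightarrow> real^'k"
    and A :: "nat \<Rightarrow> 'w \<Rightarrow> 'k"
    and pol :: "nat \<Rightarrow> ('x::finite, 'k::finite) policy"
  assumes iid_indep:
      "indep_vars (\<lambda>_. ctx_space S \<Otimes>\<^sub>M borel) (\<lambda>t \<omega>. (X t \<omega>, Y t \<omega>)) {1..}"
    and iid_law:
      "\<And>t. t \<ge> 1 \<Longrightarrow> distr M (ctx_space S \<Otimes>\<^sub>M borel) (\<lambda>\<omega>. (X t \<omega>, Y t \<omega>)) = P"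
    and action_measurable: "\<And>t. t \<ge> 1 \<Longrightarrow> A t \<in> measurable M (count_space UNIV)"
    and policy_measurable:
      "\<And>t. t \<ge> 1 \<Longrightarrow>
         (\<lambda>(x, h). pol t x h) \<in> borel_measurable (ctx_space S \<Otimes>\<^sub>M hist_space S (t - 1))"
    and policy_simplex:
      "\<And>t x h. t \<ge> 1 \<Longrightarrow> x \<in> S \<Longrightarrow> h \<in> space (hist_space S (t - 1)) \<Longrightarrow>
         pol t x h \<in> prob_simplex"
    and action_law:
      "\<And>t b. t \<ge> 1 \<Longrightarrow>
         AE \<omega> in M. real_cond_exp M (pre_action_algebra M S X Y A pol t)
                      (indicator {\<omega>\<in>space M. A t \<omega> = b}) \<omega> = behav X Y A pol t \<omega> $ b"
    and past_indep:
      "\<And>t. t \<ge> 1 \<Longrightarrow>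
         indep_set
           (sets (gen_algebra M (ctx_space S \<Otimes>\<^sub>M borel) (\<lambda>\<omega>. (X t \<omega>, Y t \<omega>))))
           (sets (gen_algebra M (hist_space S (t - 1)) (hist X Y A pol (t - 1))))"

section \<open>Population quantities and their sample analogues\<close>

type_synonym ('x, 'd) score = "real^'x \<Rightarrow> real \<Rightarrow> real^'d \<Rightarrow> real^'d"

text \<open>\<open>E[g(X,Y(a);\<theta>) g(X,Y(a);\<theta>)\<^sup>T | X]\<close>, entrywise, as a random matrix under the law \<open>P\<close>.\<close>

definition cond_second_moment ::
  "((real^'x) \<times> (real^'k)) measure \<Rightarrow> (real^'x) set \<Rightarrow> ('x::finite, 'd::finite) score \<Rightarrow> 'k \<Rightarrow> real^'d \<Rightarrow>
   (real^'x) \<times> (real^'k) \<Rightarrow> real^'d^'d" where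
  "cond_second_moment P S g a \<theta> z =
     (\<chi> i j. real_cond_exp P (gen_algebra P (ctx_space S) fst)
        (\<lambda>(x, y). outer (g x (y $ a) \<theta>) (g x (y $ a) \<theta>) $ i $ j) z)"

definition J_mat ::
  "((real^'x) \<times> (real^'k)) measure \<Rightarrow> ('x::finite, 'd::finite) score \<Rightarrow> 'k \<Rightarrow> real^'d \<Rightarrow> real^'d^'d" where
  "J_mat P g a \<theta> = (\<integral>(x, y). jacobian (g x (y $ a)) (at \<theta>) \<partial>P)"

definition I_bar ::
  "((real^'x) \<times> (real^'k)) measure \<Rightarrow> ('x::finite, 'd::finite) score \<Rightarrow> (real^'x \<Rightarrow> real^'k) \<Rightarrow> 'k \<Rightarrow> real^'d \<Rightarrow>
   real^'d^'d" where
  "I_bar P g pibar a \<theta> =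
     (\<integral>(x, y). (1 / pibar x $ a) *\<^sub>R outer (g x (y $ a) \<theta>) (g x (y $ a) \<theta>) \<partial>P)"

definition sandwich :: "real^'d^'d \<Rightarrow> real^'d^'d \<Rightarrow> real^'d^'d" where
  "sandwich G I = matrix_inv G ** I ** transpose (matrix_inv G)"

definition score_hat ::
  "('x::finite, 'd::finite) score \<Rightarrow> (nat \<Rightarrow> 'w \<Rightarrow> real^'x) \<Rightarrow> (nat \<Rightarrow> 'w \<Rightarrow> real^'k) \<Rightarrow> (nat \<Rightarrow> 'w \<Rightarrow> 'k) \<Rightarrow>
   (nat \<Rightarrow> ('x, 'k::finite) policy) \<Rightarrow> 'k \<Rightarrow> (nat \<Rightarrow> 'w \<Rightarrow> real^'d) \<Rightarrow> nat \<Rightarrow> 'w \<Rightarrow> real^'d" where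
  "score_hat g X Y A pol a \<theta>hat T \<omega> = (1 / real T) *\<^sub>R
     (\<Sum>t=1..T. (indicator {a} (A t \<omega>) / behav X Y A pol t \<omega> $ A t \<omega>) *\<^sub>R
        g (X t \<omega>) (observed Y A t \<omega>) (\<theta>hat T \<omega>))"

definition G_hat ::
  "('x::finite, 'd::finite) score \<Rightarrow> (nat \<Rightarrow> 'w \<Rightarrow> real^'x) \<Rightarrow> (nat \<Rightarrow> 'w \<Rightarrow> real^'k) \<Rightarrow> (nat \<Rightarrow> 'w \<Rightarrow> 'k) \<Rightarrow>
   (nat \<Rightarrow> ('x, 'k::finite) policy) \<Rightarrow> 'k \<Rightarrow> (nat \<Rightarrow> 'w \<Rightarrow> real^'d) \<Rightarrow> nat \<Rightarrow> 'w \<Rightarrow> real^'d^'d" where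
  "G_hat g X Y A pol a \<theta>hat T \<omega> = (1 / real T) *\<^sub>R
     (\<Sum>t=1..T. (indicator {a} (A t \<omega>) / behav X Y A pol t \<omega> $ A t \<omega>) *\<^sub>R
        jacobian (g (X t \<omega>) (observed Y A t \<omega>)) (at (\<theta>hat T \<omega>)))"

definition I_hat ::
  "('x::finite, 'd::finite) score \<Rightarrow> (nat \<Rightarrow> 'w \<Rightarrow> real^'x) \<Rightarrow> (nat \<Rightarrow> 'w \<Rightarrow> real^'k) \<Rightarrow> (nat \<Rightarrow> 'w \<Rightarrow> 'k) \<Rightarrow>
   (nat \<Rightarrow> ('x, 'k::finite) policy) \<Rightarrow> 'k \<Rightarrow> (nat \<Rightarrow> 'w \<Rightarrow> real^'d) \<Rightarrow> nat \<Rightarrow> 'w \<Rightarrow> real^'d^'d" where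
  "I_hat g X Y A pol a \<theta>hat T \<omega> = (1 / real T) *\<^sub>R
     (\<Sum>t=1..T. (indicator {a} (A t \<omega>) / (behav X Y A pol t \<omega> $ A t \<omega>)\<^sup>2) *\<^sub>R
        outer (g (X t \<omega>) (observed Y A t \<omega>) (\<theta>hat T \<omega>))
              (g (X t \<omega>) (observed Y A t \<omega>) (\<theta>hat T \<omega>)))"

end

(* The weights 1{A_t = a}/pi_t(a) are a change of measure that is invisible to functions of
   (X_t, H_{t-1}, Y_t): by unconfoundedness and the action law it does not change the law of this
   triple. Hence the centred weighted terms of a bounded function are orthogonal, and truncation
   gives an L1 law of large numbers for the weighted averages of every integrable function of
   (X, Y(a)). With the Lipschitz bounds phi and Phi this gives consistency of the estimator (finite
   net of the parameter ball), the limit of the Jacobian averages, and, once 1/pi_t is replaced by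
   1/pibar at an L1 cost that vanishes in Cesaro mean, the limit of the second-moment averages. The
   sandwich map is continuous at an invertible Jacobian by Cramer's rule. *)

theory Submission
  imports Defs
begin

section \<open>Events of asymptotic probability one\<close>

text \<open>The estimator depends on the whole sample, so no law of large numbers applies to
  summands evaluated at it. Stochastic limits are therefore taken at fixed parameters only, and the
  passage to \<open>\<theta>hat\<close> is a pathwise comparison: on an event of probability tending
  to one, the average of a random Lipschitz constant stays below its mean plus one, and the rest is
  deterministic arithmetic. The summands themselves are neither independent nor identically
  distributed, because pi_t depends on the past. What survives is that a past weighted term is a
  function of the history, and that the reweighted round t still has its context and outcomes
  independent of that history. The squared weight in \<open>I_hat\<close> is a further obstacle. One
  inverse probability is absorbed by the change of measure; the other is a function of X_t and the
  past rather than of (X_t, Y_t(a)), so its average is no population average until it is compared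
  with 1/pibar. That comparison needs a lower bound for pibar, which has to be derived from the one
  for pi_t.\<close>

text \<open>Stated through a measurable superset of the exceptional set, so that no measurability of
  the predicates themselves has to be checked.\<close>

definition whp :: "'w measure \<Rightarrow> (nat \<Rightarrow> 'w \<Rightarrow> bool) \<Rightarrow> bool" where
  "whp M Q \<longleftrightarrow>
     (\<exists>B. (\<forall>n. B n \<in> sets M) \<and> (\<lambda>n. measure M (B n)) \<longlonglongrightarrow> 0 \<and>
          (\<forall>\<^sub>F n in sequentially. \<forall>\<omega>\<in>space M - B n. Q n \<omega>))"

lemma whpI:
  assumes "\<And>n. B n \<in> sets M" "(\<lambda>n. measure M (B n)) \<longlonglongrightarrow> 0"
    and "\<forall>\<^sub>F n in sequentially. \<forall>\<omega>\<in>space M - B n. Q n \<omega>"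
  shows "whp M Q"
  using assms unfolding whp_def by blast

lemma whp_mono:
  assumes "whp M Q" "\<forall>\<^sub>F n in sequentially. \<forall>\<omega>\<in>space M. Q n \<omega> \<longrightarrow> R n \<omega>"
  shows "whp M R"
proof -
  obtain B where B: "\<And>n. B n \<in> sets M" "(\<lambda>n. measure M (B n)) \<longlonglongrightarrow> 0"
    "\<forall>\<^sub>F n in sequentially. \<forall>\<omega>\<in>space M - B n. Q n \<omega>"
    using assms(1) unfolding whp_def by blast
  show ?thesis
    using B(3) assms(2) by (intro whpI[OF B(1,2)]) (auto elim: eventually_elim2)
qed

lemma (in finite_measure) whp_conj:
  assumes "whp M Q" "whp M R"
  shows "whp M (\<lambda>n \<omega>. Q n \<omega> \<and> R n \<omega>)"
proof -
  obtain B where B: "\<And>n. B n \<in> sets M" "(\<lambda>n. measure M (B n)) \<longlonglongrightarrow> 0"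
    "\<forall>\<^sub>F n in sequentially. \<forall>\<omega>\<in>space M - B n. Q n \<omega>"
    using assms(1) unfolding whp_def by blast
  obtain C where C: "\<And>n. C n \<in> sets M" "(\<lambda>n. measure M (C n)) \<longlonglongrightarrow> 0"
    "\<forall>\<^sub>F n in sequentially. \<forall>\<omega>\<in>space M - C n. R n \<omega>"
    using assms(2) unfolding whp_def by blast
  show ?thesis
  proof (rule whpI[where B="\<lambda>n. B n \<union> C n"])
    have "(\<lambda>n. measure M (B n) + measure M (C n)) \<longlonglongrightarrow> 0 + 0"
      by (intro tendsto_add B C)
    then show "(\<lambda>n. measure M (B n \<union> C n)) \<longlonglongrightarrow> 0"
      using B(1) C(1)
      by (intro tendsto_sandwich[OF _ _ tendsto_const, of 0 "\<lambda>n. measure M (B n \<union> C n)"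
            sequentially "\<lambda>n. measure M (B n) + measure M (C n)"])
        (auto intro!: always_eventually measure_Un_le)
  qed (use B C in \<open>auto elim: eventually_elim2\<close>)
qed

lemma (in finite_measure) whp_ball:
  assumes "finite I" "\<And>i. i \<in> I \<Longrightarrow> whp M (Q i)"
  shows "whp M (\<lambda>n \<omega>. \<forall>i\<in>I. Q i n \<omega>)"
  using assms
proof (induction I)
  case empty
  show ?case by (rule whpI[where B="\<lambda>_. {}"]) auto
next
  case (insert i I)
  then show ?case
    using whp_conj[of "Q i" "\<lambda>n \<omega>. \<forall>i\<in>I. Q i n \<omega>"] by simp
qed

lemma (in finite_measure) whp_AE:
  assumes "\<And>n. n \<ge> 1 \<Longrightarrow> AE \<omega> in M. Q n \<omega>"
  shows "whp M Q"
proof -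
  have "\<exists>B. B \<in> sets M \<and> measure M B = 0 \<and> (\<forall>\<omega>\<in>space M - B. Q n \<omega>)" if n: "n \<ge> 1" for n
  proof -
    obtain N where "N \<in> null_sets M" "{\<omega>\<in>space M. \<not> Q n \<omega>} \<subseteq> N"
      using assms[OF n] unfolding eventually_ae_filter by blast
    then show ?thesis
      by (intro exI[of _ N]) (auto simp: measure_eq_0_null_sets)
  qed
  then obtain B where B: "B n \<in> sets M" "measure M (B n) = 0" "\<forall>\<omega>\<in>space M - B n. Q n \<omega>"
    if "n \<ge> 1" for n
    by metis
  \<comment> \<open>The hypothesis says nothing about index 0, so the exceptional set is chosen
    empty there; the conclusion is only eventual in \<open>n\<close>.\<close>
  show ?thesis
    by (rule whpI[where B="\<lambda>n. if n \<ge> 1 then B n else {}"])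
      (use B in \<open>auto simp: eventually_sequentially intro!: exI[of _ 1] tendsto_eventually\<close>)
qed

text \<open>Markov's inequality. The L1 limits below enter the calculus of \<open>whp\<close> events
  through this lemma.\<close>

lemma (in prob_space) whp_Markov:
  assumes int: "\<And>n. n \<ge> 1 \<Longrightarrow> integrable M (Z n)"
    and nonneg: "\<And>n. n \<ge> 1 \<Longrightarrow> AE \<omega> in M. 0 \<le> Z n \<omega>"
    and lim: "(\<lambda>n. \<integral>\<omega>. Z n \<omega> \<partial>M) \<longlonglongrightarrow> 0" and e: "e > (0::real)"
  shows "whp M (\<lambda>n \<omega>. Z n \<omega> \<le> e)"
proof (rule whpI[where B="\<lambda>n. if n \<ge> 1 then {\<omega>\<in>space M. Z n \<omega> \<ge> e} else {}"])
  show "(if n \<ge> 1 then {\<omega>\<in>space M. Z n \<omega> \<ge> e} else {}) \<in> sets M" for n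
    using int[of n] by auto
  have "(\<lambda>n. (\<integral>\<omega>. Z n \<omega> \<partial>M) / e) \<longlonglongrightarrow> 0 / e"
    by (intro tendsto_divide lim) (use e in auto)
  then have lim': "(\<lambda>n. (\<integral>\<omega>. Z n \<omega> \<partial>M) / e) \<longlonglongrightarrow> 0" by simp
  have le: "prob {\<omega>\<in>space M. Z n \<omega> \<ge> e} \<le> (\<integral>\<omega>. Z n \<omega> \<partial>M) / e" if "n \<ge> 1" for n
    using integral_Markov_inequality_measure[OF int[OF that] _ nonneg[OF that] e, of "{}"] by simp
  show "(\<lambda>n. prob (if n \<ge> 1 then {\<omega>\<in>space M. Z n \<omega> \<ge> e} else {})) \<longlonglongrightarrow> 0"
    by (rule tendsto_sandwich[OF _ _ tendsto_const lim'])
      (use le in \<open>auto simp: eventually_sequentially intro!: exI[of _ 1]\<close>)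
qed (auto simp: eventually_sequentially intro!: exI[of _ 1])

lemma (in finite_measure) whp_conv_in_prob:
  fixes Z :: "nat \<Rightarrow> 'a \<Rightarrow> 'b::{metric_space, second_countable_topology}"
  assumes "conv_in_prob M Z c" "e > 0"
  shows "whp M (\<lambda>n \<omega>. dist (Z n \<omega>) c \<le> e)"
proof (rule whpI[where B="\<lambda>n. if n \<ge> 1 then {\<omega>\<in>space M. dist (Z n \<omega>) c > e} else {}"])
  show "(if n \<ge> 1 then {\<omega>\<in>space M. dist (Z n \<omega>) c > e} else {}) \<in> sets M" for n
  proof (cases "n \<ge> 1")
    case True
    then have [measurable]: "Z n \<in> borel_measurable M"
      using assms(1) unfolding conv_in_prob_def by auto
    show ?thesis using True by simp
  qed simp
  have "(\<lambda>n. measure M {\<omega>\<in>space M. dist (Z n \<omega>) c > e}) \<longlonglongrightarrow> 0"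
    using assms unfolding conv_in_prob_def by auto
  then show "(\<lambda>n. measure M (if n \<ge> 1 then {\<omega>\<in>space M. dist (Z n \<omega>) c > e} else {})) \<longlonglongrightarrow> 0"
    by (rule Lim_transform_eventually) (auto simp: eventually_sequentially intro!: exI[of _ 1])
qed (auto simp: eventually_sequentially intro!: exI[of _ 1])

text \<open>The cover \<open>B n\<close> bounds the measure of the deviation event. Measurability of
  \<open>Z\<close> is a separate premise because \<open>conv_in_prob\<close> contains it while
  \<open>whp\<close> says nothing about it.\<close>

lemma (in finite_measure) conv_in_probI:
  assumes meas: "\<And>n. n \<ge> 1 \<Longrightarrow> Z n \<in> borel_measurable M"
    and "\<And>e. e > 0 \<Longrightarrow> whp M (\<lambda>n \<omega>. dist (Z n \<omega>) c \<le> e)"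
  shows "conv_in_prob M Z c"
  unfolding conv_in_prob_def
proof (intro conjI allI impI meas)
  fix e :: real assume "e > 0"
  then obtain B where B: "\<And>n. B n \<in> sets M" "(\<lambda>n. measure M (B n)) \<longlonglongrightarrow> 0"
    "\<forall>\<^sub>F n in sequentially. \<forall>\<omega>\<in>space M - B n. dist (Z n \<omega>) c \<le> e"
    using assms(2) unfolding whp_def by blast
  show "(\<lambda>n. measure M {\<omega>\<in>space M. dist (Z n \<omega>) c > e}) \<longlonglongrightarrow> 0"
  proof (rule tendsto_sandwich[OF _ _ tendsto_const B(2)])
    show "\<forall>\<^sub>F n in sequentially. measure M {\<omega>\<in>space M. dist (Z n \<omega>) c > e} \<le> measure M (B n)"
      using B(3)
    proof eventually_elim
      case (elim n)
      then show ?case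
        by (intro finite_measure_mono B(1)) force
    qed
  qed simp
qed

section \<open>Null sequences, Cesaro means and truncation\<close>

text \<open>The form in which truncation arguments end: a level \<open>e\<close> is fixed first, and
  the remainder \<open>r\<close>, which may depend on it, vanishes only afterwards.\<close>

lemma tendsto_zero_upto_eps:
  fixes f :: "nat \<Rightarrow> real"
  assumes "\<And>n. f n \<ge> 0"
    and "\<And>e. e > 0 \<Longrightarrow> \<exists>r. r \<longlonglongrightarrow> 0 \<and> (\<forall>\<^sub>F n in sequentially. f n \<le> e + r n)"
  shows "f \<longlonglongrightarrow> 0"
proof (rule tendstoI)
  fix e :: real assume "e > 0"
  then obtain r where r: "r \<longlonglongrightarrow> 0" "\<forall>\<^sub>F n in sequentially. f n \<le> e/2 + r n"
    using assms(2)[of "e/2"] by auto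
  have "\<forall>\<^sub>F n in sequentially. r n < e/2"
    using r(1) \<open>e > 0\<close> by (intro order_tendstoD) auto
  with r(2) show "\<forall>\<^sub>F n in sequentially. dist (f n) 0 < e"
    by eventually_elim (use assms(1) in \<open>auto simp: dist_real_def\<close>)
qed

lemma tendsto_Cesaro_zero:
  fixes f :: "nat \<Rightarrow> real"
  assumes lim: "f \<longlonglongrightarrow> 0"
  shows "(\<lambda>n. (1 / real n) * (\<Sum>t=1..n. f t)) \<longlonglongrightarrow> 0"
proof (rule LIMSEQ_I)
  fix e :: real assume e: "e > 0"
  obtain N where N: "\<And>n. n \<ge> N \<Longrightarrow> \<bar>f n\<bar> < e/2"
    using LIMSEQ_D[OF lim, of "e/2"] e by auto
  \<comment> \<open>The first \<open>N\<close> terms contribute at most the constant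
    \<open>C\<close>, which division by \<open>n\<close> makes small; the later terms are below e/2
    each, so their share of the average is too.\<close>
  define C where "C = (\<Sum>t=1..N. \<bar>f t\<bar>)"
  have "C \<ge> 0" by (auto simp: C_def intro: sum_nonneg)
  have "(\<lambda>n. C / real n) \<longlonglongrightarrow> 0"
    by (rule lim_const_over_n)
  then have "\<forall>\<^sub>F n in sequentially. C / real n < e/2"
    using e by (intro order_tendstoD) auto
  then obtain K where K: "\<And>n. n \<ge> K \<Longrightarrow> C / real n < e/2"
    unfolding eventually_sequentially by blast
  have "norm ((1 / real n) * (\<Sum>t=1..n. f t) - 0) < e" if n: "n \<ge> max (max N K) 1" for n
  proof -
    have "\<bar>\<Sum>t=1..n. f t\<bar> \<le> (\<Sum>t=1..n. \<bar>f t\<bar>)" by (rule sum_abs)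
    also have "\<dots> = C + (\<Sum>t=N+1..n. \<bar>f t\<bar>)"
      unfolding C_def using n by (subst sum.union_disjoint[symmetric]) (auto intro!: sum.cong)
    also have "(\<Sum>t=N+1..n. \<bar>f t\<bar>) \<le> (\<Sum>t=N+1..n. e/2)"
      by (intro sum_mono) (use N in \<open>auto intro: less_imp_le\<close>)
    also have "\<dots> \<le> real n * (e/2)" using e by (auto simp: mult_right_mono)
    finally have "\<bar>\<Sum>t=1..n. f t\<bar> \<le> C + real n * (e/2)" by simp
    then have "(1 / real n) * \<bar>\<Sum>t=1..n. f t\<bar> \<le> (1 / real n) * (C + real n * (e/2))"
      by (intro mult_left_mono) auto
    also have "\<dots> = C / real n + e/2" using n by (simp add: field_simps)
    also have "\<dots> < e" using K[of n] n by linarith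
    finally show ?thesis by (simp add: abs_mult)
  qed
  then show "\<exists>no. \<forall>n\<ge>no. norm ((1 / real n) * (\<Sum>t=1..n. f t) - 0) < e" by blast
qed

definition clip :: "real \<Rightarrow> real \<Rightarrow> real" where
  "clip b r = max (- b) (min b r)"

lemma abs_clip_le: "b \<ge> 0 \<Longrightarrow> \<bar>clip b r\<bar> \<le> b"
  and abs_diff_clip_le: "b \<ge> 0 \<Longrightarrow> \<bar>r - clip b r\<bar> \<le> \<bar>r\<bar>"
  and clip_eq: "\<bar>r\<bar> \<le> b \<Longrightarrow> clip b r = r"
  by (auto simp: clip_def)

lemma measurable_clip [measurable]: "clip b \<in> borel_measurable borel"
  unfolding clip_def by measurable

text \<open>Dominated convergence with |f| as the majorant: at each point the clipping error is zero
  from some level on.\<close>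

lemma ex_clip_approx:
  fixes f :: "'a \<Rightarrow> real"
  assumes f [measurable]: "integrable M f" and e: "e > 0"
  obtains b where "b \<ge> 0" "(\<integral>z. \<bar>f z - clip b (f z)\<bar> \<partial>M) < e"
proof -
  have [measurable]: "f \<in> borel_measurable M" using f by auto
  have "(\<lambda>n. \<integral>z. \<bar>f z - clip (real n) (f z)\<bar> \<partial>M) \<longlonglongrightarrow> (\<integral>z. 0 \<partial>M)"
  proof (rule integral_dominated_convergence[where w="\<lambda>z. \<bar>f z\<bar>"])
    show "AE z in M. (\<lambda>n. \<bar>f z - clip (real n) (f z)\<bar>) \<longlonglongrightarrow> 0"
    proof (rule AE_I2)
      fix z
      obtain N :: nat where "\<bar>f z\<bar> \<le> real N" using real_arch_simple by blast
      then have "\<forall>n\<ge>N. \<bar>f z - clip (real n) (f z)\<bar> = 0"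
        by (auto simp: clip_eq)
      then show "(\<lambda>n. \<bar>f z - clip (real n) (f z)\<bar>) \<longlonglongrightarrow> 0"
        by (intro tendsto_eventually) (auto simp: eventually_sequentially)
    qed
  qed (use f in \<open>auto intro!: abs_diff_clip_le\<close>)
  then have "\<forall>\<^sub>F n in sequentially. (\<integral>z. \<bar>f z - clip (real n) (f z)\<bar> \<partial>M) < e"
    using e by (intro order_tendstoD(2)[of _ 0]) auto
  then obtain n where "(\<integral>z. \<bar>f z - clip (real n) (f z)\<bar> \<partial>M) < e"
    using eventually_happens trivial_limit_sequentially by blast
  then show ?thesis using that[of "real n"] by auto
qed

section \<open>Vectors and matrices\<close>

text \<open>An entry is embedded by a bounded linear map, so a vector is a finite sum of such images
  and inherits measurability and integrability from its entries. The entry type is a general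
  Euclidean space so that the argument applies twice to a matrix: to its rows, then to their
  entries.\<close>

lemma bounded_linear_axis:
  "bounded_linear (axis i :: 'b::euclidean_space \<Rightarrow> 'b^'n::finite)"
proof (rule bounded_linear_intro[where K=1])
  show "norm (axis i x :: 'b^'n) \<le> norm x * 1" for x :: 'b
    by (simp add: norm_eq_sqrt_inner inner_axis_axis)
qed (auto simp: vec_eq_iff axis_def)

lemma vec_eq_sum_axis: "(v :: 'b::euclidean_space^'n::finite) = (\<Sum>i\<in>UNIV. axis i (v $ i))"
  by (simp add: vec_eq_iff axis_def)

lemma borel_measurable_vec_iff:
  fixes f :: "'a \<Rightarrow> 'b::euclidean_space^'n::finite"
  shows "f \<in> borel_measurable M \<longleftrightarrow> (\<forall>i. (\<lambda>z. f z $ i) \<in> borel_measurable M)"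
proof
  assume f: "f \<in> borel_measurable M"
  show "\<forall>i. (\<lambda>z. f z $ i) \<in> borel_measurable M"
    by (intro allI borel_measurable_continuous_on[OF _ f] linear_continuous_on bounded_linear_vec_nth)
next
  assume *: "\<forall>i. (\<lambda>z. f z $ i) \<in> borel_measurable M"
  have "(\<lambda>z. \<Sum>i\<in>UNIV. axis i (f z $ i)) \<in> borel_measurable M"
    using * by (intro borel_measurable_sum borel_measurable_continuous_on[where f="axis i" for i])
      (auto intro: linear_continuous_on bounded_linear_axis)
  then show "f \<in> borel_measurable M"
    by (simp only: vec_eq_sum_axis[symmetric])
qed

lemma borel_measurable_vec_nth [measurable]:
  "(\<lambda>v :: 'b::euclidean_space^'n::finite. v $ i) \<in> borel_measurable borel"
  by (intro borel_measurable_continuous_onI linear_continuous_on bounded_linear_vec_nth)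

lemma integrable_vec:
  fixes f :: "'a \<Rightarrow> 'b::euclidean_space^'n::finite"
  assumes "\<And>i. integrable M (\<lambda>z. f z $ i)"
  shows "integrable M f"
proof -
  have "integrable M (\<lambda>z. \<Sum>i\<in>UNIV. axis i (f z $ i) :: 'b^'n)"
    by (rule Bochner_Integration.integrable_sum) (rule integrable_bounded_linear[OF bounded_linear_axis assms])
  then show ?thesis
    by (simp only: vec_eq_sum_axis[symmetric])
qed

lemma integral_vec_nth:
  fixes f :: "'a \<Rightarrow> 'b::euclidean_space^'n::finite"
  assumes "integrable M f"
  shows "(\<integral>z. f z \<partial>M) $ i = (\<integral>z. f z $ i \<partial>M)"
  using integral_bounded_linear[OF bounded_linear_vec_nth assms, of i] by simp

lemma dist_vec_le_sum:
  fixes v w :: "'b::real_normed_vector^'n::finite"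
  shows "dist v w \<le> (\<Sum>i\<in>UNIV. dist (v $ i) (w $ i))"
  unfolding dist_vec_def by (rule L2_set_le_sum) auto

lemma dist_matrix_le:
  fixes A B :: "real^'n^'m"
  assumes "\<And>i j. \<bar>A $ i $ j - B $ i $ j\<bar> \<le> e"
  shows "dist A B \<le> real CARD('m) * (real CARD('n) * e)"
proof -
  have "dist A B \<le> (\<Sum>i\<in>(UNIV::'m set). \<Sum>j\<in>(UNIV::'n set). dist (A $ i $ j) (B $ i $ j))"
    by (rule order_trans[OF dist_vec_le_sum]) (intro sum_mono dist_vec_le_sum)
  also have "\<dots> \<le> (\<Sum>i\<in>(UNIV::'m set). \<Sum>j\<in>(UNIV::'n set). e)"
    using assms by (intro sum_mono) (auto simp: dist_real_def)
  finally show ?thesis by simp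
qed

section \<open>Continuity and measurability of the matrix inverse\<close>

lemma continuous_on_det: "continuous_on UNIV (det :: real^'n^'n \<Rightarrow> real)"
  unfolding det_def[abs_def] by (intro continuous_intros)

text \<open>Column k of the inverse solves A x = e_k, and Cramer's rule writes the solution as a
  quotient of determinants. These are polynomials in the entries, which is what continuity and
  measurability of the inverse rest on.\<close>

lemma matrix_inv_eq_Cramer:
  fixes A :: "real^'n^'n"
  assumes "det A \<noteq> 0"
  shows "matrix_inv A =
    (\<chi> i k. det ((\<chi> r c. if c = i then axis k 1 $ r else A $ r $ c) :: real^'n^'n) / det A)"
proof -
  have inv: "A ** matrix_inv A = mat 1"
    using assms someI_ex[of "\<lambda>B. A ** B = mat 1 \<and> B ** A = mat 1"]
    unfolding invertible_det_nz[symmetric] invertible_def matrix_inv_def by blast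
  have "matrix_inv A $ i $ k = det ((\<chi> r c. if c = i then axis k 1 $ r else A $ r $ c) :: real^'n^'n) / det A" for i k
  proof -
    have "A *v (matrix_inv A *v axis k 1) = axis k 1"
      by (simp add: matrix_vector_mul_assoc inv)
    then have "matrix_inv A *v axis k 1 =
      (\<chi> i. det ((\<chi> r c. if c = i then axis k 1 $ r else A $ r $ c) :: real^'n^'n) / det A)"
      using cramer[OF assms] by blast
    moreover have "(matrix_inv A *v axis k 1) $ i = matrix_inv A $ i $ k"
      by (simp add: matrix_vector_mul_component inner_axis)
    ultimately show ?thesis by simp
  qed
  then show ?thesis by (simp add: vec_eq_iff)
qed

lemma continuous_matrix_inv:
  fixes A :: "real^'n^'n"
  assumes "invertible A"
  shows "isCont matrix_inv A"
proof -
  have nz: "det A \<noteq> 0" using assms by (simp add: invertible_det_nz)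
  have det: "(det \<longlongrightarrow> det A) (at A)"
    using continuous_on_tendsto_compose[OF continuous_on_det tendsto_ident_at] by simp
  \<comment> \<open>The determinant formula describes \<open>matrix_inv\<close> only at nonsingular
    matrices, and all matrices close to \<open>A\<close> are nonsingular.\<close>
  have ev: "\<forall>\<^sub>F B in at A. det B \<noteq> 0"
    by (rule tendsto_imp_eventually_ne[OF det nz])
  have det': "((\<lambda>x. det (h x)) \<longlongrightarrow> det L) F" if "(h \<longlongrightarrow> L) F" for h F and L :: "real^'n^'n"
    using continuous_on_tendsto_compose[OF continuous_on_det that] by simp
  have entry: "((\<lambda>B. if c = i then axis k 1 $ r else B $ r $ c) \<longlongrightarrow> (if c = i then axis k 1 $ r else A $ r $ c)) (at A)"
    for i k r c
    by (cases "c = i") (auto intro!: tendsto_intros)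
  have "((\<lambda>B. (\<chi> i k. det ((\<chi> r c. if c = i then axis k 1 $ r else B $ r $ c) :: real^'n^'n) / det B))
        \<longlongrightarrow> matrix_inv A) (at A)"
    unfolding matrix_inv_eq_Cramer[OF nz]
    by (intro tendsto_vec_lambda tendsto_divide det nz det' entry)
  then show ?thesis unfolding isCont_def
    by (rule Lim_transform_eventually)
      (use ev in eventually_elim, simp add: matrix_inv_eq_Cramer)
qed

text \<open>On singular matrices \<^const>\<open>matrix_inv\<close> is a choice from the empty predicate, hence the same
  unspecified matrix everywhere.\<close>

lemma measurable_matrix_inv [measurable]:
  "matrix_inv \<in> borel_measurable (borel :: (real^'n^'n) measure)"
proof -
  define junk :: "real^'n^'n" where "junk = (SOME A'. False)"
  have singular: "matrix_inv A = junk" if "det A = 0" for A :: "real^'n^'n"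
  proof -
    have "\<not> invertible A" using that by (simp add: invertible_det_nz)
    then show ?thesis
      unfolding matrix_inv_def invertible_def junk_def by meson
  qed
  have [measurable]: "det \<in> borel_measurable (borel :: (real^'n^'n) measure)"
    by (rule borel_measurable_continuous_onI[OF continuous_on_det])
  have entry: "(\<lambda>B::real^'n^'n. (\<chi> r c. if c = i then axis k 1 $ r else B $ r $ c) :: real^'n^'n) \<in> borel_measurable borel"
    for i k
  proof (intro borel_measurable_continuous_onI continuous_on_vec_lambda)
    show "continuous_on UNIV (\<lambda>x::real^'n^'n. if c = i then axis k 1 $ r else x $ r $ c)" for r c
      by (cases "c = i") (auto intro!: continuous_intros)
  qed
  have dets: "(\<lambda>B::real^'n^'n. det ((\<chi> r c. if c = i then axis k 1 $ r else B $ r $ c) :: real^'n^'n)) \<in> borel_measurable borel"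
    for i k
    by (rule measurable_compose[OF entry]) measurable
  have "(\<lambda>B. if det B \<noteq> 0
      then (\<chi> i k. det ((\<chi> r c. if c = i then axis k 1 $ r else B $ r $ c) :: real^'n^'n) / det B)
      else junk) \<in> borel_measurable borel"
    by (intro measurable_If) (auto simp: borel_measurable_vec_iff intro!: borel_measurable_divide dets)
  also have "(\<lambda>B. if det B \<noteq> 0
      then (\<chi> i k. det ((\<chi> r c. if c = i then axis k 1 $ r else B $ r $ c) :: real^'n^'n) / det B)
      else junk) = matrix_inv"
    by (auto simp: matrix_inv_eq_Cramer singular)
  finally show ?thesis .
qed

lemma tendsto_matrix_mult:
  fixes f :: "'a \<Rightarrow> real^'n^'m" and h :: "'a \<Rightarrow> real^'p^'n"
  assumes "(f \<longlongrightarrow> A) F" "(h \<longlongrightarrow> B) F"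
  shows "((\<lambda>x. f x ** h x) \<longlongrightarrow> A ** B) F"
  unfolding matrix_matrix_mult_def by (intro tendsto_intros assms)

lemma tendsto_transpose:
  fixes f :: "'a \<Rightarrow> real^'n^'m"
  assumes "(f \<longlongrightarrow> A) F"
  shows "((\<lambda>x. transpose (f x)) \<longlongrightarrow> transpose A) F"
  unfolding transpose_def by (intro tendsto_intros assms)

lemma borel_measurable_sandwich:
  fixes G I :: "'a \<Rightarrow> real^'d^'d"
  assumes G: "G \<in> borel_measurable M" and I: "I \<in> borel_measurable M"
  shows "(\<lambda>\<omega>. sandwich (G \<omega>) (I \<omega>)) \<in> borel_measurable M"
proof -
  have "(\<lambda>\<omega>. matrix_inv (G \<omega>)) \<in> borel_measurable M"
    by (rule measurable_compose[OF G]) measurable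
  then show ?thesis
    using I unfolding sandwich_def matrix_matrix_mult_def transpose_def borel_measurable_vec_iff
    by (auto intro!: borel_measurable_sum borel_measurable_times)
qed

text \<open>Continuity of the sandwich map at (J, K), put in terms of entries because the stochastic
  limits are obtained entry by entry.\<close>

lemma sandwich_continuous:
  fixes J K :: "real^'d^'d"
  assumes J: "invertible J" and e: "e > 0"
  obtains r where "r > 0"
    "\<And>G I. (\<And>i j. \<bar>G $ i $ j - J $ i $ j\<bar> \<le> r) \<Longrightarrow> (\<And>i j. \<bar>I $ i $ j - K $ i $ j\<bar> \<le> r) \<Longrightarrow>
       dist (sandwich G I) (sandwich J K) \<le> e"
proof -
  have fst: "(fst \<longlongrightarrow> J) (at (J, K))" and snd: "(snd \<longlongrightarrow> K) (at (J, K))"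
    using tendsto_fst[OF tendsto_ident_at, of "(J,K)"] tendsto_snd[OF tendsto_ident_at, of "(J,K)"] by auto
  have inv: "((\<lambda>p. matrix_inv (fst p)) \<longlongrightarrow> matrix_inv J) (at (J, K))"
    by (rule isCont_tendsto_compose[OF continuous_matrix_inv[OF J] fst])
  have "((\<lambda>p. sandwich (fst p) (snd p)) \<longlongrightarrow> sandwich J K) (at (J, K))"
    unfolding sandwich_def by (intro tendsto_matrix_mult tendsto_transpose inv snd)
  then have "\<forall>\<^sub>F p in at (J, K). dist (sandwich (fst p) (snd p)) (sandwich J K) < e"
    using e by (rule tendstoD)
  then obtain d where d: "d > 0"
    "\<And>p. p \<noteq> (J,K) \<Longrightarrow> dist p (J,K) < d \<Longrightarrow> dist (sandwich (fst p) (snd p)) (sandwich J K) < e"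
    unfolding eventually_at by auto
  \<comment> \<open>\<open>N\<close> is the number of entries of a matrix, the factor lost in
    \<open>dist_matrix_le\<close>. Entry errors of d / (3 * N) give each of the two matrices an
    error of at most d/3, and the sum stays strictly below d.\<close>
  define N where "N = real CARD('d) * real CARD('d)"
  have N: "N > 0" by (simp add: N_def)
  show ?thesis
  proof (rule that[of "d / (3 * N)"])
    show "d / (3 * N) > 0" using d N by simp
    fix G I :: "real^'d^'d"
    assume G: "\<And>i j. \<bar>G $ i $ j - J $ i $ j\<bar> \<le> d / (3 * N)"
      and I: "\<And>i j. \<bar>I $ i $ j - K $ i $ j\<bar> \<le> d / (3 * N)"
    have "dist G J \<le> d / 3" "dist I K \<le> d / 3"
      using dist_matrix_le[OF G] dist_matrix_le[OF I] N unfolding mult.assoc[symmetric] N_def[symmetric]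
      by auto
    moreover have "dist (G, I) (J, K) \<le> dist G J + dist I K"
      by (simp add: dist_Pair_Pair sqrt_sum_squares_le_sum)
    ultimately have "dist (G, I) (J, K) < d" using d(1) by linarith
    \<comment> \<open>The filter \<open>at\<close> is punctured, so the base point, where the
      distance is zero, is a case of its own.\<close>
    then show "dist (sandwich G I) (sandwich J K) \<le> e"
      using d(2)[of "(G, I)"] e by (cases "(G, I) = (J, K)") (auto intro: less_imp_le)
  qed
qed

section \<open>Derivatives of a parametrised family\<close>

lemma onorm_frechet_derivative:
  fixes f :: "real^'n \<Rightarrow> real^'m"
  assumes "f differentiable at \<theta>"
  shows "onorm (frechet_derivative f (at \<theta>)) = spectral_norm (jacobian f (at \<theta>))"
proof -
  have "(f has_derivative (\<lambda>h. jacobian f (at \<theta>) *v h)) (at \<theta>)"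
    using assms jacobian_works by blast
  then have "frechet_derivative f (at \<theta>) = (\<lambda>h. jacobian f (at \<theta>) *v h)"
    using frechet_derivative_at by metis
  then show ?thesis by (simp add: spectral_norm_def)
qed

lemma spectral_norm_nonneg: "0 \<le> spectral_norm (B :: real^'n^'m)"
  unfolding spectral_norm_def
  by (rule onorm_pos_le) (rule matrix_vector_mul_bounded_linear)

lemma abs_entry_le_spectral_norm: "\<bar>B $ i $ j\<bar> \<le> spectral_norm (B :: real^'n^'m)"
proof -
  have "\<bar>B $ i $ j\<bar> = \<bar>(B *v axis j 1) $ i\<bar>"
    by (simp add: matrix_vector_mul_component inner_axis)
  also have "\<dots> \<le> norm (B *v axis j 1)" by (rule component_le_norm_cart)
  also have "\<dots> \<le> onorm (\<lambda>v. B *v v) * norm (axis j (1::real))"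
    by (rule onorm) (rule matrix_vector_mul_bounded_linear)
  finally show ?thesis by (simp add: spectral_norm_def)
qed

text \<open>The mean value inequality on a convex set, in the norm in which the Jacobian and the
  Hessians are bounded.\<close>

lemma norm_diff_le_spectral_norm:
  fixes f :: "real^'n \<Rightarrow> real^'m"
  assumes "convex D" "\<And>\<theta>. \<theta> \<in> D \<Longrightarrow> f differentiable at \<theta>"
    and "\<And>\<theta>. \<theta> \<in> D \<Longrightarrow> spectral_norm (jacobian f (at \<theta>)) \<le> B"
    and "\<theta> \<in> D" "\<eta> \<in> D"
  shows "norm (f \<theta> - f \<eta>) \<le> B * norm (\<theta> - \<eta>)"
proof (rule differentiable_bound[OF assms(1) _ _ assms(4,5)])
  fix x assume x: "x \<in> D"
  show "(f has_derivative frechet_derivative f (at x)) (at x within D)"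
    using assms(2)[OF x] frechet_derivative_works has_derivative_at_withinI by blast
  show "onorm (frechet_derivative f (at x)) \<le> B"
    using assms(2,3)[OF x] by (simp add: onorm_frechet_derivative)
qed

text \<open>Since \<open>hessian\<close> is the Jacobian of \<open>grad\<close>, rows of the
  Jacobian have to be recognised as gradients before a bound on Hessians says anything about
  them.\<close>

lemma jacobian_nth_eq_grad:
  fixes f :: "real^'n \<Rightarrow> real^'m"
  assumes "f differentiable at \<theta>"
  shows "jacobian f (at \<theta>) $ i = grad (\<lambda>\<eta>. f \<eta> $ i) \<theta>"
proof -
  have "((\<lambda>\<eta>. f \<eta> $ i) has_derivative (\<lambda>h. frechet_derivative f (at \<theta>) h $ i)) (at \<theta>)"
    using assms frechet_derivative_works bounded_linear.has_derivative[OF bounded_linear_vec_nth] by blast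
  then have "frechet_derivative (\<lambda>\<eta>. f \<eta> $ i) (at \<theta>) = (\<lambda>h. frechet_derivative f (at \<theta>) h $ i)"
    using frechet_derivative_at by metis
  then show ?thesis
    by (simp add: vec_eq_iff grad_def jacobian_def matrix_def)
qed

text \<open>Row \<open>i\<close> of the Jacobian is a vector-valued map whose own Jacobian is the
  Hessian of component \<open>i\<close>, so the mean value inequality applies row by row.\<close>

lemma jacobian_Lipschitz:
  fixes f :: "real^'n \<Rightarrow> real^'m"
  assumes f: "twice_differentiable f" and D: "convex D"
    and B: "\<And>\<theta> i. \<theta> \<in> D \<Longrightarrow> spectral_norm (hessian (\<lambda>\<eta>. f \<eta> $ i) \<theta>) \<le> B"
    and in_D: "\<theta> \<in> D" "\<eta> \<in> D"
  shows "\<bar>jacobian f (at \<theta>) $ i $ j - jacobian f (at \<eta>) $ i $ j\<bar> \<le> B * norm (\<theta> - \<eta>)"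
proof -
  have eq: "(\<lambda>\<theta>. jacobian f (at \<theta>) $ i) = grad (\<lambda>\<eta>. f \<eta> $ i)"
    using f by (auto simp: twice_differentiable_def jacobian_nth_eq_grad)
  have "(\<lambda>\<theta>. jacobian f (at \<theta>) $ i) differentiable at \<theta>" for \<theta>
    using f bounded_linear.has_derivative[OF bounded_linear_vec_nth]
    unfolding twice_differentiable_def differentiable_def by blast
  then have "norm (jacobian f (at \<theta>) $ i - jacobian f (at \<eta>) $ i) \<le> B * norm (\<theta> - \<eta>)"
    unfolding eq[THEN fun_cong]
    by (intro norm_diff_le_spectral_norm[OF D _ _ in_D]) (use B in \<open>auto simp: eq hessian_def\<close>)
  moreover have "\<bar>(jacobian f (at \<theta>) $ i - jacobian f (at \<eta>) $ i) $ j\<bar>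
      \<le> norm (jacobian f (at \<theta>) $ i - jacobian f (at \<eta>) $ i)"
    by (rule component_le_norm_cart)
  ultimately show ?thesis by simp
qed

section \<open>Measurability of parametrised families\<close>

text \<open>Each entry of the derivative is a pointwise limit of difference quotients along the
  steps 1/(n+1), and each quotient involves the family at two fixed parameters only.\<close>

lemma borel_measurable_jacobian:
  fixes f :: "'z \<Rightarrow> real^'n \<Rightarrow> real^'m"
  assumes meas: "\<And>\<theta>. (\<lambda>z. f z \<theta>) \<in> borel_measurable N"
    and diff: "\<And>z. z \<in> space N \<Longrightarrow> f z differentiable at \<theta>"
  shows "(\<lambda>z. jacobian (f z) (at \<theta>)) \<in> borel_measurable N"
proof -
  have "(\<lambda>z. jacobian (f z) (at \<theta>) $ i $ j) \<in> borel_measurable N" for i j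
  proof (rule borel_measurable_LIMSEQ_real)
    show "(\<lambda>z. real (Suc n) * (f z (\<theta> + inverse (real (Suc n)) *\<^sub>R axis j 1) $ i - f z \<theta> $ i)) \<in> borel_measurable N"
      for n
      using meas unfolding borel_measurable_vec_iff by (intro borel_measurable_times borel_measurable_diff) auto
    fix z assume z: "z \<in> space N"
    define f' where "f' = frechet_derivative (f z) (at \<theta>)"
    have der: "(f z has_derivative f') (at \<theta>)"
      using diff[OF z] frechet_derivative_works f'_def by blast
    have lin: "((\<lambda>s. \<theta> + s *\<^sub>R axis j 1) has_derivative (\<lambda>s. s *\<^sub>R axis j 1)) (at 0)"
      by (auto intro!: derivative_eq_intros)
    have "((\<lambda>s. f z (\<theta> + s *\<^sub>R axis j 1)) has_derivative (\<lambda>s. f' (s *\<^sub>R axis j 1))) (at 0)"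
      using has_derivative_compose[OF lin, of "f z" f'] der by simp
    then have "((\<lambda>s. f z (\<theta> + s *\<^sub>R axis j 1) $ i) has_derivative (\<lambda>s. f' (s *\<^sub>R axis j 1) $ i)) (at 0)"
      by (rule bounded_linear.has_derivative[OF bounded_linear_vec_nth])
    moreover have "(\<lambda>s. f' (s *\<^sub>R axis j 1) $ i) = (*) (f' (axis j 1) $ i)"
      using has_derivative_bounded_linear[OF der] by (auto simp: linear_simps)
    ultimately have "((\<lambda>s. f z (\<theta> + s *\<^sub>R axis j 1) $ i) has_field_derivative (f' (axis j 1) $ i)) (at 0)"
      by (simp add: has_field_derivative_def)
    then have "((\<lambda>s. (f z (\<theta> + s *\<^sub>R axis j 1) $ i - f z \<theta> $ i) / s) \<longlongrightarrow> f' (axis j 1) $ i) (at 0)"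
      by (simp add: DERIV_def)
    moreover have "filterlim (\<lambda>n. inverse (real (Suc n))) (at 0) sequentially"
      by (intro filterlim_atI LIMSEQ_inverse_real_of_nat) auto
    ultimately have "(\<lambda>n. (f z (\<theta> + inverse (real (Suc n)) *\<^sub>R axis j 1) $ i - f z \<theta> $ i) / inverse (real (Suc n)))
        \<longlonglongrightarrow> f' (axis j 1) $ i"
      by (rule filterlim_compose)
    then show "(\<lambda>n. real (Suc n) * (f z (\<theta> + inverse (real (Suc n)) *\<^sub>R axis j 1) $ i - f z \<theta> $ i))
        \<longlonglongrightarrow> jacobian (f z) (at \<theta>) $ i $ j"
      by (simp add: jacobian_def matrix_def f'_def divide_inverse mult.commute)
  qed
  then show ?thesis by (auto simp: borel_measurable_vec_iff)
qed

text \<open>A simple function in place of \<open>h\<close> reduces the claim to finitely many fixed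
  parameters, and continuity in the parameter carries the limit. This is what admits the random
  estimator as an argument of the score and of its Jacobian.\<close>

lemma borel_measurable_Caratheodory:
  fixes f :: "'a \<Rightarrow> 'b::{metric_space, second_countable_topology} \<Rightarrow> 'c::metric_space"
  assumes meas: "\<And>\<theta>. (\<lambda>\<omega>. f \<omega> \<theta>) \<in> borel_measurable M"
    and cont: "\<And>\<omega> \<theta>. \<omega> \<in> space M \<Longrightarrow> isCont (f \<omega>) \<theta>"
    and h: "h \<in> borel_measurable M"
  shows "(\<lambda>\<omega>. f \<omega> (h \<omega>)) \<in> borel_measurable M"
proof -
  \<comment> \<open>The point passed here is the centre of a growth bound that the approximation
    result also supplies; any value will do.\<close>
  obtain F where F: "\<And>n. simple_function M (F n)" "\<And>\<omega>. \<omega> \<in> space M \<Longrightarrow> (\<lambda>n. F n \<omega>) \<longlonglongrightarrow> h \<omega>"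
    using borel_measurable_implies_sequence_metric[OF h, of undefined] by blast
  show ?thesis
  proof (rule borel_measurable_LIMSEQ_metric)
    show "(\<lambda>\<omega>. f \<omega> (F n \<omega>)) \<in> borel_measurable M" for n
    proof (rule measurable_compose_countable'[where I="F n ` space M" and f="\<lambda>\<theta> \<omega>. f \<omega> \<theta>"])
      show "F n \<in> measurable M (count_space (F n ` space M))"
        using F(1) simple_function_def[of M "F n"]
        by (intro measurable_count_space_eq2[THEN iffD2]) auto
      show "countable (F n ` space M)"
        using F(1)[of n] by (simp add: simple_functionD(1) countable_finite)
    qed (rule meas)
    show "(\<lambda>n. f \<omega> (F n \<omega>)) \<longlonglongrightarrow> f \<omega> (h \<omega>)" if "\<omega> \<in> space M" for \<omega>
      by (rule isCont_tendsto_compose[OF cont[OF that] F(2)[OF that]])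
  qed
qed

section \<open>Inverse-propensity weighting\<close>

context contextual_bandit
begin

lemma measurable_context: "t \<ge> 1 \<Longrightarrow> X t \<in> measurable M (ctx_space S)"
  and measurable_outcomes: "t \<ge> 1 \<Longrightarrow> Y t \<in> borel_measurable M"
proof -
  assume "t \<ge> 1"
  then have XY: "(\<lambda>\<omega>. (X t \<omega>, Y t \<omega>)) \<in> measurable M (ctx_space S \<Otimes>\<^sub>M borel)"
    using iid_indep unfolding indep_vars_def by auto
  show "X t \<in> measurable M (ctx_space S)" "Y t \<in> borel_measurable M"
    using measurable_compose[OF XY measurable_fst] measurable_compose[OF XY measurable_snd] by auto
qed

lemma context_in_S: "t \<ge> 1 \<Longrightarrow> \<omega> \<in> space M \<Longrightarrow> X t \<omega> \<in> S"
  using measurable_space[OF measurable_context] by (auto simp: ctx_space_def space_restrict_space)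

lemma measurable_observed: "t \<ge> 1 \<Longrightarrow> observed Y A t \<in> borel_measurable M"
proof -
  assume t: "t \<ge> 1"
  have "(\<lambda>\<omega>. \<Sum>k\<in>UNIV. indicator {k} (A t \<omega>) * Y t \<omega> $ k) \<in> borel_measurable M"
  proof (intro borel_measurable_sum borel_measurable_times)
    show "(\<lambda>\<omega>. indicator {k} (A t \<omega>) :: real) \<in> borel_measurable M" for k
      by (rule measurable_compose[OF action_measurable[OF t]]) simp
    show "(\<lambda>\<omega>. Y t \<omega> $ k) \<in> borel_measurable M" for k
      using measurable_outcomes[OF t] by (simp add: borel_measurable_vec_iff)
  qed
  also have "(\<lambda>\<omega>. \<Sum>k\<in>UNIV. indicator {k} (A t \<omega>) * Y t \<omega> $ k) = observed Y A t"
    by (auto simp: observed_def indicator_def)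
  finally show ?thesis .
qed

lemma measurable_hist: "hist X Y A pol t \<in> measurable M (hist_space S t)"
proof (induction t)
  case 0
  show ?case by (auto simp: hist_space_def intro!: measurable_PiM_single' )
next
  case (Suc t)
  have "(\<lambda>\<omega>. (X (Suc t) \<omega>, hist X Y A pol t \<omega>)) \<in> measurable M (ctx_space S \<Otimes>\<^sub>M hist_space S t)"
    using measurable_context[of "Suc t"] Suc by simp
  from measurable_compose[OF this policy_measurable[of "Suc t", simplified]]
  have "(\<lambda>\<omega>. pol (Suc t) (X (Suc t) \<omega>) (hist X Y A pol t \<omega>)) \<in> borel_measurable M" by simp
  then have "(\<lambda>\<omega>. (X (Suc t) \<omega>, pol (Suc t) (X (Suc t) \<omega>) (hist X Y A pol t \<omega>), A (Suc t) \<omega>, observed Y A (Suc t) \<omega>))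
      \<in> measurable M (ctx_space S \<Otimes>\<^sub>M (borel \<Otimes>\<^sub>M (count_space UNIV \<Otimes>\<^sub>M borel)))"
    using measurable_context[of "Suc t"] action_measurable[of "Suc t"] measurable_observed[of "Suc t"]
    by (intro measurable_Pair) auto
  with Suc show ?case
    unfolding hist_space_def hist.simps
    by (intro measurable_fun_upd[where J="{1..t}"]) auto
qed

text \<open>Later rounds update other coordinates, so the record of round \<open>s\<close> stays in
  every longer history. This is how a past term becomes a function of the history.\<close>

lemma hist_nth:
  assumes "1 \<le> s" "s \<le> t"
  shows "hist X Y A pol t \<omega> s = (X s \<omega>, behav X Y A pol s \<omega>, A s \<omega>, observed Y A s \<omega>)"
  using assms(2)
proof (induction t)
  case 0
  then show ?case using assms(1) by simp
next
  case (Suc t)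
  then show ?case by (cases "s = Suc t") (auto simp: behav_def)
qed

lemma measurable_context_hist:
  "t \<ge> 1 \<Longrightarrow> (\<lambda>\<omega>. (X t \<omega>, hist X Y A pol (t - 1) \<omega>)) \<in> measurable M (ctx_space S \<Otimes>\<^sub>M hist_space S (t - 1))"
  using measurable_context measurable_hist by simp

lemma measurable_policy_nth:
  assumes "t \<ge> 1"
  shows "(\<lambda>u. pol t (fst u) (snd u) $ b) \<in> borel_measurable (ctx_space S \<Otimes>\<^sub>M hist_space S (t - 1))"
  using policy_measurable[OF assms] by (simp add: borel_measurable_vec_iff split_def)

lemma measurable_behav:
  assumes "t \<ge> 1"
  shows "behav X Y A pol t \<in> borel_measurable M"
  using measurable_compose[OF measurable_context_hist[OF assms] policy_measurable[OF assms]]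
  by (simp add: behav_def[abs_def])

lemma behav_simplex: "t \<ge> 1 \<Longrightarrow> \<omega> \<in> space M \<Longrightarrow> behav X Y A pol t \<omega> \<in> prob_simplex"
  unfolding behav_def
  by (intro policy_simplex context_in_S measurable_space[OF measurable_hist])

text \<open>\<open>P\<close> is known only as the common law of the rounds;
  \<open>order_refl\<close> selects round 1 to read off its properties.\<close>

lemma sets_P: "sets P = sets (ctx_space S \<Otimes>\<^sub>M borel)"
  by (subst iid_law[OF order_refl, symmetric]) simp

lemma space_P: "space P = S \<times> UNIV"
  using sets_eq_imp_space_eq[OF sets_P] by (simp add: space_pair_measure ctx_space_def space_restrict_space)

lemma prob_space_P: "prob_space P"
  by (subst iid_law[OF order_refl, symmetric])
    (intro prob_space_distr measurable_Pair measurable_context measurable_outcomes order_refl)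

lemma P_transfer:
  fixes f :: "(real^'x) \<times> (real^'k) \<Rightarrow> real"
  assumes t: "t \<ge> 1" and f: "f \<in> borel_measurable P"
  shows "integrable M (\<lambda>\<omega>. f (X t \<omega>, Y t \<omega>)) \<longleftrightarrow> integrable P f"
    and "(\<integral>\<omega>. f (X t \<omega>, Y t \<omega>) \<partial>M) = (\<integral>z. f z \<partial>P)"
proof -
  have XY: "(\<lambda>\<omega>. (X t \<omega>, Y t \<omega>)) \<in> measurable M (ctx_space S \<Otimes>\<^sub>M borel)"
    using measurable_context[OF t] measurable_outcomes[OF t] by simp
  have f': "f \<in> borel_measurable (ctx_space S \<Otimes>\<^sub>M borel)"
    using f measurable_cong_sets[OF sets_P refl] by blast
  show "integrable M (\<lambda>\<omega>. f (X t \<omega>, Y t \<omega>)) \<longleftrightarrow> integrable P f"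
    using integrable_distr_eq[OF XY f'] by (simp add: iid_law[OF t])
  show "(\<integral>\<omega>. f (X t \<omega>, Y t \<omega>) \<partial>M) = (\<integral>z. f z \<partial>P)"
    using integral_distr[OF XY f'] by (simp add: iid_law[OF t])
qed

text \<open>Both factors are measurable for independent sigma-algebras, so the expectation
  factorises. Integrability of the product is a conclusion: independence provides it from
  integrability of the factors.\<close>

lemma past_independence:
  fixes f :: "(real^'x) \<times> (real^'k) \<Rightarrow> real" and D :: "('x, 'k) history \<Rightarrow> real"
  assumes t: "t \<ge> 1" and f: "integrable P f"
    and D: "D \<in> borel_measurable (hist_space S (t - 1))"
    and intD: "integrable M (\<lambda>\<omega>. D (hist X Y A pol (t - 1) \<omega>))"
  shows "integrable M (\<lambda>\<omega>. f (X t \<omega>, Y t \<omega>) * D (hist X Y A pol (t - 1) \<omega>))"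
    and "(\<integral>\<omega>. f (X t \<omega>, Y t \<omega>) * D (hist X Y A pol (t - 1) \<omega>) \<partial>M) =
      (\<integral>z. f z \<partial>P) * (\<integral>\<omega>. D (hist X Y A pol (t - 1) \<omega>) \<partial>M)"
proof -
  have XY: "(\<lambda>\<omega>. (X t \<omega>, Y t \<omega>)) \<in> measurable M (ctx_space S \<Otimes>\<^sub>M borel)"
    using measurable_context[OF t] measurable_outcomes[OF t] by simp
  have f': "f \<in> borel_measurable (ctx_space S \<Otimes>\<^sub>M borel)"
    using borel_measurable_integrable[OF f] measurable_cong_sets[OF sets_P refl] by blast
  define G1 where "G1 = gen_algebra M (ctx_space S \<Otimes>\<^sub>M borel) (\<lambda>\<omega>. (X t \<omega>, Y t \<omega>))"
  define G2 where "G2 = gen_algebra M (hist_space S (t - 1)) (hist X Y A pol (t - 1))"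
  have G: "space G1 = space M" "space G2 = space M"
    by (simp_all add: G1_def G2_def gen_algebra_def)
  have f_G1: "(\<lambda>\<omega>. f (X t \<omega>, Y t \<omega>)) \<in> borel_measurable G1"
    unfolding G1_def gen_algebra_def using measurable_space[OF XY]
    by (intro measurable_compose[OF measurable_vimage_algebra1 f']) auto
  have D_G2: "(\<lambda>\<omega>. D (hist X Y A pol (t - 1) \<omega>)) \<in> borel_measurable G2"
    unfolding G2_def gen_algebra_def using measurable_space[OF measurable_hist]
    by (intro measurable_compose[OF measurable_vimage_algebra1 D]) auto
  have "indep_set (sets G1) (sets G2)"
    using past_indep[OF t] by (simp add: G1_def G2_def)
  \<comment> \<open>Independence passes to the smaller sigma-algebras generated by the two real
    random variables, which is the form that \<open>indep_var\<close> unfolds to.\<close>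
  then have "indep_set
      (sigma_sets (space M) {(\<lambda>\<omega>. f (X t \<omega>, Y t \<omega>)) -` B \<inter> space M | B. B \<in> sets borel})
      (sigma_sets (space M) {(\<lambda>\<omega>. D (hist X Y A pol (t - 1) \<omega>)) -` B \<inter> space M | B. B \<in> sets borel})"
    unfolding indep_set_def
  proof (rule indep_sets_mono_sets)
    have "sigma_sets (space M) {(\<lambda>\<omega>. f (X t \<omega>, Y t \<omega>)) -` B \<inter> space M | B. B \<in> sets borel} \<subseteq> sets G1"
      using measurable_sets[OF f_G1] unfolding G(1)[symmetric] by (intro sets.sigma_sets_subset) auto
    moreover have "sigma_sets (space M) {(\<lambda>\<omega>. D (hist X Y A pol (t - 1) \<omega>)) -` B \<inter> space M | B. B \<in> sets borel} \<subseteq> sets G2"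
      using measurable_sets[OF D_G2] unfolding G(2)[symmetric] by (intro sets.sigma_sets_subset) auto
    ultimately show "case_bool
          (sigma_sets (space M) {(\<lambda>\<omega>. f (X t \<omega>, Y t \<omega>)) -` B \<inter> space M | B. B \<in> sets borel})
          (sigma_sets (space M) {(\<lambda>\<omega>. D (hist X Y A pol (t - 1) \<omega>)) -` B \<inter> space M | B. B \<in> sets borel}) i
        \<subseteq> case_bool (sets G1) (sets G2) i" for i
      by (cases i) auto
  qed
  then have ind: "indep_var borel (\<lambda>\<omega>. f (X t \<omega>, Y t \<omega>)) borel (\<lambda>\<omega>. D (hist X Y A pol (t - 1) \<omega>))"
    unfolding indep_var_eq
    using measurable_compose[OF XY f'] measurable_compose[OF measurable_hist D] by simp
  have int_f: "integrable M (\<lambda>\<omega>. f (X t \<omega>, Y t \<omega>))"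
    using P_transfer(1)[OF t borel_measurable_integrable[OF f]] f by simp
  show "integrable M (\<lambda>\<omega>. f (X t \<omega>, Y t \<omega>) * D (hist X Y A pol (t - 1) \<omega>))"
    by (rule indep_var_integrable[OF ind int_f intD])
  show "(\<integral>\<omega>. f (X t \<omega>, Y t \<omega>) * D (hist X Y A pol (t - 1) \<omega>) \<partial>M) =
      (\<integral>z. f z \<partial>P) * (\<integral>\<omega>. D (hist X Y A pol (t - 1) \<omega>) \<partial>M)"
    using indep_var_lebesgue_integral[OF ind int_f intD]
      P_transfer(2)[OF t borel_measurable_integrable[OF f]] by simp
qed

end

text \<open>This layer carries what the law of large numbers uses: unconfoundedness, and overlap for
  the one arm \<open>a\<close>. The limit policy and the score are added in later layers.\<close>

locale ipw_bandit = contextual_bandit M S P X Y A pol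
  for M :: "'w measure" and S :: "(real^'x) set" and P :: "((real^'x) \<times> (real^'k)) measure"
    and X :: "nat \<Rightarrow> 'w \<Rightarrow> real^'x" and Y :: "nat \<Rightarrow> 'w \<Rightarrow> real^'k" and A :: "nat \<Rightarrow> 'w \<Rightarrow> 'k"
    and pol :: "nat \<Rightarrow> ('x::finite, 'k::finite) policy" +
  fixes a :: 'k and pimin :: real
  assumes unconfounded:
      "\<And>t. t \<ge> 1 \<Longrightarrow>
         cond_indep M (pre_action_algebra M S X Y A pol t) (count_space UNIV) (A t) borel (Y t)"
    and pimin_pos: "0 < pimin"
    and overlap: "\<And>t. t \<ge> 1 \<Longrightarrow> AE \<omega> in M. pimin \<le> behav X Y A pol t \<omega> $ a"
begin

text \<open>The probability is taken at \<open>a\<close> instead of \<open>A t\<close>: the value is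
  the same where the indicator is nonzero, and the denominator becomes a function of X_t and the
  history alone.\<close>

definition ipw :: "nat \<Rightarrow> 'w \<Rightarrow> real" where
  "ipw t \<omega> = indicator {a} (A t \<omega>) / behav X Y A pol t \<omega> $ a"

text \<open>The summand uses the potential outcome of \<open>a\<close> in place of the observed one;
  the weight vanishes where the two may differ.\<close>

definition avg :: "(real^'x \<Rightarrow> real \<Rightarrow> real) \<Rightarrow> nat \<Rightarrow> 'w \<Rightarrow> real" where
  "avg f T \<omega> = (1 / real T) * (\<Sum>t=1..T. ipw t \<omega> * f (X t \<omega>) (Y t \<omega> $ a))"

definition arm_integrable :: "(real^'x \<Rightarrow> real \<Rightarrow> real) \<Rightarrow> bool" where
  "arm_integrable f \<longleftrightarrow> integrable P (\<lambda>(x, y). f x (y $ a))"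

definition arm_mean :: "(real^'x \<Rightarrow> real \<Rightarrow> real) \<Rightarrow> real" where
  "arm_mean f = (\<integral>(x, y). f x (y $ a) \<partial>P)"

lemma ipw_nonneg: "t \<ge> 1 \<Longrightarrow> \<omega> \<in> space M \<Longrightarrow> 0 \<le> ipw t \<omega>"
  using behav_simplex by (auto simp: ipw_def prob_simplex_def)

lemma ipw_le: "t \<ge> 1 \<Longrightarrow> AE \<omega> in M. ipw t \<omega> \<le> 1 / pimin"
  by (rule AE_mp[OF overlap]) (use pimin_pos in \<open>auto simp: ipw_def indicator_def frac_le\<close>)

lemma measurable_ipw: "t \<ge> 1 \<Longrightarrow> ipw t \<in> borel_measurable M"
  unfolding ipw_def[abs_def]
  by (intro borel_measurable_divide measurable_compose[OF action_measurable])
    (use measurable_behav in \<open>auto simp: borel_measurable_vec_iff\<close>)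

text \<open>Given (X_t, H_{t-1}), the conditional probability of A_t = a together with Y_t in C is a
  product by unconfoundedness. Its first factor is pi_t(a) by the action law, and this cancels the
  denominator of the weight.\<close>

lemma integral_ipw_rectangle:
  assumes t: "t \<ge> 1" and B: "B \<in> sets (ctx_space S \<Otimes>\<^sub>M hist_space S (t - 1))" and C: "C \<in> sets borel"
  defines "E \<equiv> {\<omega>\<in>space M. (X t \<omega>, hist X Y A pol (t - 1) \<omega>) \<in> B \<and> Y t \<omega> \<in> C}"
  shows "(\<integral>\<omega>. ipw t \<omega> * indicator E \<omega> \<partial>M) = prob E"
proof -
  define U where "U \<omega> = (X t \<omega>, hist X Y A pol (t - 1) \<omega>)" for \<omega>
  define F where "F = pre_action_algebra M S X Y A pol t"
  define p where "p \<omega> = behav X Y A pol t \<omega> $ a" for \<omega>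
  define Ya where "Ya = {\<omega>\<in>space M. Y t \<omega> \<in> C}"
  define YA where "YA = {\<omega>\<in>space M. A t \<omega> \<in> {a} \<and> Y t \<omega> \<in> C}"
  \<comment> \<open>The part of the weighted indicator that is already determined before the action
    is drawn, hence can be pulled out of the conditional expectation.\<close>
  define f where "f \<omega> = indicator B (U \<omega>) / p \<omega>" for \<omega>
  have U [measurable]: "U \<in> measurable M (ctx_space S \<Otimes>\<^sub>M hist_space S (t - 1))"
    unfolding U_def using measurable_context_hist[OF t] .
  have F: "F = vimage_algebra (space M) U (ctx_space S \<Otimes>\<^sub>M hist_space S (t - 1))"
    by (simp add: F_def pre_action_algebra_def gen_algebra_def U_def[abs_def])
  have UF: "U \<in> measurable F (ctx_space S \<Otimes>\<^sub>M hist_space S (t - 1))"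
    unfolding F using measurable_space[OF U] by (intro measurable_vimage_algebra1) auto
  have "subalgebra M F"
    unfolding subalgebra_def F
    using measurable_sets[OF U] measurable_space[OF U]
    by (auto simp: sets_vimage_algebra2)
  then interpret finite_measure_subalgebra M F
    by unfold_locales
  have p_U: "p = (\<lambda>\<omega>. pol t (fst (U \<omega>)) (snd (U \<omega>)) $ a)"
    by (simp add: p_def[abs_def] U_def behav_def)
  have p_F: "p \<in> borel_measurable F"
    unfolding p_U by (rule measurable_compose[OF UF measurable_policy_nth[OF t]])
  have B_F: "(\<lambda>\<omega>. indicator B (U \<omega>) :: real) \<in> borel_measurable F"
    by (rule measurable_compose[OF UF]) (use B in simp)
  have f_F: "f \<in> borel_measurable F"
    unfolding f_def[abs_def] by (intro borel_measurable_divide B_F p_F)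
  note M_from_F = measurable_from_subalg[OF subalg]
  have [measurable]: "Y t \<in> borel_measurable M" "A t \<in> measurable M (count_space UNIV)"
    "f \<in> borel_measurable M" "p \<in> borel_measurable M"
    "(\<lambda>\<omega>. indicator B (U \<omega>) :: real) \<in> borel_measurable M"
    using measurable_outcomes[OF t] action_measurable[OF t] M_from_F[OF f_F] M_from_F[OF p_F] M_from_F[OF B_F]
    by auto
  have [measurable]: "Ya \<in> sets M" "YA \<in> sets M"
    unfolding Ya_def YA_def using C by measurable
  have p_pos: "AE \<omega> in M. pimin \<le> p \<omega>"
    using overlap[OF t] by (simp add: p_def)
  have int_f: "integrable M (\<lambda>\<omega>. f \<omega> * indicator YA \<omega>)"
  proof (rule integrable_const_bound[where B="1 / pimin"])
    show "AE \<omega> in M. norm (f \<omega> * indicator YA \<omega>) \<le> 1 / pimin"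
      by (rule AE_mp[OF p_pos]) (use pimin_pos in \<open>auto simp: f_def indicator_def frac_le\<close>)
  qed measurable
  have int_B: "integrable M (\<lambda>\<omega>. (indicator B (U \<omega>) :: real) * indicator Ya \<omega>)"
  proof (rule integrable_const_bound[where B=1])
    show "AE \<omega> in M. norm ((indicator B (U \<omega>) :: real) * indicator Ya \<omega>) \<le> 1"
      by (auto simp: indicator_def)
  qed measurable
  have "(\<integral>\<omega>. ipw t \<omega> * indicator E \<omega> \<partial>M) = (\<integral>\<omega>. f \<omega> * indicator YA \<omega> \<partial>M)"
    by (intro Bochner_Integration.integral_cong)
      (auto simp: ipw_def f_def p_def E_def YA_def U_def indicator_def)
  also have "\<dots> = (\<integral>\<omega>. f \<omega> * real_cond_exp M F (indicator YA) \<omega> \<partial>M)"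
    using real_cond_exp_intg(2)[OF int_f f_F] by simp
  also have "\<dots> = (\<integral>\<omega>. indicator B (U \<omega>) * real_cond_exp M F (indicator Ya) \<omega> \<partial>M)"
  proof (rule integral_cong_AE)
    \<comment> \<open>All three identities hold only almost everywhere, including the cancellation
      of \<open>p\<close>, which needs \<open>p\<close> to be nonzero and so relies on
      overlap.\<close>
    have "AE \<omega> in M. real_cond_exp M F (indicator YA) \<omega> =
        real_cond_exp M F (indicator {\<omega>\<in>space M. A t \<omega> \<in> {a}}) \<omega> * real_cond_exp M F (indicator Ya) \<omega>"
      using unconfounded[OF t, folded F_def] C unfolding cond_indep_def YA_def Ya_def by fastforce
    moreover have "AE \<omega> in M. real_cond_exp M F (indicator {\<omega>\<in>space M. A t \<omega> \<in> {a}}) \<omega> = p \<omega>"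
      using action_law[OF t, of a, folded F_def] by (simp add: p_def)
    ultimately show "AE \<omega> in M. f \<omega> * real_cond_exp M F (indicator YA) \<omega> =
        indicator B (U \<omega>) * real_cond_exp M F (indicator Ya) \<omega>"
      using p_pos by eventually_elim (use pimin_pos in \<open>auto simp: f_def\<close>)
  qed measurable
  also have "\<dots> = (\<integral>\<omega>. indicator B (U \<omega>) * indicator Ya \<omega> \<partial>M)"
    using real_cond_exp_intg(2)[OF int_B B_F] by simp
  also have "\<dots> = (\<integral>\<omega>. indicator E \<omega> \<partial>M)"
    by (intro Bochner_Integration.integral_cong) (auto simp: E_def Ya_def U_def indicator_def)
  also have "\<dots> = prob E"
    using Bochner_Integration.integral_indicator[of M E] by (simp add: E_def Int_def conj_commute)
  finally show ?thesis .
qed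

text \<open>Rectangles form an intersection-stable generator that contains the whole space, and the
  two measures are finite and agree on it; uniqueness of measures does the rest.\<close>

lemma ipw_change_of_measure:
  assumes t: "t \<ge> 1"
  defines "V \<equiv> (\<lambda>\<omega>. ((X t \<omega>, hist X Y A pol (t - 1) \<omega>), Y t \<omega>))"
    and "N \<equiv> (ctx_space S \<Otimes>\<^sub>M hist_space S (t - 1)) \<Otimes>\<^sub>M (borel :: (real^'k) measure)"
  shows "distr (density M (\<lambda>\<omega>. ennreal (ipw t \<omega>))) N V = distr M N V"
proof -
  let ?N1 = "ctx_space S \<Otimes>\<^sub>M hist_space S (t - 1) :: ((real^'x) \<times> ('x,'k) history) measure"
  let ?E = "{B \<times> C | B C. B \<in> sets ?N1 \<and> C \<in> sets (borel :: (real^'k) measure)}"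
  have [measurable]: "V \<in> measurable M N" "ipw t \<in> borel_measurable M"
    unfolding V_def N_def using measurable_context_hist[OF t] measurable_outcomes[OF t] measurable_ipw[OF t]
    by (auto intro!: measurable_Pair)
  have N_gen: "sets N = sigma_sets (space N) ?E"
    unfolding N_def space_pair_measure[of ?N1 borel] by (rule sets_pair_measure)
  have eq: "emeasure (distr (density M (\<lambda>\<omega>. ennreal (ipw t \<omega>))) N V) Z = emeasure (distr M N V) Z"
    if Z_E: "Z \<in> ?E" for Z
  proof -
    obtain B C where Z: "Z = B \<times> C" and B: "B \<in> sets ?N1" and C: "C \<in> sets (borel :: (real^'k) measure)"
      using Z_E by blast
    define E where "E = {\<omega>\<in>space M. (X t \<omega>, hist X Y A pol (t - 1) \<omega>) \<in> B \<and> Y t \<omega> \<in> C}"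
    have Z_N: "Z \<in> sets N" unfolding Z N_def using B C by simp
    have vE: "V -` Z \<inter> space M = E" by (auto simp: V_def Z E_def)
    have [measurable]: "E \<in> sets M" unfolding vE[symmetric] using Z_N by measurable
    have int: "integrable M (\<lambda>\<omega>. ipw t \<omega> * indicator E \<omega>)"
    proof (rule integrable_const_bound[where B="1 / pimin"])
      show "AE \<omega> in M. norm (ipw t \<omega> * indicator E \<omega>) \<le> 1 / pimin"
        using ipw_le[OF t] AE_space
        by eventually_elim (use ipw_nonneg[OF t] pimin_pos in \<open>auto simp: indicator_def\<close>)
    qed measurable
    have "emeasure (distr (density M (\<lambda>\<omega>. ennreal (ipw t \<omega>))) N V) Z
        = emeasure (density M (\<lambda>\<omega>. ennreal (ipw t \<omega>))) E"
      using Z_N by (simp add: emeasure_distr vE)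
    also have "\<dots> = (\<integral>\<^sup>+\<omega>. ennreal (ipw t \<omega>) * indicator E \<omega> \<partial>M)"
      by (rule emeasure_density) measurable
    also have "\<dots> = (\<integral>\<^sup>+\<omega>. ennreal (ipw t \<omega> * indicator E \<omega>) \<partial>M)"
      by (intro nn_integral_cong) (auto simp: indicator_def)
    also have "\<dots> = ennreal (\<integral>\<omega>. ipw t \<omega> * indicator E \<omega> \<partial>M)"
      using ipw_nonneg[OF t] by (intro nn_integral_eq_integral int AE_I2) auto
    also have "\<dots> = ennreal (prob E)"
      using integral_ipw_rectangle[OF t B C] by (simp add: E_def)
    also have "\<dots> = emeasure (distr M N V) Z"
      using Z_N by (simp add: emeasure_distr vE emeasure_eq_measure)
    finally show ?thesis .
  qed
  show ?thesis
  proof (rule measure_eqI_generator_eq[where E="?E" and \<Omega>="space N" and A="\<lambda>_. space N"])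
    show "Int_stable ?E" by (rule Int_stable_pair_measure_generator)
    show "?E \<subseteq> Pow (space N)"
      unfolding N_def space_pair_measure[of ?N1 borel] by (rule pair_measure_closed)
    have N_E: "space N \<in> ?E"
      unfolding N_def space_pair_measure[of ?N1 borel] using sets.top[of ?N1] sets.top[of "borel :: (real^'k) measure"] by blast
    then show "range (\<lambda>_::nat. space N) \<subseteq> ?E" by auto
    show "emeasure (distr (density M (\<lambda>\<omega>. ennreal (ipw t \<omega>))) N V) (space N) \<noteq> \<infinity>"
      unfolding eq[OF N_E]
      by (auto simp: emeasure_distr emeasure_eq_measure)
  qed (use eq N_gen in auto)
qed

text \<open>The change of measure in integral form. The integrand may depend on the history, since
  past weighted terms and pi_t itself enter through it; it may not depend on the action of round
  \<open>t\<close>.\<close>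

lemma ipw_transfer:
  fixes f :: "((real^'x) \<times> ('x, 'k) history) \<times> (real^'k) \<Rightarrow> real"
  assumes t: "t \<ge> 1"
    and f: "f \<in> borel_measurable ((ctx_space S \<Otimes>\<^sub>M hist_space S (t - 1)) \<Otimes>\<^sub>M borel)"
  shows "integrable M (\<lambda>\<omega>. ipw t \<omega> * f ((X t \<omega>, hist X Y A pol (t - 1) \<omega>), Y t \<omega>)) \<longleftrightarrow>
      integrable M (\<lambda>\<omega>. f ((X t \<omega>, hist X Y A pol (t - 1) \<omega>), Y t \<omega>))"
    and "(\<integral>\<omega>. ipw t \<omega> * f ((X t \<omega>, hist X Y A pol (t - 1) \<omega>), Y t \<omega>) \<partial>M) =
      (\<integral>\<omega>. f ((X t \<omega>, hist X Y A pol (t - 1) \<omega>), Y t \<omega>) \<partial>M)"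
proof -
  define V where "V = (\<lambda>\<omega>. ((X t \<omega>, hist X Y A pol (t - 1) \<omega>), Y t \<omega>))"
  define N where "N = (ctx_space S \<Otimes>\<^sub>M (hist_space S (t - 1) :: ('x, 'k) history measure)) \<Otimes>\<^sub>M (borel :: (real^'k) measure)"
  define W where "W = density M (\<lambda>\<omega>. ennreal (ipw t \<omega>))"
  have V [measurable]: "V \<in> measurable M N"
    unfolding V_def N_def using measurable_context_hist[OF t] measurable_outcomes[OF t]
    by (auto intro!: measurable_Pair)
  have [measurable]: "ipw t \<in> borel_measurable M" by (rule measurable_ipw[OF t])
  have VW: "V \<in> measurable W N" unfolding W_def by simp
  have fN [measurable]: "f \<in> borel_measurable N" using f by (simp add: N_def)
  have eq: "distr W N V = distr M N V"
    using ipw_change_of_measure[OF t] unfolding W_def N_def V_def .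
  have nonneg: "AE \<omega> in M. 0 \<le> ipw t \<omega>" using ipw_nonneg[OF t] by auto
  have "integrable W (\<lambda>\<omega>. f (V \<omega>)) \<longleftrightarrow> integrable M (\<lambda>\<omega>. f (V \<omega>))"
    using integrable_distr_eq[OF VW fN] integrable_distr_eq[OF V fN] eq by simp
  moreover have "integrable W (\<lambda>\<omega>. f (V \<omega>)) \<longleftrightarrow> integrable M (\<lambda>\<omega>. ipw t \<omega> * f (V \<omega>))"
    unfolding W_def using nonneg by (subst integrable_density) auto
  ultimately show "integrable M (\<lambda>\<omega>. ipw t \<omega> * f ((X t \<omega>, hist X Y A pol (t - 1) \<omega>), Y t \<omega>)) \<longleftrightarrow>
      integrable M (\<lambda>\<omega>. f ((X t \<omega>, hist X Y A pol (t - 1) \<omega>), Y t \<omega>))"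
    by (simp add: V_def)
  have "(\<integral>\<omega>. f (V \<omega>) \<partial>W) = (\<integral>\<omega>. f (V \<omega>) \<partial>M)"
    using integral_distr[OF VW fN] integral_distr[OF V fN] eq by simp
  moreover have "(\<integral>\<omega>. f (V \<omega>) \<partial>W) = (\<integral>\<omega>. ipw t \<omega> * f (V \<omega>) \<partial>M)"
    unfolding W_def using nonneg by (subst integral_density) auto
  ultimately show "(\<integral>\<omega>. ipw t \<omega> * f ((X t \<omega>, hist X Y A pol (t - 1) \<omega>), Y t \<omega>) \<partial>M) =
      (\<integral>\<omega>. f ((X t \<omega>, hist X Y A pol (t - 1) \<omega>), Y t \<omega>) \<partial>M)"
    by (simp add: V_def)
qed

section \<open>A law of large numbers for the weighted averages\<close>

text \<open>Integrability under \<open>P\<close> gives measurability in (x, y) of a function of y $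
  a. Substituting the vector with all entries equal to r recovers measurability in (x, r).\<close>

lemma measurable_arm:
  assumes "arm_integrable f"
  shows "(\<lambda>(x, r). f x r) \<in> borel_measurable (ctx_space S \<Otimes>\<^sub>M borel)"
proof -
  have f: "(\<lambda>(x, y). f x (y $ a)) \<in> borel_measurable (ctx_space S \<Otimes>\<^sub>M borel)"
    using assms measurable_cong_sets[OF sets_P refl] unfolding arm_integrable_def by blast
  have "(\<lambda>z. (fst z, (\<chi> i. snd z) :: real^'k)) \<in> measurable (ctx_space S \<Otimes>\<^sub>M borel) (ctx_space S \<Otimes>\<^sub>M borel)"
    by (intro measurable_Pair) (auto simp: borel_measurable_vec_iff)
  from measurable_compose[OF this f] show ?thesis by (simp add: split_def)
qed

lemma measurable_arm_full:
  assumes "arm_integrable f"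
  shows "(\<lambda>z. f (fst (fst z)) (snd z $ a)) \<in> borel_measurable ((ctx_space S \<Otimes>\<^sub>M H) \<Otimes>\<^sub>M borel)"
proof -
  have "(\<lambda>z. (fst (fst z), (snd z :: real^'k) $ a)) \<in> measurable ((ctx_space S \<Otimes>\<^sub>M H) \<Otimes>\<^sub>M borel) (ctx_space S \<Otimes>\<^sub>M borel)"
    by measurable
  from measurable_compose[OF this measurable_arm[OF assms]] show ?thesis by simp
qed

lemma arm_sample:
  assumes f: "arm_integrable f" and t: "t \<ge> 1"
  shows "integrable M (\<lambda>\<omega>. f (X t \<omega>) (Y t \<omega> $ a))"
    and "(\<integral>\<omega>. f (X t \<omega>) (Y t \<omega> $ a) \<partial>M) = arm_mean f"
proof -
  have f_P: "integrable P (\<lambda>(x, y). f x (y $ a))" using f unfolding arm_integrable_def .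
  note tr = P_transfer[OF t borel_measurable_integrable[OF f_P], unfolded prod.case]
  show "integrable M (\<lambda>\<omega>. f (X t \<omega>) (Y t \<omega> $ a))"
    unfolding tr(1) by (rule f_P)
  show "(\<integral>\<omega>. f (X t \<omega>) (Y t \<omega> $ a) \<partial>M) = arm_mean f"
    unfolding arm_mean_def by (rule tr(2))
qed

text \<open>Unbiasedness of inverse-propensity weighting: the weight is dropped by the change of
  measure, and what remains has law \<open>P\<close>.\<close>

lemma ipw_arm_sample:
  assumes f: "arm_integrable f" and t: "t \<ge> 1"
  shows "integrable M (\<lambda>\<omega>. ipw t \<omega> * f (X t \<omega>) (Y t \<omega> $ a))"
    and "(\<integral>\<omega>. ipw t \<omega> * f (X t \<omega>) (Y t \<omega> $ a) \<partial>M) = arm_mean f"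
proof -
  note tr = ipw_transfer[OF t measurable_arm_full[OF f], unfolded fst_conv snd_conv]
  show "integrable M (\<lambda>\<omega>. ipw t \<omega> * f (X t \<omega>) (Y t \<omega> $ a))"
    unfolding tr(1) by (rule arm_sample[OF f t])
  show "(\<integral>\<omega>. ipw t \<omega> * f (X t \<omega>) (Y t \<omega> $ a) \<partial>M) = arm_mean f"
    unfolding tr(2) by (rule arm_sample[OF f t])
qed

lemma arm_integrable_clip:
  assumes "arm_integrable f"
  shows "arm_integrable (\<lambda>x r. clip b (f x r))"
proof -
  interpret P: prob_space P by (rule prob_space_P)
  have [measurable]: "(\<lambda>(x, y). f x (y $ a)) \<in> borel_measurable P"
    using assms by (auto simp: arm_integrable_def)
  have "integrable P (\<lambda>z. clip b ((\<lambda>(x, y). f x (y $ a)) z))"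
    by (rule P.integrable_const_bound[where B="\<bar>b\<bar>"]) (auto simp: clip_def)
  then show ?thesis by (simp add: arm_integrable_def split_def)
qed

lemma integrable_avg:
  assumes "arm_integrable f"
  shows "integrable M (avg f T)"
  unfolding avg_def[abs_def]
  by (intro integrable_mult_right Bochner_Integration.integrable_sum ipw_arm_sample assms) auto

lemma avg_diff: "avg (\<lambda>x r. f x r - h x r) T \<omega> = avg f T \<omega> - avg h T \<omega>"
  by (simp add: avg_def algebra_simps sum_subtractf)

lemma avg_cmult: "avg (\<lambda>x r. c * f x r) T \<omega> = c * avg f T \<omega>"
  by (simp add: avg_def sum_distrib_left mult_ac)

lemma avg_mono:
  assumes \<omega>: "\<omega> \<in> space M" and le: "\<And>x r. x \<in> S \<Longrightarrow> f x r \<le> h x r"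
  shows "avg f T \<omega> \<le> avg h T \<omega>"
  unfolding avg_def
  by (intro mult_left_mono sum_mono) (use ipw_nonneg context_in_S \<omega> le in auto)

lemma abs_avg_le:
  assumes \<omega>: "\<omega> \<in> space M" and le: "\<And>x r. x \<in> S \<Longrightarrow> \<bar>f x r\<bar> \<le> h x r"
  shows "\<bar>avg f T \<omega>\<bar> \<le> avg h T \<omega>"
proof (rule abs_leI)
  show "avg f T \<omega> \<le> avg h T \<omega>"
    using le by (intro avg_mono[OF \<omega>]) (auto dest: abs_le_D1)
  have "avg (\<lambda>x r. -1 * f x r) T \<omega> \<le> avg h T \<omega>"
    using le by (intro avg_mono[OF \<omega>]) (auto dest: abs_le_D2)
  then show "- avg f T \<omega> \<le> avg h T \<omega>" by (simp only: avg_cmult)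
qed

text \<open>Past weighted terms are functions of the history, because the weight vanishes unless the
  observed outcome is that of the arm.\<close>

lemma ipw_orthogonal:
  assumes f: "arm_integrable f" and s: "1 \<le> s" and st: "s < t"
  defines "D \<equiv> \<lambda>t \<omega>. ipw t \<omega> * f (X t \<omega>) (Y t \<omega> $ a) - arm_mean f"
  shows "(\<integral>\<omega>. D s \<omega> * D t \<omega> \<partial>M) = 0"
proof -
  have t: "t \<ge> 1" using s st by simp
  define past where "past h = (\<lambda>(x, p, k, r). indicator {a} k / (p $ a) * f x r - arm_mean f) (h s)"
    for h :: "('x, 'k) history"
  have past_eq: "D s \<omega> = past (hist X Y A pol (t - 1) \<omega>)" for \<omega>
    using hist_nth[of s "t - 1" \<omega>] s st
    by (auto simp: D_def past_def ipw_def observed_def indicator_def)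
  have past_meas: "past \<in> borel_measurable (hist_space S (t - 1))"
  proof -
    let ?R = "ctx_space S \<Otimes>\<^sub>M (borel \<Otimes>\<^sub>M (count_space UNIV \<Otimes>\<^sub>M borel)) :: ((real^'x) \<times> (real^'k) \<times> 'k \<times> real) measure"
    have comp: "(\<lambda>h. h s) \<in> measurable (hist_space S (t - 1)) ?R"
      unfolding hist_space_def using s st by (intro measurable_component_singleton) auto
    have "(\<lambda>z::(real^'x) \<times> (real^'k) \<times> 'k \<times> real. (fst z, snd (snd (snd z)))) \<in> measurable ?R (ctx_space S \<Otimes>\<^sub>M borel)"
      by measurable
    from measurable_compose[OF this measurable_arm[OF f]]
    have 1: "(\<lambda>z. f (fst z) (snd (snd (snd z)))) \<in> borel_measurable ?R" by simp
    have 2: "(\<lambda>z. fst (snd z) $ a) \<in> borel_measurable ?R"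
      by measurable
    have 3: "(\<lambda>z. indicator {a} (fst (snd (snd z))) :: real) \<in> borel_measurable ?R"
      by (rule measurable_compose[where N="count_space UNIV"]) auto
    have "(\<lambda>z. indicator {a} (fst (snd (snd z))) / (fst (snd z) $ a) * f (fst z) (snd (snd (snd z))) - arm_mean f)
        \<in> borel_measurable ?R"
      by (intro borel_measurable_diff borel_measurable_times borel_measurable_divide 1 2 3) auto
    from measurable_compose[OF comp this] show ?thesis
      by (simp add: past_def[abs_def] split_def)
  qed
  have int_past: "integrable M (\<lambda>\<omega>. past (hist X Y A pol (t - 1) \<omega>))"
    unfolding past_eq[symmetric] D_def by (intro Bochner_Integration.integrable_diff ipw_arm_sample f s) auto
  have past0: "(\<integral>\<omega>. past (hist X Y A pol (t - 1) \<omega>) \<partial>M) = 0"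
    unfolding past_eq[symmetric] D_def using ipw_arm_sample[OF f s] by (simp add: prob_space)
  have f_P: "integrable P (\<lambda>(x, y). f x (y $ a))" using f by (simp add: arm_integrable_def)
  \<comment> \<open>The past factor is centred, so independence makes the unweighted product
    integrate to zero; the weight of round \<open>t\<close> is then put back by the change of
    measure.\<close>
  have fp: "integrable M (\<lambda>\<omega>. f (X t \<omega>) (Y t \<omega> $ a) * past (hist X Y A pol (t - 1) \<omega>))"
    "(\<integral>\<omega>. f (X t \<omega>) (Y t \<omega> $ a) * past (hist X Y A pol (t - 1) \<omega>) \<partial>M) = 0"
    using past_independence[OF t f_P past_meas int_past] past0 by auto
  have "(\<lambda>z. f (fst (fst z)) (snd z $ a) * past (snd (fst z)))
      \<in> borel_measurable ((ctx_space S \<Otimes>\<^sub>M hist_space S (t - 1)) \<Otimes>\<^sub>M borel)"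
    by (intro borel_measurable_times measurable_arm_full[OF f] measurable_compose[OF _ past_meas]) measurable
  from ipw_transfer[OF t this] fp
  have wfp: "integrable M (\<lambda>\<omega>. ipw t \<omega> * (f (X t \<omega>) (Y t \<omega> $ a) * past (hist X Y A pol (t - 1) \<omega>)))"
    "(\<integral>\<omega>. ipw t \<omega> * (f (X t \<omega>) (Y t \<omega> $ a) * past (hist X Y A pol (t - 1) \<omega>)) \<partial>M) = 0"
    by simp_all
  have "(\<integral>\<omega>. D s \<omega> * D t \<omega> \<partial>M) =
      (\<integral>\<omega>. ipw t \<omega> * (f (X t \<omega>) (Y t \<omega> $ a) * past (hist X Y A pol (t - 1) \<omega>))
           - arm_mean f * past (hist X Y A pol (t - 1) \<omega>) \<partial>M)"
    unfolding past_eq by (simp add: D_def algebra_simps)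
  also have "\<dots> = 0"
    using wfp int_past past0 by (subst Bochner_Integration.integral_diff) auto
  finally show ?thesis .
qed

text \<open>In the expanded square the off-diagonal terms vanish by orthogonality. The T diagonal
  terms are bounded by a constant, and the prefactor 1/T^2 leaves order 1/T.\<close>

lemma avg_variance_bound:
  assumes f: "arm_integrable f" and bd: "\<And>x r. \<bar>f x r\<bar> \<le> b"
  obtains K where "K \<ge> 0" "\<And>T. T \<ge> 1 \<Longrightarrow> integrable M (\<lambda>\<omega>. (avg f T \<omega> - arm_mean f)\<^sup>2)"
    "\<And>T. T \<ge> 1 \<Longrightarrow> (\<integral>\<omega>. (avg f T \<omega> - arm_mean f)\<^sup>2 \<partial>M) \<le> K / real T"
proof -
  define m where "m = arm_mean f"
  define D where "D t \<omega> = ipw t \<omega> * f (X t \<omega>) (Y t \<omega> $ a) - m" for t \<omega>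
  \<comment> \<open>An almost sure bound for one centred term: weight at most 1/pimin, function at
    most b, plus the size of the mean.\<close>
  define c where "c = b / pimin + \<bar>m\<bar>"
  have b: "b \<ge> 0" using bd[of undefined undefined] by linarith
  have c: "c \<ge> 0" using b pimin_pos by (simp add: c_def)
  have D_meas: "D t \<in> borel_measurable M" if "t \<ge> 1" for t
    unfolding D_def[abs_def] using ipw_arm_sample(1)[OF f that] by auto
  have D_bd: "AE \<omega> in M. \<bar>D t \<omega>\<bar> \<le> c" if t: "t \<ge> 1" for t
    using ipw_le[OF t] AE_space
  proof eventually_elim
    case (elim \<omega>)
    have "\<bar>ipw t \<omega>\<bar> * \<bar>f (X t \<omega>) (Y t \<omega> $ a)\<bar> \<le> (1 / pimin) * b"
      using elim ipw_nonneg[OF t] pimin_pos bd by (intro mult_mono) auto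
    then show ?case
      unfolding D_def c_def abs_mult[symmetric] by simp
  qed
  have DD_bd: "AE \<omega> in M. \<bar>D s \<omega> * D t \<omega>\<bar> \<le> c * c" if "s \<ge> 1" "t \<ge> 1" for s t
    using D_bd[OF that(1)] D_bd[OF that(2)]
    by eventually_elim (use c in \<open>auto simp: abs_mult intro: mult_mono\<close>)
  have DD_int: "integrable M (\<lambda>\<omega>. D s \<omega> * D t \<omega>)" if "s \<ge> 1" "t \<ge> 1" for s t
    by (rule integrable_const_bound[where B="c * c"]) (use DD_bd that D_meas in auto)
  have DD: "(\<integral>\<omega>. D s \<omega> * D t \<omega> \<partial>M) = 0" if "s \<ge> 1" "t \<ge> 1" "s \<noteq> t" for s t
  proof (cases "s < t")
    case True
    then show ?thesis using ipw_orthogonal[OF f that(1)] by (simp add: D_def m_def)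
  next
    case False
    then have "t < s" using that by simp
    then show ?thesis using ipw_orthogonal[OF f that(2)] by (simp add: D_def m_def mult.commute)
  qed
  have DD_same: "(\<integral>\<omega>. D t \<omega> * D t \<omega> \<partial>M) \<le> c * c" if t: "t \<ge> 1" for t
  proof -
    have "AE \<omega> in M. D t \<omega> * D t \<omega> \<le> c * c"
      using DD_bd[OF t t] by eventually_elim auto
    from integral_mono_AE[OF DD_int[OF t t] _ this] show ?thesis by (simp add: prob_space)
  qed
  have avg_eq: "(avg f T \<omega> - m)\<^sup>2 = (1 / (real T)\<^sup>2) * (\<Sum>s=1..T. \<Sum>t=1..T. D s \<omega> * D t \<omega>)"
    if "T \<ge> 1" for T \<omega>
  proof -
    have "avg f T \<omega> - m = (1 / real T) * (\<Sum>t=1..T. D t \<omega>)"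
      using that by (simp add: avg_def D_def sum_subtractf field_simps)
    then show ?thesis
      by (simp add: power2_eq_square sum_product)
  qed
  show ?thesis
  proof (rule that[of "c * c"])
    fix T :: nat assume T: "T \<ge> 1"
    show "integrable M (\<lambda>\<omega>. (avg f T \<omega> - arm_mean f)\<^sup>2)"
      unfolding m_def[symmetric] avg_eq[OF T]
      by (intro integrable_mult_right Bochner_Integration.integrable_sum DD_int) auto
    have "(\<integral>\<omega>. (avg f T \<omega> - arm_mean f)\<^sup>2 \<partial>M) =
        (1 / (real T)\<^sup>2) * (\<Sum>s=1..T. \<Sum>t=1..T. (\<integral>\<omega>. D s \<omega> * D t \<omega> \<partial>M))"
      unfolding m_def[symmetric] avg_eq[OF T]
      by (subst integral_mult_right_zero, subst Bochner_Integration.integral_sum,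
          (intro Bochner_Integration.integrable_sum DD_int; auto),
          intro arg_cong2[where f="(*)"] refl sum.cong Bochner_Integration.integral_sum DD_int; auto)
    also have "(\<Sum>s=1..T. \<Sum>t=1..T. (\<integral>\<omega>. D s \<omega> * D t \<omega> \<partial>M)) \<le> (\<Sum>s=1..T. c * c)"
    proof (intro sum_mono)
      fix s assume s: "s \<in> {1..T}"
      have "(\<Sum>t=1..T. (\<integral>\<omega>. D s \<omega> * D t \<omega> \<partial>M)) = (\<Sum>t\<in>{s}. (\<integral>\<omega>. D s \<omega> * D t \<omega> \<partial>M))"
        using s DD by (intro sum.mono_neutral_right) auto
      then show "(\<Sum>t=1..T. (\<integral>\<omega>. D s \<omega> * D t \<omega> \<partial>M)) \<le> c * c"
        using DD_same s by simp
    qed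
    finally show "(\<integral>\<omega>. (avg f T \<omega> - arm_mean f)\<^sup>2 \<partial>M) \<le> (c * c) / real T"
      using T by (simp add: power2_eq_square field_simps mult_left_mono)
  qed (use c in simp)
qed

text \<open>The passage from L2 to L1 goes through |z| \<le> e + z^2 / e: either |z| is at most e,
  or e |z| is at most z^2. For fixed \<open>e\<close> the second term inherits the 1/T rate of the
  variance.\<close>

lemma avg_L1_bounded:
  assumes f: "arm_integrable f" and bd: "\<And>x r. \<bar>f x r\<bar> \<le> b"
  shows "(\<lambda>T. \<integral>\<omega>. \<bar>avg f T \<omega> - arm_mean f\<bar> \<partial>M) \<longlonglongrightarrow> 0"
proof (rule tendsto_zero_upto_eps)
  fix e :: real assume e: "e > 0"
  obtain K where K: "K \<ge> 0" "\<And>T. T \<ge> 1 \<Longrightarrow> integrable M (\<lambda>\<omega>. (avg f T \<omega> - arm_mean f)\<^sup>2)"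
    "\<And>T. T \<ge> 1 \<Longrightarrow> (\<integral>\<omega>. (avg f T \<omega> - arm_mean f)\<^sup>2 \<partial>M) \<le> K / real T"
    using avg_variance_bound[OF f bd] by blast
  have "(\<integral>\<omega>. \<bar>avg f T \<omega> - arm_mean f\<bar> \<partial>M) \<le> e + (K / e) / real T" if T: "T \<ge> 1" for T
  proof -
    have le: "\<bar>z\<bar> \<le> e + z\<^sup>2 / e" for z :: real
    proof (cases "\<bar>z\<bar> \<le> e")
      case False
      then have "e * \<bar>z\<bar> \<le> \<bar>z\<bar> * \<bar>z\<bar>" by (intro mult_right_mono) auto
      then have "e * \<bar>z\<bar> \<le> z\<^sup>2" by (simp add: power2_eq_square)
      then have "\<bar>z\<bar> \<le> z\<^sup>2 / e" using e by (simp add: field_simps)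
      then show ?thesis using e by linarith
    qed (use e in \<open>simp add: add_increasing2\<close>)
    have "(\<integral>\<omega>. \<bar>avg f T \<omega> - arm_mean f\<bar> \<partial>M) \<le> (\<integral>\<omega>. e + (avg f T \<omega> - arm_mean f)\<^sup>2 / e \<partial>M)"
      using integrable_avg[OF f] K(2)[OF T] le by (intro integral_mono) auto
    also have "\<dots> = e + (\<integral>\<omega>. (avg f T \<omega> - arm_mean f)\<^sup>2 \<partial>M) / e"
      using K(2)[OF T] by (subst Bochner_Integration.integral_add) (auto simp: prob_space)
    also have "\<dots> \<le> e + (K / real T) / e"
      using K(3)[OF T] e by (intro add_left_mono divide_right_mono) auto
    finally show ?thesis by (simp add: mult.commute)
  qed
  then show "\<exists>r. r \<longlonglongrightarrow> 0 \<and> (\<forall>\<^sub>F T in sequentially. (\<integral>\<omega>. \<bar>avg f T \<omega> - arm_mean f\<bar> \<partial>M) \<le> e + r T)"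
    by (intro exI[of _ "\<lambda>T. (K / e) / real T"] conjI lim_const_over_n eventually_sequentiallyI[of 1])
qed auto

text \<open>Weighted averaging contracts L1 norms, by unbiasedness applied to |f|. This makes the
  truncation error uniform in \<open>T\<close>.\<close>

lemma arm_mean_abs_avg_le:
  assumes f: "arm_integrable f" and T: "T \<ge> 1"
  shows "(\<integral>\<omega>. \<bar>avg f T \<omega>\<bar> \<partial>M) \<le> arm_mean (\<lambda>x r. \<bar>f x r\<bar>)"
proof -
  have af: "arm_integrable (\<lambda>x r. \<bar>f x r\<bar>)"
    using integrable_abs[OF f[unfolded arm_integrable_def]] by (simp add: arm_integrable_def split_def)
  have "(\<integral>\<omega>. \<bar>avg f T \<omega>\<bar> \<partial>M) \<le> (\<integral>\<omega>. avg (\<lambda>x r. \<bar>f x r\<bar>) T \<omega> \<partial>M)"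
    by (intro integral_mono integrable_abs integrable_avg f af abs_avg_le) auto
  also have "\<dots> = (1 / real T) * (\<Sum>t=1..T. arm_mean (\<lambda>x r. \<bar>f x r\<bar>))"
    unfolding avg_def
    by (subst integral_mult_right_zero, subst Bochner_Integration.integral_sum)
      (use ipw_arm_sample[OF af] in \<open>auto intro!: sum.cong\<close>)
  finally show ?thesis using T by simp
qed

text \<open>The clipped part falls under the bounded case. The rest has L1 norm below e/2 and is
  paid for twice, once in the average and once in the mean.\<close>

theorem avg_L1:
  assumes f: "arm_integrable f"
  shows "(\<lambda>T. \<integral>\<omega>. \<bar>avg f T \<omega> - arm_mean f\<bar> \<partial>M) \<longlonglongrightarrow> 0"
proof (rule tendsto_zero_upto_eps)
  fix e :: real assume e: "e > 0"
  have f_P: "integrable P (\<lambda>(x, y). f x (y $ a))" using f by (simp add: arm_integrable_def)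
  obtain b where b: "b \<ge> 0"
    "(\<integral>z. \<bar>(\<lambda>(x, y). f x (y $ a)) z - clip b ((\<lambda>(x, y). f x (y $ a)) z)\<bar> \<partial>P) < e / 2"
    using ex_clip_approx[OF f_P, of "e / 2"] e by auto
  define fc where "fc x r = clip b (f x r)" for x r
  define d where "d x r = f x r - fc x r" for x r
  have fc: "arm_integrable fc" unfolding fc_def[abs_def] by (rule arm_integrable_clip[OF f])
  have d: "arm_integrable d"
    using Bochner_Integration.integrable_diff[OF f_P fc[unfolded arm_integrable_def]]
    by (simp add: arm_integrable_def d_def split_def)
  have mean_d: "arm_mean d = arm_mean f - arm_mean fc"
    using Bochner_Integration.integral_diff[OF f_P fc[unfolded arm_integrable_def]]
    by (simp add: arm_mean_def d_def split_def)
  have abs_d: "arm_mean (\<lambda>x r. \<bar>d x r\<bar>) < e / 2"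
    using b(2) by (simp add: arm_mean_def d_def fc_def split_def)
  have abs_mean_d: "\<bar>arm_mean d\<bar> \<le> arm_mean (\<lambda>x r. \<bar>d x r\<bar>)"
    using integral_abs_bound[of P "\<lambda>(x, y). d x (y $ a)"] by (simp add: arm_mean_def split_def)
  define r where "r T = (\<integral>\<omega>. \<bar>avg fc T \<omega> - arm_mean fc\<bar> \<partial>M)" for T
  have "r \<longlonglongrightarrow> 0"
    unfolding r_def[abs_def] using abs_clip_le[OF b(1)]
    by (intro avg_L1_bounded[where b=b] fc) (simp add: fc_def)
  moreover have "(\<integral>\<omega>. \<bar>avg f T \<omega> - arm_mean f\<bar> \<partial>M) \<le> e + r T" if T: "T \<ge> 1" for T
  proof -
    have "(\<integral>\<omega>. \<bar>avg f T \<omega> - arm_mean f\<bar> \<partial>M) \<le>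
        (\<integral>\<omega>. (\<bar>avg d T \<omega>\<bar> + \<bar>arm_mean d\<bar>) + \<bar>avg fc T \<omega> - arm_mean fc\<bar> \<partial>M)"
    proof (rule integral_mono)
      fix \<omega>
      have "avg d T \<omega> = avg f T \<omega> - avg fc T \<omega>" unfolding d_def[abs_def] by (rule avg_diff)
      then show "\<bar>avg f T \<omega> - arm_mean f\<bar> \<le> (\<bar>avg d T \<omega>\<bar> + \<bar>arm_mean d\<bar>) + \<bar>avg fc T \<omega> - arm_mean fc\<bar>"
        using mean_d by linarith
    qed (use integrable_avg f fc d in auto)
    also have "\<dots> = ((\<integral>\<omega>. \<bar>avg d T \<omega>\<bar> \<partial>M) + \<bar>arm_mean d\<bar>) + r T"
      unfolding r_def using integrable_avg[OF d] integrable_avg[OF fc]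
      by (subst Bochner_Integration.integral_add, simp, simp, subst Bochner_Integration.integral_add)
        (auto simp: prob_space)
    also have "\<dots> \<le> e + r T"
      using arm_mean_abs_avg_le[OF d T] abs_mean_d abs_d by linarith
    finally show ?thesis .
  qed
  ultimately show "\<exists>r. r \<longlonglongrightarrow> 0 \<and> (\<forall>\<^sub>F T in sequentially. (\<integral>\<omega>. \<bar>avg f T \<omega> - arm_mean f\<bar> \<partial>M) \<le> e + r T)"
    by (intro exI[of _ r] conjI eventually_sequentiallyI[of 1])
qed auto

corollary whp_avg:
  assumes "arm_integrable f" "e > 0"
  shows "whp M (\<lambda>T \<omega>. \<bar>avg f T \<omega> - arm_mean f\<bar> \<le> e)"
  by (rule whp_Markov[OF _ _ avg_L1[OF assms(1)] assms(2)]) (use integrable_avg[OF assms(1)] in auto)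

corollary whp_avg_bounded:
  assumes "arm_integrable f"
  shows "whp M (\<lambda>T \<omega>. avg f T \<omega> \<le> arm_mean f + 1)"
  by (rule whp_mono[OF whp_avg[OF assms, of 1]]) (auto intro!: always_eventually simp: abs_le_iff)

end

section \<open>The arm under a stabilising policy\<close>

context ipw_bandit
begin

lemma arm_integrable_bound:
  assumes h: "arm_integrable h" and f: "(\<lambda>(x, r). f x r) \<in> borel_measurable (ctx_space S \<Otimes>\<^sub>M borel)"
    and le: "\<And>x r. x \<in> S \<Longrightarrow> \<bar>f x r\<bar> \<le> h x r"
  shows "arm_integrable f"
  unfolding arm_integrable_def
proof (rule Bochner_Integration.integrable_bound[OF h[unfolded arm_integrable_def]])
  have "(\<lambda>z. (fst z, (snd z :: real^'k) $ a)) \<in> measurable (ctx_space S \<Otimes>\<^sub>M borel) (ctx_space S \<Otimes>\<^sub>M borel)"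
    by measurable
  from measurable_compose[OF this f]
  have "(\<lambda>(x, y). f x (y $ a)) \<in> borel_measurable (ctx_space S \<Otimes>\<^sub>M (borel :: (real^'k) measure))"
    by (simp add: split_def)
  then show "(\<lambda>(x, y). f x (y $ a)) \<in> borel_measurable P"
    using measurable_cong_sets[OF sets_P refl] by blast
  show "AE z in P. norm (case z of (x, y) \<Rightarrow> f x (y $ a)) \<le> norm (case z of (x, y) \<Rightarrow> h x (y $ a))"
  proof (rule AE_I2)
    fix z assume "z \<in> space P"
    then have "fst z \<in> S" by (auto simp: space_P)
    from le[OF this, of "snd z $ a"]
    show "norm (case z of (x, y) \<Rightarrow> f x (y $ a)) \<le> norm (case z of (x, y) \<Rightarrow> h x (y $ a))"
      by (auto simp: split_def)
  qed
qed

lemma arm_integrable_const: "arm_integrable (\<lambda>x r. c)"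
proof -
  interpret P: prob_space P by (rule prob_space_P)
  show ?thesis by (simp add: arm_integrable_def split_def)
qed

lemma arm_integrable_add:
  "arm_integrable f \<Longrightarrow> arm_integrable h \<Longrightarrow> arm_integrable (\<lambda>x r. f x r + h x r)"
  using Bochner_Integration.integrable_add[of P "\<lambda>(x, y). f x (y $ a)" "\<lambda>(x, y). h x (y $ a)"]
  by (simp add: arm_integrable_def split_def)

lemma arm_integrable_cmult: "arm_integrable f \<Longrightarrow> arm_integrable (\<lambda>x r. c * f x r)"
  using integrable_mult_right[of c P "\<lambda>(x, y). f x (y $ a)"]
  by (simp add: arm_integrable_def split_def)

lemma arm_mean_nonneg:
  assumes "\<And>x r. x \<in> S \<Longrightarrow> 0 \<le> f x r"
  shows "0 \<le> arm_mean f"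
  unfolding arm_mean_def
  by (rule Bochner_Integration.integral_nonneg_AE, rule AE_I2) (use assms in \<open>auto simp: space_P\<close>)

lemma abs_arm_mean_diff_le:
  assumes "arm_integrable f" "arm_integrable h" "arm_integrable k"
    and le: "\<And>x r. x \<in> S \<Longrightarrow> \<bar>f x r - h x r\<bar> \<le> k x r"
  shows "\<bar>arm_mean f - arm_mean h\<bar> \<le> arm_mean k"
proof -
  note [simp] = assms(1-3)[unfolded arm_integrable_def split_def]
  have "\<bar>arm_mean f - arm_mean h\<bar> = \<bar>\<integral>z. f (fst z) (snd z $ a) - h (fst z) (snd z $ a) \<partial>P\<bar>"
    by (simp add: arm_mean_def split_def)
  also have "\<dots> \<le> (\<integral>z. \<bar>f (fst z) (snd z $ a) - h (fst z) (snd z $ a)\<bar> \<partial>P)"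
    by (rule integral_abs_bound)
  also have "\<dots> \<le> arm_mean k"
    unfolding arm_mean_def split_def
    by (rule integral_mono) (use le in \<open>auto simp: space_P\<close>)
  finally show ?thesis .
qed

end

locale stable_ipw_bandit = ipw_bandit M S P X Y A pol a pimin
  for M :: "'w measure" and S :: "(real^'x) set" and P :: "((real^'x) \<times> (real^'k)) measure"
    and X :: "nat \<Rightarrow> 'w \<Rightarrow> real^'x" and Y :: "nat \<Rightarrow> 'w \<Rightarrow> real^'k" and A :: "nat \<Rightarrow> 'w \<Rightarrow> 'k"
    and pol :: "nat \<Rightarrow> ('x::finite, 'k::finite) policy" and a :: 'k and pimin :: real +
  fixes pibar :: "real^'x \<Rightarrow> real^'k"
  assumes pibar_measurable: "pibar \<in> borel_measurable (ctx_space S)"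
    and pibar_simplex: "\<And>x. x \<in> S \<Longrightarrow> pibar x \<in> prob_simplex"
    and policy_limit:
      "conv_in_prob M (\<lambda>t \<omega>. behav X Y A pol t \<omega> $ a - pibar (X t \<omega>) $ a) 0"
begin

lemma measurable_pibar_nth: "(\<lambda>x. pibar x $ b) \<in> borel_measurable (ctx_space S)"
  using pibar_measurable by (simp add: borel_measurable_vec_iff)

text \<open>All contexts have the same law, so the exceptional probabilities for the limit policy are
  constant in \<open>t\<close> and vanish in the limit.\<close>

lemma pibar_overlap: "AE z in P. pimin \<le> pibar (fst z) $ a"
proof -
  interpret P: prob_space P by (rule prob_space_P)
  define B where "B k = {z\<in>space P. pibar (fst z) $ a < pimin - 1 / real (Suc k)}" for k
  have fst_meas: "(\<lambda>z. pibar (fst z) $ a) \<in> borel_measurable (ctx_space S \<Otimes>\<^sub>M (borel :: (real^'k) measure))"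
    by (rule measurable_compose[OF measurable_fst measurable_pibar_nth])
  then have [measurable]: "(\<lambda>z. pibar (fst z) $ a) \<in> borel_measurable P"
    using measurable_cong_sets[OF sets_P refl] by blast
  have B [measurable]: "B k \<in> sets P" for k unfolding B_def by measurable
  have B0: "P.prob (B k) = 0" for k
  proof -
    \<comment> \<open>On \<open>B k\<close> the limit policy lies more than 1/(k+1) below pimin
      while pi_t(a) is almost surely at least pimin, so the two differ by more than 1/(k+1). The
      left side does not depend on \<open>t\<close>; the right side tends to zero.\<close>
    have le: "P.prob (B k) \<le> prob {\<omega>\<in>space M. dist (behav X Y A pol t \<omega> $ a - pibar (X t \<omega>) $ a) 0 > 1 / real (Suc k)}"
      if t: "t \<ge> 1" for t
    proof -
      have XY: "(\<lambda>\<omega>. (X t \<omega>, Y t \<omega>)) \<in> measurable M (ctx_space S \<Otimes>\<^sub>M borel)"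
        using measurable_context[OF t] measurable_outcomes[OF t] by simp
      have "P.prob (B k) = measure (distr M (ctx_space S \<Otimes>\<^sub>M borel) (\<lambda>\<omega>. (X t \<omega>, Y t \<omega>))) (B k)"
        by (simp add: iid_law[OF t])
      also have "\<dots> = prob ((\<lambda>\<omega>. (X t \<omega>, Y t \<omega>)) -` B k \<inter> space M)"
        using B sets_P by (intro measure_distr XY) auto
      also have "\<dots> \<le> prob {\<omega>\<in>space M. dist (behav X Y A pol t \<omega> $ a - pibar (X t \<omega>) $ a) 0 > 1 / real (Suc k)}"
      proof (rule finite_measure_mono_AE)
        show "AE \<omega> in M. \<omega> \<in> (\<lambda>\<omega>. (X t \<omega>, Y t \<omega>)) -` B k \<inter> space M \<longrightarrow>
            \<omega> \<in> {\<omega>\<in>space M. dist (behav X Y A pol t \<omega> $ a - pibar (X t \<omega>) $ a) 0 > 1 / real (Suc k)}"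
          using overlap[OF t]
          by eventually_elim (auto simp: B_def dist_real_def)
        have [measurable]: "(\<lambda>\<omega>. behav X Y A pol t \<omega> $ a - pibar (X t \<omega>) $ a) \<in> borel_measurable M"
          using policy_limit t unfolding conv_in_prob_def by blast
        show "{\<omega>\<in>space M. dist (behav X Y A pol t \<omega> $ a - pibar (X t \<omega>) $ a) 0 > 1 / real (Suc k)} \<in> events"
          by measurable
      qed
      finally show ?thesis .
    qed
    have "(\<lambda>t. prob {\<omega>\<in>space M. dist (behav X Y A pol t \<omega> $ a - pibar (X t \<omega>) $ a) 0 > 1 / real (Suc k)}) \<longlonglongrightarrow> 0"
      using policy_limit unfolding conv_in_prob_def by simp
    then have "P.prob (B k) \<le> 0"
      by (rule LIMSEQ_le_const) (use le in blast)
    then show ?thesis by (simp add: measure_le_0_iff)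
  qed
  have "AE z in P. \<forall>k. z \<notin> B k"
    unfolding AE_all_countable
    using B0 by (auto intro!: AE_not_in simp: P.emeasure_eq_measure null_sets_def)
  then show ?thesis
    using AE_space
  proof eventually_elim
    case (elim z)
    show "pimin \<le> pibar (fst z) $ a"
    proof (rule ccontr)
      assume "\<not> ?thesis"
      then obtain k where "1 / real (Suc k) < pimin - pibar (fst z) $ a"
        using nat_approx_posE[of "pimin - pibar (fst z) $ a"] by auto
      then have "pibar (fst z) $ a < pimin - 1 / real (Suc k)" by linarith
      then have "z \<in> B k" using elim unfolding B_def by blast
      then show False using elim by blast
    qed
  qed
qed

text \<open>One null set serves all rounds, so that the lower bounds can be used pathwise inside
  sums over \<open>t\<close>.\<close>

lemma sample_overlap:
  "AE \<omega> in M. \<forall>t\<ge>1. pimin \<le> behav X Y A pol t \<omega> $ a \<and> pimin \<le> pibar (X t \<omega>) $ a"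
proof -
  have "AE \<omega> in M. t \<ge> 1 \<longrightarrow> pimin \<le> behav X Y A pol t \<omega> $ a \<and> pimin \<le> pibar (X t \<omega>) $ a" for t
  proof (cases "t \<ge> 1")
    case True
    have XY: "(\<lambda>\<omega>. (X t \<omega>, Y t \<omega>)) \<in> measurable M (ctx_space S \<Otimes>\<^sub>M borel)"
      using measurable_context[OF True] measurable_outcomes[OF True] by simp
    have "AE z in distr M (ctx_space S \<Otimes>\<^sub>M borel) (\<lambda>\<omega>. (X t \<omega>, Y t \<omega>)). pimin \<le> pibar (fst z) $ a"
      unfolding iid_law[OF True] by (rule pibar_overlap)
    from AE_distrD[OF XY this] overlap[OF True] show ?thesis
      by eventually_elim simp
  qed simp
  then show ?thesis by (simp add: AE_all_countable)
qed

section \<open>Distance of the behavior policy from its limit\<close>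

definition drift :: "nat \<Rightarrow> 'w \<Rightarrow> real" where
  "drift t \<omega> = \<bar>behav X Y A pol t \<omega> $ a - pibar (X t \<omega>) $ a\<bar>"

lemma prob_simplex_nth: "p \<in> prob_simplex \<Longrightarrow> 0 \<le> p $ b \<and> p $ b \<le> 1"
  unfolding prob_simplex_def
  using member_le_sum[of b UNIV "\<lambda>b. p $ b"] by auto

lemma drift_le_1: "t \<ge> 1 \<Longrightarrow> \<omega> \<in> space M \<Longrightarrow> drift t \<omega> \<le> 1"
  using prob_simplex_nth[OF behav_simplex, of t \<omega> a] prob_simplex_nth[OF pibar_simplex[OF context_in_S], of t \<omega> a]
  unfolding drift_def by linarith

lemma measurable_drift: "t \<ge> 1 \<Longrightarrow> drift t \<in> borel_measurable M"
  using policy_limit unfolding drift_def[abs_def] conv_in_prob_def by auto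

text \<open>Convergence in probability becomes L1 convergence because the drift is at most one: it
  is below \<open>e\<close> off an event whose probability vanishes.\<close>

lemma drift_mean: "(\<lambda>t. \<integral>\<omega>. drift t \<omega> \<partial>M) \<longlonglongrightarrow> 0"
proof (rule tendsto_zero_upto_eps)
  show "0 \<le> (\<integral>\<omega>. drift t \<omega> \<partial>M)" for t
    by (simp add: drift_def)
  fix e :: real assume e: "e > 0"
  define E where "E t = {\<omega>\<in>space M. dist (behav X Y A pol t \<omega> $ a - pibar (X t \<omega>) $ a) 0 > e}" for t
  have lim: "(\<lambda>t. prob (E t)) \<longlonglongrightarrow> 0"
    using policy_limit e unfolding conv_in_prob_def E_def by blast
  have "(\<integral>\<omega>. drift t \<omega> \<partial>M) \<le> e + prob (E t)" if t: "t \<ge> 1" for t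
  proof -
    have [measurable]: "(\<lambda>\<omega>. behav X Y A pol t \<omega> $ a - pibar (X t \<omega>) $ a) \<in> borel_measurable M"
      using policy_limit t unfolding conv_in_prob_def by blast
    have E [measurable]: "E t \<in> events" unfolding E_def by measurable
    have "(\<integral>\<omega>. drift t \<omega> \<partial>M) \<le> (\<integral>\<omega>. e + indicator (E t) \<omega> \<partial>M)"
    proof (rule integral_mono)
      show "integrable M (drift t)"
        by (rule integrable_const_bound[where B=1])
          (use drift_le_1[OF t] measurable_drift[OF t] in \<open>auto simp: drift_def\<close>)
      show "drift t \<omega> \<le> e + indicator (E t) \<omega>" if "\<omega> \<in> space M" for \<omega>
        using drift_le_1[OF t that] that e
        by (cases "\<omega> \<in> E t") (auto simp: E_def drift_def dist_real_def)
    qed (use E in \<open>auto simp: emeasure_eq_measure\<close>)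
    also have "\<dots> = e + prob (E t)"
      using E by (subst Bochner_Integration.integral_add) (auto simp: prob_space emeasure_eq_measure)
    finally show ?thesis .
  qed
  then show "\<exists>r. r \<longlonglongrightarrow> 0 \<and> (\<forall>\<^sub>F t in sequentially. (\<integral>\<omega>. drift t \<omega> \<partial>M) \<le> e + r t)"
    using lim by (intro exI[of _ "\<lambda>t. prob (E t)"] conjI eventually_sequentiallyI[of 1])
qed

text \<open>The drift is a function of X_t and the history, so the change of measure removes the
  weight here as well.\<close>

lemma ipw_drift_sample:
  assumes h: "arm_integrable h" and t: "t \<ge> 1"
  shows "integrable M (\<lambda>\<omega>. drift t \<omega> * h (X t \<omega>) (Y t \<omega> $ a))"
    and "integrable M (\<lambda>\<omega>. ipw t \<omega> * (drift t \<omega> * h (X t \<omega>) (Y t \<omega> $ a)))"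
    and "(\<integral>\<omega>. ipw t \<omega> * (drift t \<omega> * h (X t \<omega>) (Y t \<omega> $ a)) \<partial>M) =
      (\<integral>\<omega>. drift t \<omega> * h (X t \<omega>) (Y t \<omega> $ a) \<partial>M)"
proof -
  show int: "integrable M (\<lambda>\<omega>. drift t \<omega> * h (X t \<omega>) (Y t \<omega> $ a))"
  proof (rule Bochner_Integration.integrable_bound[OF arm_sample(1)[OF h t]])
    show "(\<lambda>\<omega>. drift t \<omega> * h (X t \<omega>) (Y t \<omega> $ a)) \<in> borel_measurable M"
      using measurable_drift[OF t] arm_sample(1)[OF h t] by auto
    show "AE \<omega> in M. norm (drift t \<omega> * h (X t \<omega>) (Y t \<omega> $ a)) \<le> norm (h (X t \<omega>) (Y t \<omega> $ a))"
    proof (rule AE_I2)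
      fix \<omega> assume \<omega>: "\<omega> \<in> space M"
      have "\<bar>drift t \<omega>\<bar> * \<bar>h (X t \<omega>) (Y t \<omega> $ a)\<bar> \<le> 1 * \<bar>h (X t \<omega>) (Y t \<omega> $ a)\<bar>"
        using drift_le_1[OF t \<omega>] by (intro mult_right_mono) (auto simp: drift_def)
      then show "norm (drift t \<omega> * h (X t \<omega>) (Y t \<omega> $ a)) \<le> norm (h (X t \<omega>) (Y t \<omega> $ a))"
        by (simp add: abs_mult)
    qed
  qed
  define D where "D u = \<bar>pol t (fst u) (snd u) $ a - pibar (fst u) $ a\<bar>" for u
  have D: "drift t \<omega> = D (X t \<omega>, hist X Y A pol (t - 1) \<omega>)" for \<omega>
    by (simp add: drift_def D_def behav_def)
  have D_meas: "D \<in> borel_measurable (ctx_space S \<Otimes>\<^sub>M hist_space S (t - 1))"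
    unfolding D_def[abs_def]
    by (intro borel_measurable_abs borel_measurable_diff measurable_policy_nth[OF t]
        measurable_compose[OF measurable_fst measurable_pibar_nth])
  have f: "(\<lambda>z. D (fst z) * h (fst (fst z)) (snd z $ a)) \<in> borel_measurable ((ctx_space S \<Otimes>\<^sub>M hist_space S (t - 1)) \<Otimes>\<^sub>M borel)"
    by (intro borel_measurable_times measurable_arm_full[OF h] measurable_compose[OF measurable_fst D_meas])
  note tr = ipw_transfer[OF t f, unfolded fst_conv snd_conv, folded D]
  show "integrable M (\<lambda>\<omega>. ipw t \<omega> * (drift t \<omega> * h (X t \<omega>) (Y t \<omega> $ a)))"
    unfolding tr(1) by (rule int)
  show "(\<integral>\<omega>. ipw t \<omega> * (drift t \<omega> * h (X t \<omega>) (Y t \<omega> $ a)) \<partial>M) =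
      (\<integral>\<omega>. drift t \<omega> * h (X t \<omega>) (Y t \<omega> $ a) \<partial>M)"
    by (rule tr(2))
qed

text \<open>Here \<open>h\<close> is only integrable, so it is clipped at a level \<open>b\<close>.
  The clipped part costs at most b times the mean drift, which vanishes; the rest costs at most its
  own mean, since the drift is at most one.\<close>

lemma drift_weighted_mean:
  assumes h: "arm_integrable h" and nonneg: "\<And>x r. x \<in> S \<Longrightarrow> 0 \<le> h x r"
  shows "(\<lambda>t. \<integral>\<omega>. ipw t \<omega> * (drift t \<omega> * h (X t \<omega>) (Y t \<omega> $ a)) \<partial>M) \<longlonglongrightarrow> 0"
proof -
  define f where "f t = (\<integral>\<omega>. drift t \<omega> * h (X t \<omega>) (Y t \<omega> $ a) \<partial>M)" for t
  \<comment> \<open>Round 0 is unconstrained, but \<open>tendsto_zero_upto_eps\<close> asks for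
    nonnegativity at every index, so the value there is replaced by 0.\<close>
  have "(\<lambda>t. if t \<ge> 1 then f t else 0) \<longlonglongrightarrow> 0"
  proof (rule tendsto_zero_upto_eps)
    show "0 \<le> (if t \<ge> 1 then f t else 0)" for t
      using nonneg context_in_S by (auto simp: f_def drift_def intro!: Bochner_Integration.integral_nonneg_AE AE_I2)
    fix e :: real assume e: "e > 0"
    have h_P: "integrable P (\<lambda>(x, y). h x (y $ a))" using h by (simp add: arm_integrable_def)
    obtain b where b: "b \<ge> 0"
      "(\<integral>z. \<bar>(\<lambda>(x, y). h x (y $ a)) z - clip b ((\<lambda>(x, y). h x (y $ a)) z)\<bar> \<partial>P) < e"
      using ex_clip_approx[OF h_P e] by auto
    define d where "d x r = \<bar>h x r - clip b (h x r)\<bar>" for x r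
    have d: "arm_integrable d"
      using integrable_abs[OF Bochner_Integration.integrable_diff[OF h_P arm_integrable_clip[OF h, unfolded arm_integrable_def]]]
      by (simp add: arm_integrable_def d_def split_def)
    have mean_d: "arm_mean d < e"
      using b(2) by (simp add: arm_mean_def d_def split_def)
    have "f t \<le> e + b * (\<integral>\<omega>. drift t \<omega> \<partial>M)" if t: "t \<ge> 1" for t
    proof -
      have int_drift: "integrable M (drift t)"
        by (rule integrable_const_bound[where B=1])
          (use drift_le_1[OF t] measurable_drift[OF t] in \<open>auto simp: drift_def\<close>)
      have "f t \<le> (\<integral>\<omega>. d (X t \<omega>) (Y t \<omega> $ a) + b * drift t \<omega> \<partial>M)"
        unfolding f_def
      proof (rule integral_mono)
        show "integrable M (\<lambda>\<omega>. drift t \<omega> * h (X t \<omega>) (Y t \<omega> $ a))"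
          by (rule ipw_drift_sample[OF h t])
        show "integrable M (\<lambda>\<omega>. d (X t \<omega>) (Y t \<omega> $ a) + b * drift t \<omega>)"
          using arm_sample(1)[OF d t] int_drift by auto
        fix \<omega> assume \<omega>: "\<omega> \<in> space M"
        let ?h = "h (X t \<omega>) (Y t \<omega> $ a)"
        have q: "0 \<le> drift t \<omega>" "drift t \<omega> \<le> 1" using drift_le_1[OF t \<omega>] by (auto simp: drift_def)
        have "?h \<le> d (X t \<omega>) (Y t \<omega> $ a) + b"
          using abs_clip_le[OF b(1), of ?h] by (simp add: d_def)
        then have "drift t \<omega> * ?h \<le> drift t \<omega> * (d (X t \<omega>) (Y t \<omega> $ a) + b)"
          using q by (intro mult_left_mono) auto
        also have "\<dots> \<le> d (X t \<omega>) (Y t \<omega> $ a) + b * drift t \<omega>"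
          using mult_right_mono[OF q(2), of "d (X t \<omega>) (Y t \<omega> $ a)"] by (simp add: d_def algebra_simps)
        finally show "drift t \<omega> * ?h \<le> d (X t \<omega>) (Y t \<omega> $ a) + b * drift t \<omega>" .
      qed
      also have "\<dots> = arm_mean d + b * (\<integral>\<omega>. drift t \<omega> \<partial>M)"
        using arm_sample[OF d t] int_drift by (subst Bochner_Integration.integral_add) auto
      finally show ?thesis using mean_d by linarith
    qed
    moreover have "(\<lambda>t. b * (\<integral>\<omega>. drift t \<omega> \<partial>M)) \<longlonglongrightarrow> b * 0"
      by (intro tendsto_mult tendsto_const drift_mean)
    ultimately show "\<exists>r. r \<longlonglongrightarrow> 0 \<and> (\<forall>\<^sub>F t in sequentially. (if t \<ge> 1 then f t else 0) \<le> e + r t)"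
      by (intro exI[of _ "\<lambda>t. b * (\<integral>\<omega>. drift t \<omega> \<partial>M)"] conjI eventually_sequentiallyI[of 1]) auto
  qed
  then show ?thesis
    by (rule Lim_transform_eventually)
      (auto simp: f_def ipw_drift_sample[OF h] intro!: eventually_sequentiallyI[of 1])
qed

lemma whp_drift:
  assumes h: "arm_integrable h" and nonneg: "\<And>x r. x \<in> S \<Longrightarrow> 0 \<le> h x r" and e: "e > 0"
  shows "whp M (\<lambda>T \<omega>. (1 / real T) * (\<Sum>t=1..T. ipw t \<omega> * (drift t \<omega> * h (X t \<omega>) (Y t \<omega> $ a))) \<le> e)"
proof (rule whp_Markov[OF _ _ _ e])
  fix T :: nat
  note int = ipw_drift_sample(2)[OF h]
  show "integrable M (\<lambda>\<omega>. (1 / real T) * (\<Sum>t=1..T. ipw t \<omega> * (drift t \<omega> * h (X t \<omega>) (Y t \<omega> $ a))))"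
    by (intro integrable_mult_right Bochner_Integration.integrable_sum int) auto
  show "AE \<omega> in M. 0 \<le> (1 / real T) * (\<Sum>t=1..T. ipw t \<omega> * (drift t \<omega> * h (X t \<omega>) (Y t \<omega> $ a)))"
    using ipw_nonneg nonneg context_in_S
    by (intro AE_I2 mult_nonneg_nonneg sum_nonneg) (auto simp: drift_def)
next
  note int = ipw_drift_sample(2)[OF h]
  have "(\<lambda>T. (1 / real T) * (\<Sum>t=1..T. \<integral>\<omega>. ipw t \<omega> * (drift t \<omega> * h (X t \<omega>) (Y t \<omega> $ a)) \<partial>M)) \<longlonglongrightarrow> 0"
    by (intro tendsto_Cesaro_zero drift_weighted_mean h nonneg)
  also have "(\<lambda>T. (1 / real T) * (\<Sum>t=1..T. \<integral>\<omega>. ipw t \<omega> * (drift t \<omega> * h (X t \<omega>) (Y t \<omega> $ a)) \<partial>M)) =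
      (\<lambda>T. \<integral>\<omega>. (1 / real T) * (\<Sum>t=1..T. ipw t \<omega> * (drift t \<omega> * h (X t \<omega>) (Y t \<omega> $ a))) \<partial>M)"
    by (subst integral_mult_right_zero, subst Bochner_Integration.integral_sum) (auto intro!: int)
  finally show "(\<lambda>T. \<integral>\<omega>. (1 / real T) * (\<Sum>t=1..T. ipw t \<omega> * (drift t \<omega> * h (X t \<omega>) (Y t \<omega> $ a))) \<partial>M) \<longlonglongrightarrow> 0" .
qed

end

section \<open>M-estimation\<close>

lemma component_diff_le_norm: "\<bar>v $ i - w $ i\<bar> \<le> norm (v - w :: real^'n)"
  using component_le_norm_cart[of "v - w" i] by simp

lemma abs_le_one_plus_square: "\<bar>z\<bar> \<le> 1 + z\<^sup>2" for z :: real
proof -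
  have "0 \<le> (\<bar>z\<bar> - 1)\<^sup>2" by simp
  then have "2 * \<bar>z\<bar> \<le> 1 + z\<^sup>2" by (simp add: power2_diff)
  then show ?thesis using abs_ge_zero[of z] by linarith
qed

text \<open>The size of the factors is known only at the reference point (p', q'), hence the
  expansion around it and the quadratic term in \<open>e\<close>.\<close>

lemma abs_mult_diff_le:
  fixes p q p' q' :: real
  assumes "\<bar>p - p'\<bar> \<le> e" "\<bar>q - q'\<bar> \<le> e" "\<bar>p'\<bar> \<le> m" "\<bar>q'\<bar> \<le> m"
  shows "\<bar>p * q - p' * q'\<bar> \<le> e * (2 * m + e)"
proof -
  have e: "e \<ge> 0" and m: "m \<ge> 0" using assms by linarith+
  have "p * q - p' * q' = (p - p') * (q - q') + (p - p') * q' + p' * (q - q')"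
    by (simp add: algebra_simps)
  then have "\<bar>p * q - p' * q'\<bar> \<le> \<bar>p - p'\<bar> * \<bar>q - q'\<bar> + \<bar>p - p'\<bar> * \<bar>q'\<bar> + \<bar>p'\<bar> * \<bar>q - q'\<bar>"
    unfolding abs_mult[symmetric] by linarith
  also have "\<dots> \<le> e * e + e * m + m * e"
    using assms e m by (intro add_mono mult_mono) auto
  finally show ?thesis by (simp add: algebra_simps)
qed

locale bandit_m_estimation = stable_ipw_bandit M S P X Y A pol a pimin pibar
  for M :: "'w measure" and S :: "(real^'x) set" and P :: "((real^'x) \<times> (real^'k)) measure"
    and X :: "nat \<Rightarrow> 'w \<Rightarrow> real^'x" and Y :: "nat \<Rightarrow> 'w \<Rightarrow> real^'k" and A :: "nat \<Rightarrow> 'w \<Rightarrow> 'k"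
    and pol :: "nat \<Rightarrow> ('x::finite, 'k::finite) policy" and a :: 'k and pimin :: real
    and pibar :: "real^'x \<Rightarrow> real^'k" +
  fixes g :: "('x, 'd::finite) score" and \<theta>star :: "real^'d" and R\<theta> \<epsilon>0 :: real
    and \<phi> \<Phi> :: "real^'x \<Rightarrow> real \<Rightarrow> real" and \<theta>hat :: "nat \<Rightarrow> 'w \<Rightarrow> real^'d"
  assumes g_measurable:
      "\<And>\<theta>. (\<lambda>(x, y). g x y \<theta>) \<in> borel_measurable (ctx_space S \<Otimes>\<^sub>M borel)"
    and well_separated:
      "\<And>\<epsilon>. \<epsilon> > 0 \<Longrightarrow>
         (INF \<theta>\<in>{\<theta>. norm (\<theta> - \<theta>star) > \<epsilon>}. norm (\<integral>(x, y). g x (y $ a) \<theta> \<partial>P)) > 0"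
    and \<theta>star_bound: "norm \<theta>star < R\<theta>"
    and fourth_moment: "integrable P (\<lambda>(x, y). (norm (g x (y $ a) \<theta>star)) ^ 4)"
    and g_twice: "\<And>x y. x \<in> S \<Longrightarrow> twice_differentiable (g x y)"
    and jacobian_bound:
      "\<And>x y \<theta>. x \<in> S \<Longrightarrow> norm \<theta> \<le> R\<theta> \<Longrightarrow> spectral_norm (jacobian (g x y) (at \<theta>)) \<le> \<phi> x y"
    and \<phi>_moment: "integrable P (\<lambda>(x, y). (\<phi> x (y $ a))\<^sup>2)"
    and \<epsilon>0_pos: "\<epsilon>0 > 0"
    and hessian_bound:
      "\<And>x y \<theta> i. x \<in> S \<Longrightarrow> norm (\<theta> - \<theta>star) \<le> \<epsilon>0 \<Longrightarrow>
         spectral_norm (hessian (\<lambda>\<eta>. g x y \<eta> $ i) \<theta>) \<le> \<Phi> x y"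
    and \<Phi>_moment: "integrable P (\<lambda>(x, y). \<Phi> x (y $ a))"
    and \<theta>hat_measurable: "\<And>T. T \<ge> 1 \<Longrightarrow> \<theta>hat T \<in> borel_measurable M"
    and \<theta>hat_bound: "\<And>T. T \<ge> 1 \<Longrightarrow> AE \<omega> in M. norm (\<theta>hat T \<omega>) \<le> R\<theta>"
    and \<theta>hat_root:
      "small_o_prob M (score_hat g X Y A pol a \<theta>hat) (\<lambda>T. 1 / sqrt (real T))"
begin

lemma g_differentiable: "x \<in> S \<Longrightarrow> g x r differentiable at \<theta>"
  and jacobian_differentiable: "x \<in> S \<Longrightarrow> (\<lambda>\<theta>. jacobian (g x r) (at \<theta>)) differentiable at \<theta>"
  using g_twice unfolding twice_differentiable_def by auto

lemma measurable_g_nth: "(\<lambda>(x, r). g x r \<theta> $ i) \<in> borel_measurable (ctx_space S \<Otimes>\<^sub>M borel)"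
  using g_measurable[of \<theta>] by (simp add: borel_measurable_vec_iff split_def)

lemma measurable_g_norm: "(\<lambda>(x, r). norm (g x r \<theta>)) \<in> borel_measurable (ctx_space S \<Otimes>\<^sub>M borel)"
  using measurable_compose[OF g_measurable[of \<theta>] borel_measurable_norm] by (simp add: split_def)

lemma measurable_jacobian_nth:
  "(\<lambda>(x, r). jacobian (g x r) (at \<theta>) $ i $ j) \<in> borel_measurable (ctx_space S \<Otimes>\<^sub>M borel)"
proof -
  have "(\<lambda>z. jacobian (\<lambda>\<theta>. g (fst z) (snd z) \<theta>) (at \<theta>)) \<in> borel_measurable (ctx_space S \<Otimes>\<^sub>M borel)"
  proof (rule borel_measurable_jacobian)
    show "(\<lambda>z. g (fst z) (snd z) \<theta>) \<in> borel_measurable (ctx_space S \<Otimes>\<^sub>M borel)" for \<theta>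
      using g_measurable[of \<theta>] by (simp add: split_def)
    show "(\<lambda>\<theta>. g (fst z) (snd z) \<theta>) differentiable at \<theta>" if "z \<in> space (ctx_space S \<Otimes>\<^sub>M borel)" for z :: "(real^'x) \<times> real"
      using that by (intro g_differentiable) (auto simp: space_pair_measure ctx_space_def space_restrict_space)
  qed
  then show ?thesis by (simp add: borel_measurable_vec_iff split_def)
qed

lemma \<phi>_nonneg: "x \<in> S \<Longrightarrow> 0 \<le> \<phi> x r"
  using order_trans[OF spectral_norm_nonneg jacobian_bound[of x \<theta>star r]] \<theta>star_bound by simp

lemma \<Phi>_nonneg: "x \<in> S \<Longrightarrow> 0 \<le> \<Phi> x r"
  using order_trans[OF spectral_norm_nonneg hessian_bound[of x \<theta>star r undefined]] \<epsilon>0_pos by simp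

lemma arm_\<phi>_square: "arm_integrable (\<lambda>x r. (\<phi> x r)\<^sup>2)"
  and arm_\<Phi>: "arm_integrable \<Phi>"
  and arm_g_fourth: "arm_integrable (\<lambda>x r. norm (g x r \<theta>star) ^ 4)"
  using \<phi>_moment \<Phi>_moment fourth_moment by (simp_all add: arm_integrable_def)

text \<open>Measurability is known for the square of \<phi> through its integrability; on
  \<open>S\<close> the function is nonnegative and thus the square root of its square.\<close>

lemma measurable_\<phi>: "(\<lambda>(x, r). \<phi> x r) \<in> borel_measurable (ctx_space S \<Otimes>\<^sub>M borel)"
proof -
  have "(\<lambda>z. sqrt ((\<lambda>(x, r). (\<phi> x r)\<^sup>2) z)) \<in> borel_measurable (ctx_space S \<Otimes>\<^sub>M borel)"
    by (rule measurable_compose[OF measurable_arm[OF arm_\<phi>_square]]) simp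
  then show ?thesis
    by (subst measurable_cong[where g="\<lambda>z. sqrt ((\<lambda>(x, r). (\<phi> x r)\<^sup>2) z)"])
      (auto simp: space_pair_measure ctx_space_def space_restrict_space \<phi>_nonneg)
qed

lemma arm_\<phi>: "arm_integrable \<phi>"
proof (rule arm_integrable_bound[OF arm_integrable_add[OF arm_integrable_const[of 1] arm_\<phi>_square] measurable_\<phi>])
  show "\<bar>\<phi> x r\<bar> \<le> 1 + (\<phi> x r)\<^sup>2" for x r
    by (rule abs_le_one_plus_square)
qed

lemma arm_g_square: "arm_integrable (\<lambda>x r. (norm (g x r \<theta>star))\<^sup>2)"
proof (rule arm_integrable_bound[OF arm_integrable_add[OF arm_integrable_const[of 1] arm_g_fourth]])
  show "(\<lambda>(x, r). (norm (g x r \<theta>star))\<^sup>2) \<in> borel_measurable (ctx_space S \<Otimes>\<^sub>M borel)"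
    using borel_measurable_power[OF measurable_g_norm[of \<theta>star], of 2] by (simp add: split_def)
  show "\<bar>(norm (g x r \<theta>star))\<^sup>2\<bar> \<le> 1 + norm (g x r \<theta>star) ^ 4" for x r
    using abs_le_one_plus_square[of "(norm (g x r \<theta>star))\<^sup>2"] by simp
qed

lemma g_Lipschitz:
  assumes "x \<in> S" "norm \<theta> \<le> R\<theta>" "norm \<eta> \<le> R\<theta>"
  shows "\<bar>g x r \<theta> $ i - g x r \<eta> $ i\<bar> \<le> \<phi> x r * norm (\<theta> - \<eta>)"
proof -
  have "norm (g x r \<theta> - g x r \<eta>) \<le> \<phi> x r * norm (\<theta> - \<eta>)"
    by (rule norm_diff_le_spectral_norm[OF convex_cball[of 0 R\<theta>] g_differentiable[OF assms(1)]])
      (use assms jacobian_bound in auto)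
  then show ?thesis
    using component_diff_le_norm order_trans by blast
qed

text \<open>Integrability spreads from \<open>\<theta>star\<close> over the parameter ball through
  the Lipschitz bound with the integrable constant \<phi>.\<close>

lemma arm_g_nth:
  assumes "norm \<theta> \<le> R\<theta>"
  shows "arm_integrable (\<lambda>x r. g x r \<theta> $ i)"
proof (rule arm_integrable_bound[OF _ measurable_g_nth])
  show "arm_integrable (\<lambda>x r. (1 + (norm (g x r \<theta>star))\<^sup>2) + norm (\<theta> - \<theta>star) * \<phi> x r)"
    by (intro arm_integrable_add arm_integrable_cmult arm_\<phi> arm_g_square arm_integrable_const)
  fix x r assume x: "x \<in> S"
  have "\<bar>g x r \<theta>star $ i\<bar> \<le> norm (g x r \<theta>star)" by (rule component_le_norm_cart)
  also have "\<dots> \<le> 1 + (norm (g x r \<theta>star))\<^sup>2"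
    using abs_le_one_plus_square[of "norm (g x r \<theta>star)"] by simp
  finally show "\<bar>g x r \<theta> $ i\<bar> \<le> (1 + (norm (g x r \<theta>star))\<^sup>2) + norm (\<theta> - \<theta>star) * \<phi> x r"
    using g_Lipschitz[OF x assms, of \<theta>star r i] \<theta>star_bound by (simp add: mult.commute)
qed

lemma score_mean_nth:
  assumes "norm \<theta> \<le> R\<theta>"
  shows "(\<integral>(x, y). g x (y $ a) \<theta> \<partial>P) $ i = arm_mean (\<lambda>x r. g x r \<theta> $ i)"
proof -
  have "integrable P (\<lambda>z. g (fst z) (snd z $ a) \<theta>)"
    using arm_g_nth[OF assms] by (intro integrable_vec) (simp add: arm_integrable_def split_def)
  from integral_vec_nth[OF this, of i] show ?thesis
    by (simp add: arm_mean_def split_def)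
qed

text \<open>Passes from observable quantities to those of the arm: both sides vanish unless A_t = a,
  and then they coincide. The value type is general so that the rule serves scores and Jacobians
  alike.\<close>

lemma ipw_observed:
  fixes f :: "real^'x \<Rightarrow> real \<Rightarrow> 'b::real_vector"
  shows "(indicator {a} (A t \<omega>) / behav X Y A pol t \<omega> $ A t \<omega>) *\<^sub>R f (X t \<omega>) (observed Y A t \<omega>) =
    ipw t \<omega> *\<^sub>R f (X t \<omega>) (Y t \<omega> $ a)"
  by (cases "A t \<omega> = a") (auto simp: ipw_def observed_def)

lemma score_hat_nth: "score_hat g X Y A pol a \<theta>hat T \<omega> $ i = avg (\<lambda>x r. g x r (\<theta>hat T \<omega>) $ i) T \<omega>"
  by (simp only: score_hat_def avg_def ipw_observed[where f="\<lambda>x r. g x r (\<theta>hat T \<omega>)"]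
      vector_scaleR_component sum_component real_scaleR_def)

lemma G_hat_nth:
  "G_hat g X Y A pol a \<theta>hat T \<omega> $ i $ j = avg (\<lambda>x r. jacobian (g x r) (at (\<theta>hat T \<omega>)) $ i $ j) T \<omega>"
  by (simp only: G_hat_def avg_def ipw_observed[where f="\<lambda>x r. jacobian (g x r) (at (\<theta>hat T \<omega>))"]
      vector_scaleR_component sum_component real_scaleR_def)

text \<open>Of the two inverse probabilities one becomes the weight \<open>ipw\<close>, the other
  stays with the summand, to be replaced by its limit later.\<close>

lemma I_hat_nth:
  "I_hat g X Y A pol a \<theta>hat T \<omega> $ i $ j = (1 / real T) *
    (\<Sum>t=1..T. ipw t \<omega> * (1 / behav X Y A pol t \<omega> $ a *
      (g (X t \<omega>) (Y t \<omega> $ a) (\<theta>hat T \<omega>) $ i * g (X t \<omega>) (Y t \<omega> $ a) (\<theta>hat T \<omega>) $ j)))"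
proof -
  have "(indicator {a} (A t \<omega>) / (behav X Y A pol t \<omega> $ A t \<omega>)\<^sup>2) *
        (g (X t \<omega>) (observed Y A t \<omega>) (\<theta>hat T \<omega>) $ i * g (X t \<omega>) (observed Y A t \<omega>) (\<theta>hat T \<omega>) $ j) =
      ipw t \<omega> * (1 / behav X Y A pol t \<omega> $ a *
        (g (X t \<omega>) (Y t \<omega> $ a) (\<theta>hat T \<omega>) $ i * g (X t \<omega>) (Y t \<omega> $ a) (\<theta>hat T \<omega>) $ j))" for t
    by (cases "A t \<omega> = a") (auto simp: ipw_def observed_def power2_eq_square)
  then show ?thesis
    by (simp add: I_hat_def outer_def)
qed

lemma whp_\<theta>hat_bound: "whp M (\<lambda>T \<omega>. norm (\<theta>hat T \<omega>) \<le> R\<theta>)"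
  by (rule whp_AE[OF \<theta>hat_bound])

lemma whp_score_hat:
  assumes "e > 0"
  shows "whp M (\<lambda>T \<omega>. norm (score_hat g X Y A pol a \<theta>hat T \<omega>) \<le> e)"
proof (rule whp_mono)
  show "whp M (\<lambda>T \<omega>. dist (inverse (1 / sqrt (real T)) *\<^sub>R score_hat g X Y A pol a \<theta>hat T \<omega>) 0 \<le> e)"
    using \<theta>hat_root assms unfolding small_o_prob_def by (rule whp_conv_in_prob)
  show "\<forall>\<^sub>F T in sequentially. \<forall>\<omega>\<in>space M.
      dist (inverse (1 / sqrt (real T)) *\<^sub>R score_hat g X Y A pol a \<theta>hat T \<omega>) 0 \<le> e \<longrightarrow>
      norm (score_hat g X Y A pol a \<theta>hat T \<omega>) \<le> e"
  proof (intro eventually_sequentiallyI[of 1] ballI impI)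
    fix T :: nat and \<omega> assume T: "1 \<le> T"
      and *: "dist (inverse (1 / sqrt (real T)) *\<^sub>R score_hat g X Y A pol a \<theta>hat T \<omega>) 0 \<le> e"
    \<comment> \<open>The inverse rate is the square root of T, which is at least one, so the
      rescaled score dominates the score.\<close>
    have "1 * norm (score_hat g X Y A pol a \<theta>hat T \<omega>) \<le> sqrt (real T) * norm (score_hat g X Y A pol a \<theta>hat T \<omega>)"
      using T by (intro mult_right_mono) auto
    then show "norm (score_hat g X Y A pol a \<theta>hat T \<omega>) \<le> e"
      using * by simp
  qed
qed

text \<open>The score averages are Lipschitz in the parameter with constant the average of \<open>\<phi>\<close>, so a finite
  net of the parameter ball turns the pointwise law of large numbers into a uniform one.\<close>

proposition consistency:
  assumes \<delta>: "\<delta> > 0"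
  shows "whp M (\<lambda>T \<omega>. norm (\<theta>hat T \<omega> - \<theta>star) \<le> \<delta>)"
proof -
  define m where "m \<theta> = (\<integral>(x, y). g x (y $ a) \<theta> \<partial>P)" for \<theta>
  define c where "c = (INF \<theta>\<in>{\<theta>. norm (\<theta> - \<theta>star) > \<delta>}. norm (m \<theta>))"
  have c: "c > 0" using well_separated[OF \<delta>] by (simp add: c_def m_def)
  have sep: "c \<le> norm (m \<theta>)" if "norm (\<theta> - \<theta>star) > \<delta>" for \<theta>
    unfolding c_def by (rule cINF_lower) (use that in \<open>auto intro: bdd_belowI[of _ 0]\<close>)
  \<comment> \<open>Each coordinate of the mean score collects four errors of size \<eta>. Summing
    over the coordinates in the l1 bound gives 4c/5, strictly below the separation constant
    c.\<close>
  define \<eta> where "\<eta> = c / (5 * real CARD('d))"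
  have \<eta>: "\<eta> > 0" using c by (simp add: \<eta>_def)
  have mean_\<phi>: "arm_mean \<phi> \<ge> 0" by (rule arm_mean_nonneg) (rule \<phi>_nonneg)
  \<comment> \<open>The mesh of the net makes the Lipschitz error equal to \<eta>. The added 1
    leaves room for the average of \<phi> to exceed its mean, and keeps the denominator
    positive.\<close>
  define r where "r = \<eta> / (arm_mean \<phi> + 1)"
  have r: "r > 0" and r_\<eta>: "r * (arm_mean \<phi> + 1) = \<eta>"
    using \<eta> mean_\<phi> by (simp_all add: r_def)
  obtain K :: "(real^'d) set" where K: "finite K" "K \<subseteq> cball 0 R\<theta>" "cball 0 R\<theta> \<subseteq> (\<Union>\<kappa>\<in>K. ball \<kappa> r)"
    using seq_compact_imp_totally_bounded[OF compact_imp_seq_compact[OF compact_cball[of "0::real^'d" R\<theta>]], rule_format, OF r]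
    by blast
  have net: "whp M (\<lambda>T \<omega>. \<forall>\<kappa>\<in>K. \<forall>i\<in>UNIV. \<bar>avg (\<lambda>x r. g x r \<kappa> $ i) T \<omega> - arm_mean (\<lambda>x r. g x r \<kappa> $ i)\<bar> \<le> \<eta>)"
  proof (rule whp_ball[OF K(1)], rule whp_ball[OF finite])
    show "whp M (\<lambda>T \<omega>. \<bar>avg (\<lambda>x r. g x r \<kappa> $ i) T \<omega> - arm_mean (\<lambda>x r. g x r \<kappa> $ i)\<bar> \<le> \<eta>)"
      if \<kappa>: "\<kappa> \<in> K" for \<kappa> i
    proof -
      have "norm \<kappa> \<le> R\<theta>" using subsetD[OF K(2) \<kappa>] by simp
      then show ?thesis by (rule whp_avg[OF arm_g_nth \<eta>])
    qed
  qed
  have "whp M (\<lambda>T \<omega>. (\<forall>\<kappa>\<in>K. \<forall>i\<in>UNIV. \<bar>avg (\<lambda>x r. g x r \<kappa> $ i) T \<omega> - arm_mean (\<lambda>x r. g x r \<kappa> $ i)\<bar> \<le> \<eta>) \<and>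
      avg \<phi> T \<omega> \<le> arm_mean \<phi> + 1 \<and> norm (score_hat g X Y A pol a \<theta>hat T \<omega>) \<le> \<eta> \<and> norm (\<theta>hat T \<omega>) \<le> R\<theta>)"
    by (rule whp_conj[OF net whp_conj[OF whp_avg_bounded[OF arm_\<phi>] whp_conj[OF whp_score_hat[OF \<eta>] whp_\<theta>hat_bound]]])
  then show ?thesis
  proof (rule whp_mono, intro always_eventually allI ballI impI)
    fix T \<omega> assume \<omega>: "\<omega> \<in> space M"
      and *: "(\<forall>\<kappa>\<in>K. \<forall>i\<in>UNIV. \<bar>avg (\<lambda>x r. g x r \<kappa> $ i) T \<omega> - arm_mean (\<lambda>x r. g x r \<kappa> $ i)\<bar> \<le> \<eta>) \<and>
      avg \<phi> T \<omega> \<le> arm_mean \<phi> + 1 \<and> norm (score_hat g X Y A pol a \<theta>hat T \<omega>) \<le> \<eta> \<and> norm (\<theta>hat T \<omega>) \<le> R\<theta>"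
    define \<theta> where "\<theta> = \<theta>hat T \<omega>"
    have \<theta>R: "norm \<theta> \<le> R\<theta>" using * by (simp add: \<theta>_def)
    then obtain \<kappa> where \<kappa>: "\<kappa> \<in> K" "norm (\<kappa> - \<theta>) < r"
      using K(3) by (force simp: dist_norm)
    have \<kappa>R: "norm \<kappa> \<le> R\<theta>" using K(2) \<kappa>(1) by auto
    have lip: "\<bar>g x s \<kappa> $ i - g x s \<theta> $ i\<bar> \<le> r * \<phi> x s" if "x \<in> S" for x s i
      using g_Lipschitz[OF that \<kappa>R \<theta>R, of s i] mult_left_mono[OF less_imp_le[OF \<kappa>(2)] \<phi>_nonneg[OF that, of s]]
      by (simp add: mult.commute)
    \<comment> \<open>The path from the mean score at \<theta> to zero: mean at the net point,
      sample average at the net point, sample average at \<theta>, and that last average is a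
      coordinate of the estimating equation.\<close>
    have "\<bar>m \<theta> $ i\<bar> \<le> 4 * \<eta>" for i
    proof -
      have "\<bar>arm_mean (\<lambda>x r. g x r \<kappa> $ i) - arm_mean (\<lambda>x r. g x r \<theta> $ i)\<bar> \<le> arm_mean (\<lambda>x s. r * \<phi> x s)"
        by (intro abs_arm_mean_diff_le arm_g_nth \<kappa>R \<theta>R arm_integrable_cmult arm_\<phi> lip)
      also have "\<dots> = r * arm_mean \<phi>"
        by (simp add: arm_mean_def split_def)
      also have "\<dots> \<le> \<eta>"
        using r r_\<eta> by (simp add: algebra_simps)
      finally have 1: "\<bar>arm_mean (\<lambda>x r. g x r \<kappa> $ i) - arm_mean (\<lambda>x r. g x r \<theta> $ i)\<bar> \<le> \<eta>" .
      have "\<bar>avg (\<lambda>x s. g x s \<kappa> $ i - g x s \<theta> $ i) T \<omega>\<bar> \<le> avg (\<lambda>x s. r * \<phi> x s) T \<omega>"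
        by (intro abs_avg_le[OF \<omega>] lip)
      also have "\<dots> \<le> r * (arm_mean \<phi> + 1)"
        unfolding avg_cmult using * r by (intro mult_left_mono) auto
      finally have 2: "\<bar>avg (\<lambda>x s. g x s \<kappa> $ i) T \<omega> - avg (\<lambda>x s. g x s \<theta> $ i) T \<omega>\<bar> \<le> \<eta>"
        by (simp only: avg_diff r_\<eta>)
      have 3: "\<bar>avg (\<lambda>x s. g x s \<kappa> $ i) T \<omega> - arm_mean (\<lambda>x r. g x r \<kappa> $ i)\<bar> \<le> \<eta>"
        using * \<kappa>(1) by auto
      have "\<bar>avg (\<lambda>x s. g x s \<theta> $ i) T \<omega>\<bar> \<le> norm (score_hat g X Y A pol a \<theta>hat T \<omega>)"
        unfolding \<theta>_def score_hat_nth[symmetric] by (rule component_le_norm_cart)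
      then have 4: "\<bar>avg (\<lambda>x s. g x s \<theta> $ i) T \<omega>\<bar> \<le> \<eta>"
        using * by linarith
      show ?thesis
        unfolding m_def score_mean_nth[OF \<theta>R] using 1 2 3 4 by linarith
    qed
    then have "norm (m \<theta>) \<le> (\<Sum>i\<in>(UNIV::'d set). 4 * \<eta>)"
      by (intro order_trans[OF norm_le_l1_cart] sum_mono)
    also have "\<dots> = 4 / 5 * c" by (simp add: \<eta>_def)
    finally have "norm (m \<theta>) < c" using c by simp
    then show "norm (\<theta>hat T \<omega> - \<theta>star) \<le> \<delta>"
      using sep[of \<theta>] unfolding \<theta>_def by linarith
  qed
qed

section \<open>Limit of the Jacobian averages\<close>

lemma arm_jacobian_nth: "arm_integrable (\<lambda>x r. jacobian (g x r) (at \<theta>star) $ i $ j)"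
proof (rule arm_integrable_bound[OF arm_\<phi> measurable_jacobian_nth])
  show "\<bar>jacobian (g x r) (at \<theta>star) $ i $ j\<bar> \<le> \<phi> x r" if "x \<in> S" for x r
    using abs_entry_le_spectral_norm jacobian_bound[OF that, of \<theta>star r] \<theta>star_bound
    by (meson less_imp_le order_trans)
qed

lemma J_mat_nth: "J_mat P g a \<theta>star $ i $ j = arm_mean (\<lambda>x r. jacobian (g x r) (at \<theta>star) $ i $ j)"
proof -
  have row: "integrable P (\<lambda>z. jacobian (g (fst z) (snd z $ a)) (at \<theta>star) $ i)" for i
    using arm_jacobian_nth by (intro integrable_vec) (simp add: arm_integrable_def split_def)
  show ?thesis
    using integral_vec_nth[OF row, of i j] integral_vec_nth[OF integrable_vec[OF row], of i]
    by (simp add: J_mat_def arm_mean_def split_def)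
qed

text \<open>Near \<open>\<theta>star\<close> the Jacobian entries are Lipschitz with constant
  \<Phi>, so by consistency moving the parameter from the estimator to \<open>\<theta>star\<close>
  costs at most \<delta> times the average of \<Phi>. The law of large numbers at the fixed
  \<open>\<theta>star\<close> gives the rest.\<close>

lemma whp_G_hat:
  assumes e: "e > 0"
  shows "whp M (\<lambda>T \<omega>. \<bar>G_hat g X Y A pol a \<theta>hat T \<omega> $ i $ j - J_mat P g a \<theta>star $ i $ j\<bar> \<le> e)"
proof -
  define J where "J x r = jacobian (g x r) (at \<theta>star) $ i $ j" for x r
  have mean_\<Phi>: "arm_mean \<Phi> \<ge> 0" by (rule arm_mean_nonneg) (rule \<Phi>_nonneg)
  \<comment> \<open>The first bound keeps the estimator where the Hessians are controlled; the
    second makes the Lipschitz error at most e/2.\<close>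
  define \<delta> where "\<delta> = min \<epsilon>0 (e / 2 / (arm_mean \<Phi> + 1))"
  have \<delta>: "\<delta> > 0" "\<delta> \<le> \<epsilon>0" and "\<delta> \<le> e / 2 / (arm_mean \<Phi> + 1)"
    using e mean_\<Phi> \<epsilon>0_pos by (auto simp: \<delta>_def)
  then have \<delta>_e: "\<delta> * (arm_mean \<Phi> + 1) \<le> e / 2"
    using mean_\<Phi> by (intro pos_le_divide_eq[THEN iffD1]) auto
  have "whp M (\<lambda>T \<omega>. norm (\<theta>hat T \<omega> - \<theta>star) \<le> \<delta> \<and> avg \<Phi> T \<omega> \<le> arm_mean \<Phi> + 1 \<and>
      \<bar>avg J T \<omega> - arm_mean J\<bar> \<le> e / 2)"
    unfolding J_def
    by (intro whp_conj consistency \<delta> whp_avg_bounded arm_\<Phi> whp_avg arm_jacobian_nth) (use e in simp)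
  then show ?thesis
  proof (rule whp_mono, intro always_eventually allI ballI impI)
    fix T \<omega> assume \<omega>: "\<omega> \<in> space M"
      and *: "norm (\<theta>hat T \<omega> - \<theta>star) \<le> \<delta> \<and> avg \<Phi> T \<omega> \<le> arm_mean \<Phi> + 1 \<and>
      \<bar>avg J T \<omega> - arm_mean J\<bar> \<le> e / 2"
    define Jh where "Jh x r = jacobian (g x r) (at (\<theta>hat T \<omega>)) $ i $ j" for x r
    have "\<bar>Jh x r - J x r\<bar> \<le> \<delta> * \<Phi> x r" if x: "x \<in> S" for x r
    proof -
      have "\<bar>Jh x r - J x r\<bar> \<le> \<Phi> x r * norm (\<theta>hat T \<omega> - \<theta>star)"
        unfolding Jh_def J_def
      proof (rule jacobian_Lipschitz[OF g_twice[OF x] convex_cball[of \<theta>star \<epsilon>0]])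
        show "spectral_norm (hessian (\<lambda>\<eta>. g x r \<eta> $ i) \<theta>) \<le> \<Phi> x r" if "\<theta> \<in> cball \<theta>star \<epsilon>0" for \<theta> i
          using hessian_bound[OF x, of \<theta> r i] that by (simp add: dist_norm norm_minus_commute)
      qed (use * \<delta> \<epsilon>0_pos in \<open>auto simp: dist_norm norm_minus_commute\<close>)
      also have "\<dots> \<le> \<Phi> x r * \<delta>"
        using * \<Phi>_nonneg[OF x] by (intro mult_left_mono) auto
      finally show ?thesis by (simp add: mult.commute)
    qed
    then have "\<bar>avg (\<lambda>x r. Jh x r - J x r) T \<omega>\<bar> \<le> avg (\<lambda>x r. \<delta> * \<Phi> x r) T \<omega>"
      by (rule abs_avg_le[OF \<omega>])
    also have "\<dots> \<le> \<delta> * (arm_mean \<Phi> + 1)"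
      unfolding avg_cmult using * \<delta> by (intro mult_left_mono) auto
    finally have "\<bar>avg Jh T \<omega> - avg J T \<omega>\<bar> \<le> e / 2"
      using \<delta>_e by (simp add: avg_diff)
    then show "\<bar>G_hat g X Y A pol a \<theta>hat T \<omega> $ i $ j - J_mat P g a \<theta>star $ i $ j\<bar> \<le> e"
      using * unfolding G_hat_nth J_mat_nth J_def[symmetric] Jh_def[symmetric] by linarith
  qed
qed

section \<open>Limit of the second-moment averages\<close>

definition opg :: "'d \<Rightarrow> 'd \<Rightarrow> real^'x \<Rightarrow> real \<Rightarrow> real" where
  "opg i j x r = g x r \<theta>star $ i * g x r \<theta>star $ j"

lemma abs_opg_le: "\<bar>opg i j x r\<bar> \<le> (norm (g x r \<theta>star))\<^sup>2"
  unfolding opg_def abs_mult power2_eq_square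
  by (intro mult_mono component_le_norm_cart) auto

lemma measurable_opg: "(\<lambda>(x, r). opg i j x r) \<in> borel_measurable (ctx_space S \<Otimes>\<^sub>M borel)"
  using borel_measurable_times[OF measurable_g_nth[of \<theta>star i] measurable_g_nth[of \<theta>star j]]
  by (simp add: opg_def split_def)

text \<open>The overlap of the limit policy holds only almost surely, hence the truncation of its
  probability at \<open>pimin\<close>.\<close>

definition limit_opg :: "'d \<Rightarrow> 'd \<Rightarrow> real^'x \<Rightarrow> real \<Rightarrow> real" where
  "limit_opg i j x r = 1 / max pimin (pibar x $ a) * opg i j x r"

lemma arm_limit_opg: "arm_integrable (limit_opg i j)"
proof (rule arm_integrable_bound[OF arm_integrable_cmult[OF arm_g_square, of "1 / pimin"]])
  have "(\<lambda>z. 1 / max pimin (pibar (fst z) $ a) * opg i j (fst z) (snd z)) \<in> borel_measurable (ctx_space S \<Otimes>\<^sub>M borel)"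
    using measurable_opg[of i j] measurable_compose[OF measurable_fst measurable_pibar_nth[of a]]
    by (intro borel_measurable_times borel_measurable_divide borel_measurable_max) (auto simp: split_def)
  then show "(\<lambda>(x, r). limit_opg i j x r) \<in> borel_measurable (ctx_space S \<Otimes>\<^sub>M borel)"
    by (simp add: limit_opg_def split_def)
  show "\<bar>limit_opg i j x r\<bar> \<le> 1 / pimin * (norm (g x r \<theta>star))\<^sup>2" for x r
    unfolding limit_opg_def abs_mult
    by (intro mult_mono abs_opg_le) (use pimin_pos in \<open>auto simp: frac_le\<close>)
qed

text \<open>The truncation in \<open>limit_opg\<close> is invisible to the integral, because pibar
  is almost surely at least pimin.\<close>

lemma I_bar_nth: "I_bar P g pibar a \<theta>star $ i $ j = arm_mean (limit_opg i j)"
proof -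
  define F where "F z = (\<chi> i j. limit_opg i j (fst z) (snd z $ a))" for z :: "(real^'x) \<times> (real^'k)"
  have row: "integrable P (\<lambda>z. F z $ i)" for i
    using arm_limit_opg by (intro integrable_vec) (simp add: arm_integrable_def F_def split_def)
  have F: "integrable P F" by (rule integrable_vec[OF row])
  have eq: "AE z in P. (1 / pibar (fst z) $ a) *\<^sub>R outer (g (fst z) (snd z $ a) \<theta>star) (g (fst z) (snd z $ a) \<theta>star) = F z"
    using pibar_overlap
    by eventually_elim (simp add: vec_eq_iff outer_def F_def limit_opg_def opg_def max_absorb2)
  have [measurable]: "(\<lambda>z. pibar (fst z) $ a) \<in> borel_measurable P"
    using measurable_compose[OF measurable_fst measurable_pibar_nth[of a]] measurable_cong_sets[OF sets_P refl]
    by blast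
  have g_P: "(\<lambda>z. g (fst z) (snd z $ a) \<theta>star $ i) \<in> borel_measurable P" for i
    using arm_g_nth[of \<theta>star i] \<theta>star_bound by (auto simp: arm_integrable_def split_def)
  have "I_bar P g pibar a \<theta>star = (\<integral>z. F z \<partial>P)"
    unfolding I_bar_def split_def
  proof (rule integral_cong_AE[OF _ _ eq])
    show "(\<lambda>z. (1 / pibar (fst z) $ a) *\<^sub>R outer (g (fst z) (snd z $ a) \<theta>star) (g (fst z) (snd z $ a) \<theta>star)) \<in> borel_measurable P"
      using g_P by (simp add: borel_measurable_vec_iff outer_def)
  qed (use F in auto)
  then show ?thesis
    using integral_vec_nth[OF row, of i j] integral_vec_nth[OF F, of i]
    by (simp add: arm_mean_def split_def F_def)
qed

text \<open>Three errors of e/3 each: the estimator is replaced by \<open>\<theta>star\<close> in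
  the product of scores, 1/pi_t by 1/pibar, and the remaining average of \<open>limit_opg\<close> by
  its mean.\<close>

lemma whp_I_hat:
  assumes e: "e > 0"
  shows "whp M (\<lambda>T \<omega>. \<bar>I_hat g X Y A pol a \<theta>hat T \<omega> $ i $ j - I_bar P g pibar a \<theta>star $ i $ j\<bar> \<le> e)"
proof -
  \<comment> \<open>With n the norm of the score at \<open>\<theta>star\<close>, the perturbed
    product brings in 2 \<phi> n + \<phi>^2, and 2 \<phi> n is at most \<phi>^2 + n^2. This bound
    consists of integrable squares.\<close>
  define \<psi> where "\<psi> x r = (\<phi> x r)\<^sup>2 + 1 * (norm (g x r \<theta>star))\<^sup>2 + 1 * (\<phi> x r)\<^sup>2" for x r
  have \<psi>: "arm_integrable \<psi>"
    unfolding \<psi>_def[abs_def] by (intro arm_integrable_add arm_integrable_cmult arm_\<phi>_square arm_g_square)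
  have mean_\<psi>: "arm_mean \<psi> \<ge> 0" by (rule arm_mean_nonneg) (simp add: \<psi>_def)
  \<comment> \<open>The bound 1 makes the quadratic error term linear in \<delta>. The second keeps
    the estimator in the ball on which \<phi> is a Lipschitz constant. The third absorbs the factor
    1/pimin left by the remaining inverse probability.\<close>
  define \<delta> where "\<delta> = min (min 1 (R\<theta> - norm \<theta>star)) (pimin * (e / 3) / (arm_mean \<psi> + 1))"
  have \<delta>: "\<delta> > 0" "\<delta> \<le> 1" "\<delta> \<le> R\<theta> - norm \<theta>star" and "\<delta> \<le> pimin * (e / 3) / (arm_mean \<psi> + 1)"
    using e mean_\<psi> pimin_pos \<theta>star_bound by (auto simp: \<delta>_def)
  then have \<delta>_e: "\<delta> * (arm_mean \<psi> + 1) \<le> pimin * (e / 3)"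
    using mean_\<psi> by (intro pos_le_divide_eq[THEN iffD1]) auto
  \<comment> \<open>The drift is required to be small at level pimin^2 * (e/3), since the difference
    of 1/pi_t and 1/pibar is at most the drift divided by pimin^2.\<close>
  have "whp M (\<lambda>T \<omega>. norm (\<theta>hat T \<omega> - \<theta>star) \<le> \<delta> \<and> avg \<psi> T \<omega> \<le> arm_mean \<psi> + 1 \<and>
      \<bar>avg (limit_opg i j) T \<omega> - arm_mean (limit_opg i j)\<bar> \<le> e / 3 \<and>
      (1 / real T) * (\<Sum>t=1..T. ipw t \<omega> * (drift t \<omega> * (norm (g (X t \<omega>) (Y t \<omega> $ a) \<theta>star))\<^sup>2)) \<le> pimin\<^sup>2 * (e / 3) \<and>
      (\<forall>t\<ge>1. pimin \<le> behav X Y A pol t \<omega> $ a \<and> pimin \<le> pibar (X t \<omega>) $ a))"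
    by (intro whp_conj consistency \<delta> whp_avg_bounded \<psi> whp_avg arm_limit_opg whp_drift[OF arm_g_square] whp_AE sample_overlap)
      (use e pimin_pos in auto)
  then show ?thesis
  proof (rule whp_mono, intro always_eventually allI ballI impI)
    fix T \<omega> assume \<omega>: "\<omega> \<in> space M"
      and *: "norm (\<theta>hat T \<omega> - \<theta>star) \<le> \<delta> \<and> avg \<psi> T \<omega> \<le> arm_mean \<psi> + 1 \<and>
      \<bar>avg (limit_opg i j) T \<omega> - arm_mean (limit_opg i j)\<bar> \<le> e / 3 \<and>
      (1 / real T) * (\<Sum>t=1..T. ipw t \<omega> * (drift t \<omega> * (norm (g (X t \<omega>) (Y t \<omega> $ a) \<theta>star))\<^sup>2)) \<le> pimin\<^sup>2 * (e / 3) \<and>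
      (\<forall>t\<ge>1. pimin \<le> behav X Y A pol t \<omega> $ a \<and> pimin \<le> pibar (X t \<omega>) $ a)"
    define \<theta> where "\<theta> = \<theta>hat T \<omega>"
    define p where "p t = behav X Y A pol t \<omega> $ a" for t
    define Gh where "Gh x r = g x r \<theta> $ i * g x r \<theta> $ j" for x r
    have near: "norm (\<theta> - \<theta>star) \<le> \<delta>" using * by (simp add: \<theta>_def)
    have \<theta>R: "norm \<theta> \<le> R\<theta>"
      using norm_triangle_ineq[of "\<theta> - \<theta>star" \<theta>star] near \<delta>(3) by simp
    have p: "pimin \<le> p t" "pimin \<le> pibar (X t \<omega>) $ a" if "t \<ge> 1" for t
      using * that by (auto simp: p_def)
    have Gh: "\<bar>Gh x r - opg i j x r\<bar> \<le> \<delta> * \<psi> x r" if x: "x \<in> S" for x r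
    proof -
      define n where "n = norm (g x r \<theta>star)"
      have \<phi>0: "\<phi> x r \<ge> 0" by (rule \<phi>_nonneg[OF x])
      have comp: "\<bar>g x r \<theta> $ k - g x r \<theta>star $ k\<bar> \<le> \<delta> * \<phi> x r" for k
        using g_Lipschitz[OF x \<theta>R, of \<theta>star r k] \<theta>star_bound mult_left_mono[OF near \<phi>0]
        by (simp add: mult.commute)
      have "\<bar>Gh x r - opg i j x r\<bar> \<le> (\<delta> * \<phi> x r) * (2 * n + \<delta> * \<phi> x r)"
        unfolding Gh_def opg_def n_def by (intro abs_mult_diff_le comp component_le_norm_cart)
      also have "\<dots> \<le> (\<delta> * \<phi> x r) * (2 * n + 1 * \<phi> x r)"
        using \<delta> \<phi>0 by (intro mult_left_mono add_left_mono mult_right_mono) auto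
      also have "\<dots> = \<delta> * (2 * \<phi> x r * n + (\<phi> x r)\<^sup>2)"
        by (simp add: algebra_simps power2_eq_square)
      also have "\<dots> \<le> \<delta> * \<psi> x r"
        using \<delta>(1) zero_le_power2[of "\<phi> x r - n"]
        by (intro mult_left_mono) (simp_all add: \<psi>_def n_def power2_diff)
      finally show ?thesis .
    qed
    have "\<bar>I_hat g X Y A pol a \<theta>hat T \<omega> $ i $ j -
          (1 / real T) * (\<Sum>t=1..T. ipw t \<omega> * (1 / p t * opg i j (X t \<omega>) (Y t \<omega> $ a)))\<bar> =
        (1 / real T) * \<bar>\<Sum>t=1..T. ipw t \<omega> * (1 / p t * (Gh (X t \<omega>) (Y t \<omega> $ a) - opg i j (X t \<omega>) (Y t \<omega> $ a)))\<bar>"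
      unfolding I_hat_nth \<theta>_def[symmetric] p_def[symmetric] Gh_def
        right_diff_distrib[symmetric] sum_subtractf[symmetric]
      by (simp add: abs_mult)
    also have "\<dots> \<le> (1 / real T) * (\<Sum>t=1..T. ipw t \<omega> * (\<delta> / pimin * \<psi> (X t \<omega>) (Y t \<omega> $ a)))"
    proof (intro mult_left_mono order_trans[OF sum_abs] sum_mono)
      fix t assume "t \<in> {1..T}"
      then have t: "t \<ge> 1" by simp
      have "\<bar>1 / p t * (Gh (X t \<omega>) (Y t \<omega> $ a) - opg i j (X t \<omega>) (Y t \<omega> $ a))\<bar> \<le>
          1 / pimin * (\<delta> * \<psi> (X t \<omega>) (Y t \<omega> $ a))"
        unfolding abs_mult using p(1)[OF t] pimin_pos
        by (intro mult_mono Gh context_in_S t \<omega>) (auto simp: frac_le)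
      from mult_left_mono[OF this ipw_nonneg[OF t \<omega>]]
      show "\<bar>ipw t \<omega> * (1 / p t * (Gh (X t \<omega>) (Y t \<omega> $ a) - opg i j (X t \<omega>) (Y t \<omega> $ a)))\<bar> \<le>
          ipw t \<omega> * (\<delta> / pimin * \<psi> (X t \<omega>) (Y t \<omega> $ a))"
        unfolding abs_mult[of "ipw t \<omega>"] abs_of_nonneg[OF ipw_nonneg[OF t \<omega>]] by simp
    qed simp
    also have "\<dots> = \<delta> / pimin * avg \<psi> T \<omega>"
      unfolding avg_cmult[symmetric] by (simp add: avg_def)
    also have "\<dots> \<le> \<delta> / pimin * (arm_mean \<psi> + 1)"
      using * \<delta> pimin_pos by (intro mult_left_mono) auto
    also have "\<dots> \<le> e / 3"
      using \<delta>_e pimin_pos by (simp add: pos_divide_le_eq mult.commute)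
    finally have 1: "\<bar>I_hat g X Y A pol a \<theta>hat T \<omega> $ i $ j -
          (1 / real T) * (\<Sum>t=1..T. ipw t \<omega> * (1 / p t * opg i j (X t \<omega>) (Y t \<omega> $ a)))\<bar> \<le> e / 3" .
    have "\<bar>(1 / real T) * (\<Sum>t=1..T. ipw t \<omega> * (1 / p t * opg i j (X t \<omega>) (Y t \<omega> $ a))) - avg (limit_opg i j) T \<omega>\<bar> =
        (1 / real T) * \<bar>\<Sum>t=1..T. ipw t \<omega> * (1 / p t * opg i j (X t \<omega>) (Y t \<omega> $ a) - limit_opg i j (X t \<omega>) (Y t \<omega> $ a))\<bar>"
      unfolding avg_def right_diff_distrib[symmetric] sum_subtractf[symmetric]
      by (simp add: abs_mult)
    also have "\<dots> \<le> (1 / real T) * (\<Sum>t=1..T. ipw t \<omega> * (1 / pimin\<^sup>2 * (drift t \<omega> * (norm (g (X t \<omega>) (Y t \<omega> $ a) \<theta>star))\<^sup>2)))"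
    proof (intro mult_left_mono order_trans[OF sum_abs] sum_mono)
      fix t assume "t \<in> {1..T}"
      then have t: "t \<ge> 1" by simp
      define q where "q = pibar (X t \<omega>) $ a"
      have q: "pimin \<le> q" "max pimin q = q" using p(2)[OF t] by (auto simp: q_def)
      have pos: "p t > 0" "q > 0" using p(1)[OF t] q pimin_pos by linarith+
      have "\<bar>1 / p t - 1 / q\<bar> = \<bar>p t - q\<bar> / (p t * q)"
        using pos by (simp add: abs_mult divide_simps abs_minus_commute split: abs_split)
      also have "\<dots> \<le> \<bar>p t - q\<bar> / pimin\<^sup>2"
        using p(1)[OF t] q pimin_pos pos unfolding power2_eq_square
        by (intro divide_left_mono mult_mono) auto
      finally have inv: "\<bar>1 / p t - 1 / q\<bar> \<le> 1 / pimin\<^sup>2 * drift t \<omega>"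
        by (simp add: drift_def p_def q_def)
      have "\<bar>1 / p t * opg i j (X t \<omega>) (Y t \<omega> $ a) - limit_opg i j (X t \<omega>) (Y t \<omega> $ a)\<bar> =
          \<bar>1 / p t - 1 / q\<bar> * \<bar>opg i j (X t \<omega>) (Y t \<omega> $ a)\<bar>"
        unfolding limit_opg_def q_def[symmetric] q(2) abs_mult[symmetric] by (simp add: algebra_simps)
      also have "\<dots> \<le> (1 / pimin\<^sup>2 * drift t \<omega>) * (norm (g (X t \<omega>) (Y t \<omega> $ a) \<theta>star))\<^sup>2"
        by (intro mult_mono inv abs_opg_le) (auto simp: drift_def)
      finally show "\<bar>ipw t \<omega> * (1 / p t * opg i j (X t \<omega>) (Y t \<omega> $ a) - limit_opg i j (X t \<omega>) (Y t \<omega> $ a))\<bar> \<le>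
          ipw t \<omega> * (1 / pimin\<^sup>2 * (drift t \<omega> * (norm (g (X t \<omega>) (Y t \<omega> $ a) \<theta>star))\<^sup>2))"
        unfolding abs_mult[of "ipw t \<omega>"] abs_of_nonneg[OF ipw_nonneg[OF t \<omega>]] mult.assoc
        by (intro mult_left_mono ipw_nonneg[OF t \<omega>])
    qed simp
    also have "\<dots> = 1 / pimin\<^sup>2 * ((1 / real T) * (\<Sum>t=1..T. ipw t \<omega> * (drift t \<omega> * (norm (g (X t \<omega>) (Y t \<omega> $ a) \<theta>star))\<^sup>2)))"
      by (simp add: sum_distrib_left mult_ac)
    also have "\<dots> \<le> 1 / pimin\<^sup>2 * (pimin\<^sup>2 * (e / 3))"
      using * by (intro mult_left_mono) auto
    also have "\<dots> = e / 3" using pimin_pos by simp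
    finally have 2: "\<bar>(1 / real T) * (\<Sum>t=1..T. ipw t \<omega> * (1 / p t * opg i j (X t \<omega>) (Y t \<omega> $ a))) - avg (limit_opg i j) T \<omega>\<bar> \<le> e / 3" .
    show "\<bar>I_hat g X Y A pol a \<theta>hat T \<omega> $ i $ j - I_bar P g pibar a \<theta>star $ i $ j\<bar> \<le> e"
      using 1 2 * unfolding I_bar_nth by linarith
  qed
qed

section \<open>Measurability of the plug-in averages\<close>

lemma measurable_score_sample:
  "t \<ge> 1 \<Longrightarrow> (\<lambda>\<omega>. g (X t \<omega>) (observed Y A t \<omega>) \<theta>) \<in> borel_measurable M"
  using measurable_compose[OF measurable_Pair[OF measurable_context measurable_observed] g_measurable[of \<theta>]]
  by simp

text \<open>\<open>conv_in_prob\<close> demands measurable estimators. The score is measurable at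
  fixed parameters and continuous in the parameter, so a random parameter may be
  substituted.\<close>

lemma measurable_score_plugin:
  assumes "T \<ge> 1" "t \<ge> 1"
  shows "(\<lambda>\<omega>. g (X t \<omega>) (observed Y A t \<omega>) (\<theta>hat T \<omega>)) \<in> borel_measurable M"
proof (rule borel_measurable_Caratheodory[OF measurable_score_sample[OF assms(2)] _ \<theta>hat_measurable[OF assms(1)]])
  show "isCont (\<lambda>\<theta>. g (X t \<omega>) (observed Y A t \<omega>) \<theta>) \<theta>" if "\<omega> \<in> space M" for \<omega> \<theta>
    using g_differentiable[OF context_in_S[OF assms(2) that]] by (rule differentiable_imp_continuous_within)
qed

lemma measurable_jacobian_plugin:
  assumes "T \<ge> 1" "t \<ge> 1"
  shows "(\<lambda>\<omega>. jacobian (g (X t \<omega>) (observed Y A t \<omega>)) (at (\<theta>hat T \<omega>))) \<in> borel_measurable M"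
proof (rule borel_measurable_Caratheodory[OF _ _ \<theta>hat_measurable[OF assms(1)]])
  show "(\<lambda>\<omega>. jacobian (g (X t \<omega>) (observed Y A t \<omega>)) (at \<theta>)) \<in> borel_measurable M" for \<theta>
    by (rule borel_measurable_jacobian)
      (use measurable_score_sample[OF assms(2)] g_differentiable[OF context_in_S[OF assms(2)]] in auto)
  show "isCont (\<lambda>\<theta>. jacobian (g (X t \<omega>) (observed Y A t \<omega>)) (at \<theta>)) \<theta>" if "\<omega> \<in> space M" for \<omega> \<theta>
    using jacobian_differentiable[OF context_in_S[OF assms(2) that]] by (rule differentiable_imp_continuous_within)
qed

lemma measurable_action_indicator: "t \<ge> 1 \<Longrightarrow> (\<lambda>\<omega>. indicator {a} (A t \<omega>) :: real) \<in> borel_measurable M"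
  by (rule measurable_compose[OF action_measurable]) simp_all

lemma measurable_action_prob:
  assumes t: "t \<ge> 1"
  shows "(\<lambda>\<omega>. behav X Y A pol t \<omega> $ A t \<omega>) \<in> borel_measurable M"
proof (rule measurable_compose_countable'[where f="\<lambda>k \<omega>. behav X Y A pol t \<omega> $ k" and I=UNIV])
  show "(\<lambda>\<omega>. behav X Y A pol t \<omega> $ k) \<in> borel_measurable M" for k
    using measurable_behav[OF t] by (simp add: borel_measurable_vec_iff)
qed (use action_measurable[OF t] in \<open>auto simp: countable_finite\<close>)

lemma measurable_G_hat:
  assumes "T \<ge> 1"
  shows "G_hat g X Y A pol a \<theta>hat T \<in> borel_measurable M"
  unfolding G_hat_def[abs_def]
  by (intro borel_measurable_scaleR borel_measurable_const borel_measurable_sum borel_measurable_divide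
      measurable_jacobian_plugin measurable_action_indicator measurable_action_prob assms) auto

lemma measurable_I_hat:
  assumes "T \<ge> 1"
  shows "I_hat g X Y A pol a \<theta>hat T \<in> borel_measurable M"
proof -
  have "(\<lambda>\<omega>. outer (g (X t \<omega>) (observed Y A t \<omega>) (\<theta>hat T \<omega>)) (g (X t \<omega>) (observed Y A t \<omega>) (\<theta>hat T \<omega>)))
      \<in> borel_measurable M" if "t \<ge> 1" for t
    using measurable_score_plugin[OF assms that]
    by (auto simp: borel_measurable_vec_iff outer_def intro!: borel_measurable_times)
  then show ?thesis
    unfolding I_hat_def[abs_def]
    by (intro borel_measurable_scaleR borel_measurable_const borel_measurable_sum borel_measurable_divide
        borel_measurable_power measurable_action_indicator measurable_action_prob assms) auto
qed

text \<open>There are finitely many entries, so with high probability all of them are close to their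
  limits at once; continuity of the sandwich map at the invertible Jacobian turns this into
  closeness of the matrices.\<close>

theorem sandwich_consistent:
  assumes J: "invertible (J_mat P g a \<theta>star)"
  shows "conv_in_prob M
     (\<lambda>T \<omega>. sandwich (G_hat g X Y A pol a \<theta>hat T \<omega>) (I_hat g X Y A pol a \<theta>hat T \<omega>))
     (sandwich (J_mat P g a \<theta>star) (I_bar P g pibar a \<theta>star))"
proof (rule conv_in_probI)
  show "(\<lambda>\<omega>. sandwich (G_hat g X Y A pol a \<theta>hat T \<omega>) (I_hat g X Y A pol a \<theta>hat T \<omega>)) \<in> borel_measurable M"
    if "T \<ge> 1" for T
    by (intro borel_measurable_sandwich measurable_G_hat measurable_I_hat that)
  fix e :: real assume "e > 0"
  from sandwich_continuous[OF J this, of "I_bar P g pibar a \<theta>star"]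
  obtain r where r: "r > 0" "\<And>G I. (\<And>i j. \<bar>G $ i $ j - J_mat P g a \<theta>star $ i $ j\<bar> \<le> r) \<Longrightarrow>
      (\<And>i j. \<bar>I $ i $ j - I_bar P g pibar a \<theta>star $ i $ j\<bar> \<le> r) \<Longrightarrow>
      dist (sandwich G I) (sandwich (J_mat P g a \<theta>star) (I_bar P g pibar a \<theta>star)) \<le> e"
    by blast
  have "whp M (\<lambda>T \<omega>.
      (\<forall>i\<in>UNIV. \<forall>j\<in>UNIV. \<bar>G_hat g X Y A pol a \<theta>hat T \<omega> $ i $ j - J_mat P g a \<theta>star $ i $ j\<bar> \<le> r) \<and>
      (\<forall>i\<in>UNIV. \<forall>j\<in>UNIV. \<bar>I_hat g X Y A pol a \<theta>hat T \<omega> $ i $ j - I_bar P g pibar a \<theta>star $ i $ j\<bar> \<le> r))"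
    by (intro whp_conj whp_ball finite whp_G_hat whp_I_hat r)
  then show "whp M (\<lambda>T \<omega>. dist (sandwich (G_hat g X Y A pol a \<theta>hat T \<omega>) (I_hat g X Y A pol a \<theta>hat T \<omega>))
      (sandwich (J_mat P g a \<theta>star) (I_bar P g pibar a \<theta>star)) \<le> e)"
    by (rule whp_mono) (auto intro!: always_eventually r(2))
qed

end

theorem proposition3p4:
  fixes M :: "'w measure"
    and S :: "(real^'x) set"
    and P :: "((real^'x) \<times> (real^'k)) measure"
    and X :: "nat \<Rightarrow> 'w \<Rightarrow> real^'x"
    and Y :: "nat \<Rightarrow> 'w \<Rightarrow> real^'k"
    and A :: "nat \<Rightarrow> 'w \<Rightarrow> 'k"
    and pol :: "nat \<Rightarrow> ('x::finite, 'k::finite) policy"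
    and a :: 'k
    and g :: "('x, 'd::finite) score"
    and \<theta>star :: "real^'d"
    and R\<theta> M2 \<epsilon>0 pimin :: real
    and \<phi> \<Phi> :: "real^'x \<Rightarrow> real \<Rightarrow> real"
    and pibar :: "real^'x \<Rightarrow> real^'k"
    and \<theta>hat :: "nat \<Rightarrow> 'w \<Rightarrow> real^'d"
  assumes bandit: "contextual_bandit M S P X Y A pol"
    and g_measurable:
      "\<And>\<theta>. (\<lambda>(x, y). g x y \<theta>) \<in> borel_measurable (ctx_space S \<Otimes>\<^sub>M borel)"
    and root: "(\<integral>(x, y). g x (y $ a) \<theta>star \<partial>P) = 0"
    and unconfounded:
      "\<And>t. t \<ge> 1 \<Longrightarrow>
         cond_indep M (pre_action_algebra M S X Y A pol t) (count_space UNIV) (A t) borel (Y t)"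
    and well_separated:
      "\<And>\<epsilon>. \<epsilon> > 0 \<Longrightarrow>
         (INF \<theta>\<in>{\<theta>. norm (\<theta> - \<theta>star) > \<epsilon>}. norm (\<integral>(x, y). g x (y $ a) \<theta> \<partial>P)) > 0"
    and second_moment: "AE z in P. spectral_norm (cond_second_moment P S g a \<theta>star z) \<le> M2"
    and \<theta>star_bound: "norm \<theta>star < R\<theta>"
    and uniform_moment:
      "(SUP \<theta>\<in>{\<theta>. norm \<theta> \<le> R\<theta>}. \<integral>\<^sup>+(x, y). ennreal ((norm (g x (y $ a) \<theta>))\<^sup>2) \<partial>P) < \<infinity>"
    and fourth_moment: "integrable P (\<lambda>(x, y). (norm (g x (y $ a) \<theta>star)) ^ 4)"
    and g_twice: "\<And>x y. x \<in> S \<Longrightarrow> twice_differentiable (g x y)"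
    and J_nonsingular: "invertible (J_mat P g a \<theta>star)"
    and jacobian_bound:
      "\<And>x y \<theta>. x \<in> S \<Longrightarrow> norm \<theta> \<le> R\<theta> \<Longrightarrow> spectral_norm (jacobian (g x y) (at \<theta>)) \<le> \<phi> x y"
    and \<phi>_moment: "integrable P (\<lambda>(x, y). (\<phi> x (y $ a))\<^sup>2)"
    and \<epsilon>0_pos: "\<epsilon>0 > 0"
    and hessian_bound:
      "\<And>x y \<theta> i. x \<in> S \<Longrightarrow> norm (\<theta> - \<theta>star) \<le> \<epsilon>0 \<Longrightarrow>
         spectral_norm (hessian (\<lambda>\<eta>. g x y \<eta> $ i) \<theta>) \<le> \<Phi> x y"
    and \<Phi>_moment: "integrable P (\<lambda>(x, y). \<Phi> x (y $ a))"
    and pimin: "0 < pimin" "pimin < 1"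
    and overlap: "\<And>t. t \<ge> 1 \<Longrightarrow> AE \<omega> in M. pimin \<le> behav X Y A pol t \<omega> $ a"
    and pibar_measurable: "pibar \<in> borel_measurable (ctx_space S)"
    and pibar_simplex: "\<And>x. x \<in> S \<Longrightarrow> pibar x \<in> prob_simplex"
    and policy_limit:
      "conv_in_prob M (\<lambda>t \<omega>. behav X Y A pol t \<omega> $ a - pibar (X t \<omega>) $ a) 0"
    and \<theta>hat_measurable: "\<And>T. T \<ge> 1 \<Longrightarrow> \<theta>hat T \<in> borel_measurable M"
    and \<theta>hat_bound: "\<And>T. T \<ge> 1 \<Longrightarrow> AE \<omega> in M. norm (\<theta>hat T \<omega>) \<le> R\<theta>"
    and \<theta>hat_root:
      "small_o_prob M (score_hat g X Y A pol a \<theta>hat) (\<lambda>T. 1 / sqrt (real T))"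
  shows "conv_in_prob M
           (\<lambda>T \<omega>. sandwich (G_hat g X Y A pol a \<theta>hat T \<omega>) (I_hat g X Y A pol a \<theta>hat T \<omega>))
           (sandwich (J_mat P g a \<theta>star) (I_bar P g pibar a \<theta>star))"
proof -
  \<comment> \<open>The base locale comes first so that \<open>unfold_locales\<close> leaves only
    the assumptions of the later layers.\<close>
  interpret contextual_bandit M S P X Y A pol by (rule bandit)
  interpret bandit_m_estimation M S P X Y A pol a pimin pibar g \<theta>star R\<theta> \<epsilon>0 \<phi> \<Phi> \<theta>hat
    by unfold_locales (fact assms)+
  show ?thesis by (rule sandwich_consistent[OF J_nonsingular])
qed

end
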